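(* Let $G$ be a finite group and $V$ a faithful representation of $G$ of finite dimension $N\geq1$ over a field $\mathbf{k}$. If $$\gamma_{\mathrm{field}}(G,V)<\sqrt[N]{2|G|},$$ then $$\beta_{\mathrm{field}}(G,V)=\gamma_{\mathrm{field}}(G,V).$$ If moreover $G$ is abelian and $\operatorname{char}\mathbf{k}\nmid|G|$, then the same conclusion holds with $N$ replaced in the hypothesis by the number $m$ of distinct nontrivial characters of $G$ occurring in $V$ (assuming $m\geq1$): if $\gamma_{\mathrm{field}}(G,V)<\sqrt[m]{2|G|}$, then $\beta_{\mathrm{field}}(G,V)=\gamma_{\mathrm{field}}(G,V)$.
   Context: $\mathbf{k}[V]$ is the ring of polynomial functions on $V$, $\mathbf{k}(V)$ its fraction field, with $G$ acting by $(gf)(v)=f(g^{-1}v)$; $\mathbf{k}[V]^G$, $\mathbf{k}(V)^G$ are the invariants, and $\mathbf{k}[V]^G_{\leq d}$ is the space of invariant polynomials of degree at most $d$. $\beta_{\mathrm{field}}(G,V)$ is the least natural number $d$ such that $\mathbf{k}[V]^G_{\leq d}$ generates $\mathbf{k}(V)^G$ as a field extension of $\mathbf{k}$. $\gamma_{\mathrm{field}}(G,V)$ is the least natural number $d$ such that $\mathbf{k}(V)^G$ is a finite field extension of its subfield $\mathbf{k}(\mathbf{k}[V]^G_{\leq d})$. The characters occurring in $V$ means the characters occurring in $\mathbf{K}\otimes_{\mathbf{k}}V$, where $\mathbf{K}\supseteq\mathbf{k}$ is an extension field containing the $|G|$th roots of unity. *)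

theory Defs
  imports
    "HOL-Analysis.Analysis"
    "HOL-Library.Poly_Mapping"
    "HOL-Computational_Algebra.Computational_Algebra"
    "HOL-Algebra.Algebra"
    "HOL-Algebra.Algebraic_Closure_Type"
begin

no_notation fps_nth (infixl \<open>$\<close> 75)

text \<open>
  Conventions.  A representation of dimension \<open>N\<close> over the field \<open>'k\<close> is given, in coordinates, by
  matrices acting on column vectors in \<open>'k ^ 'n\<close>, where \<open>N = CARD('n)\<close>.  The coordinate ring
  \<open>k[V]\<close> is the (formal) polynomial ring in the coordinates \<open>x\<^sub>i\<close> with \<open>i :: 'n\<close>; over a finite
  field it must not be confused with a ring of set-theoretic functions.  A polynomial is a finitely
  supported map from exponent vectors to coefficients.  The index type is required to be linearly
  ordered only because the library derives the absence of zero divisors from a monomial order.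
\<close>

type_synonym ('n, 'k) mpoly = "('n \<Rightarrow>\<^sub>0 nat) \<Rightarrow>\<^sub>0 'k"

type_synonym ('k, 'n) sqmat = "(('k, 'n) vec, 'n) vec"

definition mconst :: "'k::comm_semiring_1 \<Rightarrow> ('n, 'k) mpoly" where
  "mconst c = Poly_Mapping.single 0 c"

definition mvar :: "'n \<Rightarrow> ('n, 'k::comm_semiring_1) mpoly" where
  "mvar i = Poly_Mapping.single (Poly_Mapping.single i 1) 1"

definition deg_le :: "('n::finite, 'k::zero) mpoly \<Rightarrow> nat \<Rightarrow> bool" where
  "deg_le f d \<longleftrightarrow> (\<forall>m \<in> Poly_Mapping.keys f. (\<Sum>i\<in>UNIV. Poly_Mapping.lookup m i) \<le> d)"

definition msubst ::
  "('n::finite \<Rightarrow> ('l, 'k::comm_semiring_1) mpoly) \<Rightarrow> ('n, 'k) mpoly \<Rightarrow> ('l, 'k) mpoly" where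
  "msubst s f = (\<Sum>m \<in> Poly_Mapping.keys f.
     mconst (Poly_Mapping.lookup f m) * (\<Prod>i\<in>UNIV. s i ^ Poly_Mapping.lookup m i))"

text \<open>The polynomial \<open>v \<mapsto> f (A v)\<close>.\<close>

definition mcompose :: "('k::comm_semiring_1, 'n) sqmat \<Rightarrow> ('n::finite, 'k) mpoly \<Rightarrow> ('n, 'k) mpoly" where
  "mcompose A f = msubst (\<lambda>i. \<Sum>j\<in>UNIV. mconst (A $ i $ j) * mvar j) f"

text \<open>
  The same operation on rational functions, \<open>(p/q)(A v) = p(A v)/q(A v)\<close>.  This is well defined for
  invertible \<open>A\<close>; see \<open>fcompose_Fract\<close> below.
\<close>

definition fcompose ::
  "('k::field, 'n) sqmat \<Rightarrow> ('n::{finite,linorder}, 'k) mpoly fract \<Rightarrow> ('n, 'k) mpoly fract" where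
  "fcompose A x = (THE y. \<exists>p q. q \<noteq> 0 \<and> x = Fract p q \<and> y = Fract (mcompose A p) (mcompose A q))"

lemma msubst_superset:
  assumes "finite S" "Poly_Mapping.keys f \<subseteq> S"
  shows "msubst s f = (\<Sum>m \<in> S. mconst (Poly_Mapping.lookup f m) *
           (\<Prod>i\<in>UNIV. s i ^ Poly_Mapping.lookup m i))"
  unfolding msubst_def using assms
  by (intro sum.mono_neutral_left) (auto simp: mconst_def in_keys_iff)

lemma mconst_add: "mconst (a + b) = mconst a + mconst b"
  by (simp add: mconst_def single_add)

lemma mconst_mult: "mconst (a * b) = mconst a * mconst b"
  by (simp add: mconst_def mult_single)

lemma msubst_0 [simp]: "msubst s 0 = 0"
  by (simp add: msubst_def)

lemma msubst_add: "msubst s (f + g) = msubst s f + msubst s g"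
proof -
  let ?S = "Poly_Mapping.keys f \<union> Poly_Mapping.keys g"
  have "Poly_Mapping.keys (f + g) \<subseteq> ?S" by (rule Poly_Mapping.keys_add)
  then show ?thesis
    by (simp add: msubst_superset[of ?S] lookup_add mconst_add algebra_simps sum.distrib)
qed

lemma msubst_sum: "msubst s (\<Sum>x\<in>A. f x) = (\<Sum>x\<in>A. msubst s (f x))"
  by (induction A rule: infinite_finite_induct) (auto simp: msubst_add)

lemma msubst_single: "msubst s (Poly_Mapping.single m c) =
    mconst c * (\<Prod>i\<in>UNIV. s i ^ Poly_Mapping.lookup m i)"
  by (subst msubst_superset[of "{m}"]) auto

lemma mpoly_sum_single: "(f :: ('n, 'k::comm_semiring_1) mpoly) =
    (\<Sum>m\<in>Poly_Mapping.keys f. Poly_Mapping.single m (Poly_Mapping.lookup f m))"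
  by (rule poly_mapping_eqI)
     (auto simp: lookup_sum lookup_single when_def in_keys_iff sum.delta')

lemma msubst_mult: "msubst s (f * g) = msubst s f * msubst s g"
proof -
  have "f * g = (\<Sum>m\<in>Poly_Mapping.keys f. \<Sum>l\<in>Poly_Mapping.keys g.
      Poly_Mapping.single (m + l) (Poly_Mapping.lookup f m * Poly_Mapping.lookup g l))"
    by (subst mpoly_sum_single[of f], subst mpoly_sum_single[of g])
       (simp add: sum_product mult_single)
  then have "msubst s (f * g) = (\<Sum>m\<in>Poly_Mapping.keys f. \<Sum>l\<in>Poly_Mapping.keys g.
      msubst s (Poly_Mapping.single m (Poly_Mapping.lookup f m)) *
      msubst s (Poly_Mapping.single l (Poly_Mapping.lookup g l)))"
    by (simp add: msubst_sum msubst_single lookup_add power_add prod.distrib mconst_mult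
        algebra_simps)
  also have "\<dots> = msubst s f * msubst s g"
    by (subst (3) mpoly_sum_single[of f], subst (3) mpoly_sum_single[of g])
       (simp add: msubst_sum sum_product)
  finally show ?thesis .
qed

lemma msubst_mconst [simp]: "msubst s (mconst c) = mconst c"
  by (simp add: mconst_def msubst_single[of s 0 c, unfolded mconst_def])

lemma msubst_1 [simp]: "msubst s 1 = 1"
  using msubst_mconst[of s 1] by (simp add: mconst_def)

lemma msubst_power: "msubst s (f ^ k) = msubst s f ^ k"
  by (induction k) (auto simp: msubst_mult)

lemma msubst_prod: "msubst s (\<Prod>x\<in>A. f x) = (\<Prod>x\<in>A. msubst s (f x))"
  by (induction A rule: infinite_finite_induct) (auto simp: msubst_mult)

lemma msubst_mvar [simp]: "msubst s (mvar i) = s i"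
proof -
  have "(\<Prod>j\<in>UNIV. s j ^ Poly_Mapping.lookup (Poly_Mapping.single i 1) j) =
        (\<Prod>j\<in>UNIV. if j = i then s i else 1)"
    by (rule prod.cong) (auto simp: lookup_single)
  then show ?thesis
    by (simp add: mvar_def msubst_single mconst_def)
qed

lemma msubst_msubst: "msubst t (msubst s f) = msubst (\<lambda>i. msubst t (s i)) f"
  by (simp add: msubst_def[of s f] msubst_sum msubst_mult msubst_prod msubst_power)
     (simp add: msubst_def)

lemma mvar_power: "(mvar i :: ('n, 'k::comm_semiring_1) mpoly) ^ k =
    Poly_Mapping.single (Poly_Mapping.single i k) 1"
  by (induction k) (auto simp: mvar_def mult_single simp flip: single_add)

lemma prod_single_one: "(\<Prod>i\<in>A. Poly_Mapping.single (m i) (1::'k::comm_semiring_1)) =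
    Poly_Mapping.single (\<Sum>i\<in>A. m i :: 'n \<Rightarrow>\<^sub>0 nat) 1"
  by (induction A rule: infinite_finite_induct) (auto simp: mult_single)

lemma msubst_mvar_id: "msubst mvar f = (f :: ('n::finite, 'k::comm_semiring_1) mpoly)"
proof -
  have *: "(\<Sum>i\<in>UNIV. Poly_Mapping.single i (Poly_Mapping.lookup m i)) = m" for m :: "'n::finite \<Rightarrow>\<^sub>0 nat"
    by (rule poly_mapping_eqI) (simp add: lookup_sum lookup_single when_def)
  have "msubst mvar f = (\<Sum>m\<in>Poly_Mapping.keys f. Poly_Mapping.single m (Poly_Mapping.lookup f m))"
    unfolding msubst_def mvar_power prod_single_one * by (simp add: mconst_def mult_single)
  then show ?thesis using mpoly_sum_single[of f] by simp
qed

lemma mconst_sum: "mconst (\<Sum>x\<in>S. h x) = (\<Sum>x\<in>S. mconst (h x))"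
  by (induction S rule: infinite_finite_induct) (auto simp: mconst_add, auto simp: mconst_def)

lemma mcompose_mcompose: "mcompose B (mcompose A f) = mcompose (A ** B) f"
proof -
  have *: "(\<Sum>j\<in>UNIV. mconst (A $ i $ j) * (\<Sum>l\<in>UNIV. mconst (B $ j $ l) * mvar l)) =
        (\<Sum>l\<in>UNIV. mconst ((A ** B) $ i $ l) * mvar l)" for i
    by (simp add: matrix_matrix_mult_def sum_distrib_left sum_distrib_right mconst_mult mconst_sum
          mult.assoc)
       (rule sum.swap)
  show ?thesis
    unfolding mcompose_def msubst_msubst by (simp add: msubst_sum msubst_mult *)
qed

lemma mcompose_mat_1: "mcompose (mat 1) f = (f :: ('n::finite, 'k::comm_semiring_1) mpoly)"
proof -
  have "(\<Sum>j\<in>UNIV. mconst (mat 1 $ i $ j) * mvar j) = (mvar i :: ('n, 'k) mpoly)" for i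
    by (subst sum.mono_neutral_right[of _ "{i}"]) (auto simp: mat_def mconst_def)
  then show ?thesis by (simp add: mcompose_def msubst_mvar_id)
qed

lemma mcompose_eq_0_iff:
  assumes "invertible A"
  shows "mcompose A f = 0 \<longleftrightarrow> f = 0"
proof
  obtain B where "A ** B = mat 1" using assms by (auto simp: invertible_def)
  then have "mcompose B (mcompose A f) = f" by (simp add: mcompose_mcompose mcompose_mat_1)
  then show "f = 0" if "mcompose A f = 0" using that by (simp add: mcompose_def)
qed (simp add: mcompose_def)

lemma fcompose_Fract:
  assumes "invertible A" "q \<noteq> 0"
  shows "fcompose A (Fract p q) = Fract (mcompose A p) (mcompose A q)"
  unfolding fcompose_def
proof (rule the_equality)
  fix y
  assume "\<exists>p' q'. q' \<noteq> 0 \<and> Fract p q = Fract p' q' \<and> y = Fract (mcompose A p') (mcompose A q')"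
  then obtain p' q' where *: "q' \<noteq> 0" "Fract p q = Fract p' q'"
    and y: "y = Fract (mcompose A p') (mcompose A q')" by blast
  from * have "p * q' = p' * q" using assms by (simp add: eq_fract)
  then have "mcompose A p * mcompose A q' = mcompose A p' * mcompose A q"
    by (simp add: mcompose_def flip: msubst_mult)
  then show "y = Fract (mcompose A p) (mcompose A q)"
    using assms * by (simp add: y eq_fract mcompose_eq_0_iff)
qed (use assms in auto)

definition GL_monoid :: "('k::field, 'n::finite) sqmat monoid" where
  "GL_monoid = \<lparr>carrier = {A. invertible A}, mult = (**), one = mat 1\<rparr>"

definition faithful_rep :: "('g, 'b) monoid_scheme \<Rightarrow> ('g \<Rightarrow> ('k::field, 'n::finite) sqmat) \<Rightarrow> bool" where
  "faithful_rep G \<rho> \<longleftrightarrow> \<rho> \<in> hom G GL_monoid \<and> inj_on \<rho> (carrier G)"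

text \<open>
  Invariants for the actions \<open>(g f)(v) = f (g\<^sup>-\<^sup>1 v)\<close> on \<open>k[V]\<close> and on its fraction field \<open>k(V)\<close>.
\<close>

definition poly_invariants_le ::
  "('g, 'b) monoid_scheme \<Rightarrow> ('g \<Rightarrow> ('k::field, 'n) sqmat) \<Rightarrow> nat \<Rightarrow> ('n::finite, 'k) mpoly set" where
  "poly_invariants_le G \<rho> d =
     {f. deg_le f d \<and> (\<forall>g\<in>carrier G. mcompose (\<rho> (inv\<^bsub>G\<^esub> g)) f = f)}"

definition field_invariants ::
  "('g, 'b) monoid_scheme \<Rightarrow> ('g \<Rightarrow> ('k::field, 'n) sqmat) \<Rightarrow> ('n::{finite,linorder}, 'k) mpoly fract set" where
  "field_invariants G \<rho> = {x. \<forall>g\<in>carrier G. fcompose (\<rho> (inv\<^bsub>G\<^esub> g)) x = x}"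

text \<open>
  The subfield \<open>k(k[V]\<^sup>G\<^bsub>\<le>d\<^esub>)\<close> of \<open>k(V)\<close>.  The constants need not be adjoined separately: they are
  invariants of degree \<open>0\<close>.
\<close>

definition inv_subfield ::
  "('g, 'b) monoid_scheme \<Rightarrow> ('g \<Rightarrow> ('k::field, 'n) sqmat) \<Rightarrow> nat \<Rightarrow> ('n::{finite,linorder}, 'k) mpoly fract set" where
  "inv_subfield G \<rho> d =
     generate_field ring_of_type_algebra ((\<lambda>f. Fract f 1) ` poly_invariants_le G \<rho> d)"

definition beta_field ::
  "('g, 'b) monoid_scheme \<Rightarrow> ('g \<Rightarrow> ('k::field, 'n::{finite,linorder}) sqmat) \<Rightarrow> nat" where
  "beta_field G \<rho> = (LEAST d. inv_subfield G \<rho> d = field_invariants G \<rho>)"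

definition gamma_field ::
  "('g, 'b) monoid_scheme \<Rightarrow> ('g \<Rightarrow> ('k::field, 'n::{finite,linorder}) sqmat) \<Rightarrow> nat" where
  "gamma_field G \<rho> =
     (LEAST d. ring.finite_dimension ring_of_type_algebra (inv_subfield G \<rho> d) (field_invariants G \<rho>))"

definition has_roots_of_unity :: "'K::field itself \<Rightarrow> nat \<Rightarrow> bool" where
  "has_roots_of_unity _ n \<longleftrightarrow>
     (\<exists>zs :: 'K list. Polynomial.monom 1 n - 1 = (\<Prod>z\<leftarrow>zs. [:- z, 1:]))"

text \<open>
  The distinct nontrivial characters \<open>c : G \<rightarrow> K\<^sup>\<times>\<close> occurring in \<open>K \<otimes> V\<close>, i.e. those having a nonzero
  eigenvector there; \<open>e\<close> is the embedding of \<open>k\<close> into \<open>K\<close>.  Characters are made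
  \<open>undefined\<close> outside the carrier, so that they are counted correctly.
\<close>

definition nontrivial_characters ::
  "('g, 'b) monoid_scheme \<Rightarrow> ('g \<Rightarrow> ('k::field, 'n::finite) sqmat) \<Rightarrow> ('k \<Rightarrow> 'K::field) \<Rightarrow> ('g \<Rightarrow> 'K) set" where
  "nontrivial_characters G \<rho> e =
     {c \<in> hom G (mult_of ring_of_type_algebra) \<inter> extensional (carrier G).
        (\<exists>g\<in>carrier G. c g \<noteq> 1) \<and>
        (\<exists>v. v \<noteq> 0 \<and> (\<forall>g\<in>carrier G. map_matrix e (\<rho> g) *v v = c g *s v))}"

end

(* Let d = gamma_field and let S be the set of invariants of degree at most d; all coordinates are
   algebraic over k(S). Counting monomials shows that at most d^N polynomials are linearly independent
   over k(S): a transcendence basis B of k(S) inside S has N elements, and r independent polynomials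
   times the monomials of degree at most t in B give r * binomial(t + N, N) elements, independent over
   k, in a space of dimension binomial(d t + c + N, N). On the other hand, if h has |G| distinct
   conjugates and u is an invariant outside k(S), then the 2 |G| elements h^i and u h^i with i < |G|
   are independent over k(S). Hence k(S) = k(V)^G as soon as d^N < 2 |G|.

   In the abelian case diagonalize over K. There the algebra generated by S is spanned by monomials,
   and mapping each variable to a representative with the same character reduces the count to one
   variable for each nontrivial character. The quotient of two variables with the same character lies
   in K(S), so all invariant monomials do. A k-linear functional K -> k applied to coefficients brings
   the resulting identity back to k. *)

theory Submission
  imports Defs
begin

section \<open>Algebras generated by a set over an embedded field\<close>

text \<open>The exponent of \<open>d\<close> is a transcendence degree, and \<open>d ^ N\<close> is
  a ratio of leading coefficients: both sides of the count are polynomials in \<open>t\<close> of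
  degree \<open>N\<close>, with leading coefficients \<open>r / N!\<close> and
  \<open>d ^ N / N!\<close>. The number \<open>2 |G|\<close> is the tower law seen from below:
  \<open>k(V)\<close> has degree \<open>|G|\<close> over \<open>k(V)^G\<close>, so a proper
  inclusion of \<open>k(S)\<close> in \<open>k(V)^G\<close> would force degree at least
  \<open>2 |G|\<close> over \<open>k(S)\<close>. Transcendence bases are compared by growth as well:
  if one set is algebraic over another, its monomials, multiplied by powers of fixed denominators,
  lie in spaces of comparable dimension. Since \<open>k\<close> may be finite, constants cannot be
  used to build \<open>h\<close>; powers of an invariant take their place. In the abelian case
  \<open>gamma_field\<close> speaks about \<open>k\<close> while the diagonal coordinates exist only
  over \<open>K\<close>, so algebraic dependence must first be carried up; this works because the
  old coordinates stay algebraic and the algebraic elements form a field.\<close>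

locale field_embedding =
  fixes \<epsilon> :: "'k::field \<Rightarrow> 'a::field"
  assumes hom_add: "\<epsilon> (a + b) = \<epsilon> a + \<epsilon> b"
    and hom_mult: "\<epsilon> (a * b) = \<epsilon> a * \<epsilon> b"
    and hom_1: "\<epsilon> 1 = 1"
begin

sublocale vs: vector_space "\<lambda>c x. \<epsilon> c * x"
  by unfold_locales (simp_all add: hom_add hom_mult hom_1 algebra_simps)

lemma hom_0: "\<epsilon> 0 = 0"
  using hom_add[of 0 0] by (metis add_cancel_left_left add.right_neutral)

lemma hom_eq_0_iff: "\<epsilon> c = 0 \<longleftrightarrow> c = 0"
  using vs.scale_eq_0_iff[of c 1] by simp

lemma hom_uminus: "\<epsilon> (- c) = - \<epsilon> c"
  using hom_add[of c "- c"] hom_0 by (simp add: eq_neg_iff_add_eq_0 add.commute)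

text \<open>The index bounds the number of factors taken from \<open>S\<close>, so the stages
  multiply like degrees even if the elements of \<open>S\<close> satisfy relations.\<close>

definition polys :: "'a set \<Rightarrow> nat \<Rightarrow> 'a set" where
  "polys S t = vs.span {prod_mset M |M. set_mset M \<subseteq> S \<and> size M \<le> t}"

definition alg :: "'a set \<Rightarrow> 'a set" where
  "alg S = vs.span {prod_mset M |M. set_mset M \<subseteq> S}"

definition rat :: "'a set \<Rightarrow> 'a set" where
  "rat S = {p / q |p q. p \<in> alg S \<and> q \<in> alg S \<and> q \<noteq> 0}"

text \<open>Algebraicity over the field \<open>rat S\<close> with denominators cleared: coefficients
  lie in the algebra, and the leading one is merely nonzero. Positivity of the degree is automatic,
  since \<open>n = 0\<close> would force \<open>c 0 = 0\<close>.\<close>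

definition alg_dep :: "'a set \<Rightarrow> 'a \<Rightarrow> bool" where
  "alg_dep S y \<longleftrightarrow> (\<exists>n c. (\<forall>l\<le>n. c l \<in> alg S) \<and> c n \<noteq> 0 \<and> (\<Sum>l\<le>n. c l * y ^ l) = 0)"

text \<open>The sums run over multisets and not over their products, so independence includes that
  distinct monomials are distinct elements.\<close>

definition alg_indep :: "'a set \<Rightarrow> bool" where
  "alg_indep B \<longleftrightarrow> (\<forall>A c. finite A \<longrightarrow> (\<forall>M\<in>A. set_mset M \<subseteq> B) \<longrightarrow>
     (\<Sum>M\<in>A. \<epsilon> (c M) * prod_mset M) = 0 \<longrightarrow> (\<forall>M\<in>A. c M = 0))"

lemma span_mult:
  assumes "x \<in> vs.span A" "y \<in> vs.span B" "\<And>a b. a \<in> A \<Longrightarrow> b \<in> B \<Longrightarrow> a * b \<in> vs.span C"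
  shows "x * y \<in> vs.span C"
proof -
  have *: "a * y \<in> vs.span C" if a: "a \<in> A" for a
    using assms(2)
  proof (induction rule: vs.span_induct_alt)
    case (step c b y)
    have "a * (\<epsilon> c * b + y) = \<epsilon> c * (a * b) + a * y" by (simp add: algebra_simps)
    then show ?case using step assms(3)[OF a] by (metis vs.span_add vs.span_scale)
  qed (simp add: vs.span_zero)
  show ?thesis using assms(1)
  proof (induction rule: vs.span_induct_alt)
    case (step c b x)
    have "(\<epsilon> c * b + x) * y = \<epsilon> c * (b * y) + x * y" by (simp add: algebra_simps)
    then show ?case using step * by (metis vs.span_add vs.span_scale)
  qed (simp add: vs.span_zero)
qed

lemma polys_mono: "S \<subseteq> T \<Longrightarrow> s \<le> t \<Longrightarrow> polys S s \<subseteq> polys T t"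
  unfolding polys_def by (rule vs.span_mono) fastforce

lemma polys_subset_alg: "polys S t \<subseteq> alg S"
  unfolding polys_def alg_def by (rule vs.span_mono) auto

lemma polys_add: "p \<in> polys S t \<Longrightarrow> q \<in> polys S t \<Longrightarrow> p + q \<in> polys S t"
  unfolding polys_def by (rule vs.span_add)

lemma polys_sum: "(\<And>i. i \<in> I \<Longrightarrow> f i \<in> polys S t) \<Longrightarrow> sum f I \<in> polys S t"
  unfolding polys_def by (rule vs.span_sum)

lemma polys_mult: "p \<in> polys S s \<Longrightarrow> q \<in> polys S t \<Longrightarrow> p * q \<in> polys S (s + t)"
  unfolding polys_def
proof (erule (1) span_mult, clarify)
  fix M N :: "'a multiset"
  assume "set_mset M \<subseteq> S" "size M \<le> s" "set_mset N \<subseteq> S" "size N \<le> t"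
  then show "prod_mset M * prod_mset N \<in> vs.span {prod_mset M |M. set_mset M \<subseteq> S \<and> size M \<le> s + t}"
    by (intro vs.span_base CollectI exI[of _ "M + N"]) auto
qed

lemma polys_const: "\<epsilon> c \<in> polys S t"
proof -
  have "1 \<in> polys S t" unfolding polys_def by (rule vs.span_base) (auto intro!: exI[of _ "{#}"])
  then have "\<epsilon> c * 1 \<in> polys S t" unfolding polys_def by (rule vs.span_scale)
  then show ?thesis by simp
qed

lemma polys_0: "0 \<in> polys S t" and polys_1: "1 \<in> polys S t"
  using polys_const[of 0] polys_const[of 1] by (simp_all add: hom_0 hom_1)

lemma polys_prod_mset: "set_mset M \<subseteq> S \<Longrightarrow> size M \<le> t \<Longrightarrow> prod_mset M \<in> polys S t"
  unfolding polys_def by (rule vs.span_base) auto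

lemma polys_base: "x \<in> S \<Longrightarrow> 0 < t \<Longrightarrow> x \<in> polys S t"
  using polys_prod_mset[of "{#x#}" S t] by simp

lemma polys_prod_mset_le:
  assumes "\<And>x. x \<in># M \<Longrightarrow> x \<in> polys S d"
  shows "prod_mset M \<in> polys S (d * size M)"
  using assms
proof (induction M)
  case (add x M)
  then have "x * prod_mset M \<in> polys S (d + d * size M)" by (intro polys_mult) auto
  then show ?case by simp
qed (simp add: polys_1)

lemma alg_add: "p \<in> alg S \<Longrightarrow> q \<in> alg S \<Longrightarrow> p + q \<in> alg S"
  unfolding alg_def by (rule vs.span_add)

lemma alg_uminus: "p \<in> alg S \<Longrightarrow> - p \<in> alg S"
  unfolding alg_def by (rule vs.span_neg)

lemma alg_sum: "(\<And>i. i \<in> I \<Longrightarrow> f i \<in> alg S) \<Longrightarrow> sum f I \<in> alg S"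
  unfolding alg_def by (rule vs.span_sum)

lemma alg_const: "\<epsilon> c \<in> alg S"
  using polys_const polys_subset_alg by blast

lemma alg_0: "0 \<in> alg S" and alg_1: "1 \<in> alg S"
  using polys_0 polys_1 polys_subset_alg by blast+

lemma alg_base: "x \<in> S \<Longrightarrow> x \<in> alg S"
  using polys_base[of x S 1] polys_subset_alg by auto

lemma alg_mono: "S \<subseteq> T \<Longrightarrow> alg S \<subseteq> alg T"
  unfolding alg_def by (rule vs.span_mono) auto

lemma alg_mult: "p \<in> alg S \<Longrightarrow> q \<in> alg S \<Longrightarrow> p * q \<in> alg S"
  unfolding alg_def
proof (erule (1) span_mult, clarify)
  fix M N :: "'a multiset"
  assume "set_mset M \<subseteq> S" "set_mset N \<subseteq> S"
  then show "prod_mset M * prod_mset N \<in> vs.span {prod_mset M |M. set_mset M \<subseteq> S}"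
    by (intro vs.span_base CollectI exI[of _ "M + N"]) auto
qed

text \<open>An element involves only finitely many generators. Dimension counts need a finite
  generating set, whereas a set of invariants may be infinite.\<close>

lemma alg_imp_polys:
  assumes "p \<in> alg S"
  shows "\<exists>S0 t. finite S0 \<and> S0 \<subseteq> S \<and> p \<in> polys S0 t"
  using assms unfolding alg_def
proof (induction rule: vs.span_induct_alt)
  case base
  then show ?case using polys_0 by blast
next
  case (step c x y)
  then obtain S0 t M where *: "finite S0" "S0 \<subseteq> S" "y \<in> polys S0 t" "x = prod_mset M" "set_mset M \<subseteq> S"
    by auto
  let ?S = "S0 \<union> set_mset M" and ?t = "max t (size M)"
  have "\<epsilon> c * x \<in> polys ?S ?t"
    unfolding *(4) using polys_mult[OF polys_const[of c ?S 0] polys_prod_mset[of M ?S ?t]] by simp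
  moreover have "y \<in> polys ?S ?t" using * polys_mono[of S0 ?S t ?t] by auto
  ultimately have "\<epsilon> c * x + y \<in> polys ?S ?t" by (rule polys_add)
  then show ?case using * by (intro exI[of _ ?S] exI[of _ ?t]) auto
qed

lemma alg_imp_polys_finite:
  assumes "finite I" "\<And>i. i \<in> I \<Longrightarrow> f i \<in> alg S"
  shows "\<exists>S0 t. finite S0 \<and> S0 \<subseteq> S \<and> f ` I \<subseteq> polys S0 t"
  using assms
proof (induction I rule: finite_induct)
  case (insert i I)
  then obtain S0 t where 1: "finite S0" "S0 \<subseteq> S" "f ` I \<subseteq> polys S0 t" by auto
  obtain S1 s where 2: "finite S1" "S1 \<subseteq> S" "f i \<in> polys S1 s"
    using alg_imp_polys[of "f i" S] insert.prems by auto
  have "polys S0 t \<subseteq> polys (S0 \<union> S1) (max t s)" "polys S1 s \<subseteq> polys (S0 \<union> S1) (max t s)"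
    by (rule polys_mono; auto)+
  then show ?case using 1 2
    by (intro exI[of _ "S0 \<union> S1"] exI[of _ "max t s"]) auto
qed auto

lemma alg_finite_imp_polys: "finite S \<Longrightarrow> finite I \<Longrightarrow> (\<And>i. i \<in> I \<Longrightarrow> f i \<in> alg S) \<Longrightarrow> \<exists>t. f ` I \<subseteq> polys S t"
  using alg_imp_polys_finite[of I f S] polys_mono by (meson order.trans order.refl)

lemma ratI:
  assumes "p \<in> alg S" "q \<in> alg S"
  shows "p / q \<in> rat S"
proof (cases "q = 0")
  case True
  then have "p / q = 0 / 1" by simp
  then show ?thesis unfolding rat_def using alg_0 alg_1 by fastforce
qed (use assms in \<open>auto simp: rat_def\<close>)

lemma alg_subset_rat: "alg S \<subseteq> rat S"
  using ratI[OF _ alg_1] by fastforce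

lemma rat_mono: "S \<subseteq> T \<Longrightarrow> rat S \<subseteq> rat T"
  unfolding rat_def using alg_mono by blast

lemma rat_add: "x \<in> rat S \<Longrightarrow> y \<in> rat S \<Longrightarrow> x + y \<in> rat S"
proof -
  assume "x \<in> rat S" "y \<in> rat S"
  then obtain p q r s where "x = p / q" "y = r / s" "p \<in> alg S" "q \<in> alg S" "r \<in> alg S" "s \<in> alg S" "q \<noteq> 0" "s \<noteq> 0"
    unfolding rat_def by blast
  then show ?thesis using ratI[of "p * s + r * q" S "q * s"] by (simp add: alg_add alg_mult add_frac_eq)
qed

lemma rat_mult: "x \<in> rat S \<Longrightarrow> y \<in> rat S \<Longrightarrow> x * y \<in> rat S"
proof -
  assume "x \<in> rat S" "y \<in> rat S"
  then obtain p q r s where "x = p / q" "y = r / s" "p \<in> alg S" "q \<in> alg S" "r \<in> alg S" "s \<in> alg S" "q \<noteq> 0" "s \<noteq> 0"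
    unfolding rat_def by blast
  then show ?thesis using ratI[of "p * r" S "q * s"] by (simp add: alg_mult)
qed

lemma rat_inverse: "x \<in> rat S \<Longrightarrow> inverse x \<in> rat S"
  unfolding rat_def using ratI[unfolded rat_def] by (auto simp: inverse_eq_divide) 

lemma rat_divide: "x \<in> rat S \<Longrightarrow> y \<in> rat S \<Longrightarrow> x / y \<in> rat S"
  by (simp add: divide_inverse rat_mult rat_inverse)

lemma rat_const: "\<epsilon> c \<in> rat S" and rat_0: "0 \<in> rat S" and rat_1: "1 \<in> rat S"
  using alg_const alg_0 alg_1 alg_subset_rat by blast+

lemma rat_base: "x \<in> S \<Longrightarrow> x \<in> rat S"
  using alg_base alg_subset_rat by blast

lemma rat_uminus: "x \<in> rat S \<Longrightarrow> - x \<in> rat S"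
  using rat_mult[OF rat_const[of "-1"], of x S] by (simp add: hom_uminus hom_1)

lemma rat_sum: "(\<And>i. i \<in> I \<Longrightarrow> f i \<in> rat S) \<Longrightarrow> sum f I \<in> rat S"
  by (induction I rule: infinite_finite_induct) (auto simp: rat_0 rat_add)

lemma rat_prod: "(\<And>i. i \<in> I \<Longrightarrow> f i \<in> rat S) \<Longrightarrow> prod f I \<in> rat S"
  by (induction I rule: infinite_finite_induct) (auto simp: rat_1 rat_mult)

lemma rat_power: "x \<in> rat S \<Longrightarrow> x ^ n \<in> rat S"
  by (induction n) (auto simp: rat_1 rat_mult)

lemma common_denominator:
  assumes "finite I" "\<And>i. i \<in> I \<Longrightarrow> f i \<in> rat S"
  shows "\<exists>q\<in>alg S. q \<noteq> 0 \<and> (\<forall>i\<in>I. q * f i \<in> alg S)"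
  using assms
proof (induction I rule: finite_induct)
  case empty
  then show ?case using alg_1[of S] by (auto intro!: bexI[of _ 1])
next
  case (insert i I)
  then obtain q where q: "q \<in> alg S" "q \<noteq> 0" "\<forall>i\<in>I. q * f i \<in> alg S" by auto
  obtain p r where r: "f i = p / r" "p \<in> alg S" "r \<in> alg S" "r \<noteq> 0"
    using insert.prems unfolding rat_def by blast
  have "(q * r) * f j \<in> alg S" if j: "j \<in> insert i I" for j
  proof (cases "j = i")
    case True
    then show ?thesis using r q by (simp add: alg_mult)
  next
    case False
    then have "q * f j \<in> alg S" using j q by auto
    then have "r * (q * f j) \<in> alg S" by (rule alg_mult[OF r(3)])
    then show ?thesis by (simp add: algebra_simps)
  qed
  then show ?case using q r by (intro bexI[of _ "q * r"]) (auto simp: alg_mult)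
qed

lemma alg_dep_rat:
  assumes "\<And>l. l \<le> n \<Longrightarrow> c l \<in> rat S" "c n \<noteq> 0" "(\<Sum>l\<le>n. c l * y ^ l) = 0"
  shows "alg_dep S y"
proof -
  obtain q where q: "q \<in> alg S" "q \<noteq> 0" "\<forall>i\<in>{..n}. q * c i \<in> alg S"
    using common_denominator[of "{..n}" c S] assms by auto
  have "(\<Sum>l\<le>n. (q * c l) * y ^ l) = q * (\<Sum>l\<le>n. c l * y ^ l)"
    by (simp add: sum_distrib_left mult.assoc)
  then show ?thesis unfolding alg_dep_def using q assms
    by (intro exI[of _ n] exI[of _ "\<lambda>l. q * c l"]) auto
qed

end

section \<open>Counting monomials\<close>

text \<open>Splitting off the multisets of size exactly \<open>Suc t\<close> gives Pascal's
  rule.\<close>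

lemma card_multisets_size_le:
  assumes "finite S"
  shows "finite {M. set_mset M \<subseteq> S \<and> size M \<le> t}" (is "finite (?A t)")
    and "card {M. set_mset M \<subseteq> S \<and> size M \<le> t} = (card S + t) choose t"
proof -
  have A_0: "?A 0 = multisets_of_size S 0" by (auto simp: multisets_of_size_def)
  have A_Suc: "?A (Suc t) = ?A t \<union> multisets_of_size S (Suc t)" for t
    by (auto simp: multisets_of_size_def)
  show fin: "finite (?A t)" for t
    by (induction t) (use assms A_0 A_Suc in \<open>auto simp: finite_multisets_of_size\<close>)
  show "card (?A t) = (card S + t) choose t"
  proof (induction t)
    case 0
    show ?case unfolding A_0 by simp
  next
    case (Suc t)
    have "?A t \<inter> multisets_of_size S (Suc t) = {}" by (auto simp: multisets_of_size_def)
    then have "card (?A (Suc t)) = card (?A t) + card (multisets_of_size S (Suc t))"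
      unfolding A_Suc using fin finite_multisets_of_size[OF assms] by (intro card_Un_disjoint)
    also have "card (multisets_of_size S (Suc t)) = (card S + t) choose Suc t"
      by (simp add: card_multisets_of_size[OF assms])
    finally show ?case unfolding Suc.IH by simp
  qed
qed

text \<open>Together with \<open>fact_times_binomial_le\<close> this compares the number of
  monomials with \<open>t ^ m / fact m\<close> up to lower order terms, which is the precision that
  the growth arguments use.\<close>

lemma power_le_fact_times_binomial: "(t::nat) ^ m \<le> fact m * ((m + t) choose t)"
proof (induction m)
  case (Suc m)
  have eq: "(k + t) choose t = (k + t) choose k" for k
    using binomial_symmetric[of t "k + t"] by simp
  have "t * t ^ m \<le> Suc (m + t) * (fact m * ((m + t) choose t))"
    by (rule mult_mono) (use Suc in auto)
  also have "\<dots> = fact m * (Suc (m + t) * ((m + t) choose m))"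
    unfolding eq[of m] by (rule mult.left_commute)
  also have "\<dots> = fact m * (Suc m * (Suc (m + t) choose Suc m))"
    by (simp only: Suc_times_binomial)
  also have "\<dots> = fact (Suc m) * ((Suc m + t) choose t)"
    using eq[of "Suc m"] by (simp only: fact_Suc add_Suc of_nat_id mult.assoc mult.left_commute)
  finally show ?case by simp
qed simp

lemma fact_times_binomial_le: "fact m * ((m + t) choose t) \<le> (m + t) ^ m"
  using binomial_fact_pow[of "m + t" m] binomial_symmetric[of t "m + t"] by (simp add: mult.commute)

text \<open>Both sides grow polynomially in \<open>t\<close>, with exponents \<open>p\<close> and
  \<open>s\<close>, so a large \<open>t\<close> contradicts \<open>p > s\<close>.\<close>

lemma binomial_growth_exponent:
  assumes "\<And>t. (p + t) choose t \<le> K * ((s + d * t) choose (d * t))"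
  shows "p \<le> s"
proof (rule ccontr)
  assume "\<not> p \<le> s"
  \<comment> \<open>The factor \<open>fact p\<close> turns the left binomial into a power, and
    \<open>(s + d) ^ s\<close> comes from \<open>s + d * t \<le> (s + d) * t\<close>; in the end
    \<open>t ^ s * t \<le> t ^ s * C\<close>.\<close>
  define C where "C = fact p * K * (s + d) ^ s"
  define t where "t = Suc C"
  have "t ^ s * t \<le> t ^ p" using \<open>\<not> p \<le> s\<close> power_increasing[of "Suc s" p t] by (simp add: t_def mult.commute)
  also have "\<dots> \<le> fact p * ((p + t) choose t)" by (rule power_le_fact_times_binomial)
  also have "\<dots> \<le> fact p * (K * ((s + d * t) choose (d * t)))" using assms by simp
  also have "\<dots> \<le> fact p * (K * (fact s * ((s + d * t) choose (d * t))))" by simp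
  also have "\<dots> \<le> fact p * (K * (s + d * t) ^ s)"
    by (intro mult_left_mono fact_times_binomial_le) auto
  also have "s + d * t \<le> (s + d) * t" by (simp add: t_def algebra_simps)
  then have "fact p * (K * (s + d * t) ^ s) \<le> fact p * (K * ((s + d) * t) ^ s)"
    by (intro mult_left_mono power_mono) auto
  also have "\<dots> = t ^ s * C" by (simp add: C_def power_mult_distrib mult.commute mult.left_commute)
  finally have "t \<le> C" by (simp add: t_def)
  then show False by (simp add: t_def)
qed

text \<open>After division by \<open>t ^ m\<close> the limit compares leading coefficients, and the
  shift \<open>c\<close> disappears. The index \<open>Suc t\<close> keeps the divisor
  positive.\<close>

lemma binomial_growth_leading_coeff:
  assumes "\<And>t. r * ((m + t) choose t) \<le> (m + (d * t + c)) choose (d * t + c)"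
  shows "r \<le> d ^ m"
proof -
  have *: "real r \<le> (real d + real (m + c) / real (Suc t)) ^ m" for t
  proof -
    let ?t = "Suc t"
    have "r * ?t ^ m \<le> r * (fact m * ((m + ?t) choose ?t))"
      by (intro mult_left_mono power_le_fact_times_binomial) auto
    also have "\<dots> \<le> fact m * ((m + (d * ?t + c)) choose (d * ?t + c))"
      using assms[of ?t] by (metis mult.left_commute mult_le_mono2)
    also have "\<dots> \<le> (m + (d * ?t + c)) ^ m" by (rule fact_times_binomial_le)
    finally have "real r * real ?t ^ m \<le> real (m + (d * ?t + c)) ^ m"
      by (metis of_nat_le_iff of_nat_mult of_nat_power)
    moreover have "real d + real (m + c) / real ?t = real (m + (d * ?t + c)) / real ?t"
      by (simp add: field_simps)
    ultimately show ?thesis by (simp add: power_divide pos_le_divide_eq del: of_nat_Suc)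
  qed
  have "(\<lambda>t. (real d + real (m + c) / real (Suc t)) ^ m) \<longlonglongrightarrow> (real d + 0) ^ m"
    by (intro tendsto_intros LIMSEQ_Suc[OF lim_const_over_n])
  then have "real r \<le> (real d + 0) ^ m" by (rule LIMSEQ_le_const) (use * in auto)
  then show ?thesis by (metis add.right_neutral of_nat_le_iff of_nat_power)
qed

section \<open>Hilbert functions and transcendence degree\<close>

context field_embedding
begin

text \<open>Independence of an indexed family also excludes two indices with the same value, by the
  coefficients \<open>1\<close> and \<open>-1\<close>; hence indices may be counted instead of
  elements.\<close>

lemma independent_family_card_le:
  assumes "finite A" "\<And>c. (\<Sum>a\<in>A. \<epsilon> (c a) * f a) = 0 \<Longrightarrow> \<forall>a\<in>A. c a = 0"
    and "finite T" "f ` A \<subseteq> vs.span T"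
  shows "card A \<le> card T"
proof -
  have inj: "inj_on f A"
  proof (rule inj_onI, rule ccontr)
    fix a b assume ab: "a \<in> A" "b \<in> A" "f a = f b" "a \<noteq> b"
    define c where "c x = (if x = a then 1 else if x = b then -1 else (0::'k))" for x
    have "(\<Sum>x\<in>A. \<epsilon> (c x) * f x) = (\<Sum>x\<in>{a,b}. \<epsilon> (c x) * f x)"
      by (rule sum.mono_neutral_right) (use assms(1) ab in \<open>auto simp: c_def hom_0\<close>)
    also have "\<dots> = 0" using ab by (simp add: c_def hom_1 hom_uminus)
    finally have "c a = 0" using assms(2) ab by blast
    then show False by (simp add: c_def)
  qed
  have "vs.independent (f ` A)"
  proof (rule vs.independent_if_scalars_zero)
    fix c x assume "(\<Sum>x\<in>f ` A. \<epsilon> (c x) * x) = 0" "x \<in> f ` A"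
    then show "c x = 0" using assms(2)[of "c \<circ> f"] by (auto simp: sum.reindex[OF inj])
  qed (use assms in auto)
  then show ?thesis
    using vs.independent_span_bound[OF assms(3) _ assms(4)] card_image[OF inj] by auto
qed

lemma alg_indepD:
  "alg_indep B \<Longrightarrow> finite A \<Longrightarrow> (\<And>M. M \<in> A \<Longrightarrow> set_mset M \<subseteq> B) \<Longrightarrow>
    (\<Sum>M\<in>A. \<epsilon> (c M) * prod_mset M) = 0 \<Longrightarrow> M \<in> A \<Longrightarrow> c M = 0"
  unfolding alg_indep_def by blast

lemma alg_indep_card_le_span:
  assumes "alg_indep B" "finite B" "finite T"
    and "\<And>M. set_mset M \<subseteq> B \<Longrightarrow> size M \<le> t \<Longrightarrow> prod_mset M \<in> vs.span T"
  shows "(card B + t) choose t \<le> card T"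
proof -
  let ?A = "{M. set_mset M \<subseteq> B \<and> size M \<le> t}"
  have "card ?A \<le> card T"
  proof (rule independent_family_card_le[where f = prod_mset])
    show fin: "finite ?A" using card_multisets_size_le(1)[OF assms(2)] .
    show "\<forall>a\<in>?A. c a = 0" if "(\<Sum>a\<in>?A. \<epsilon> (c a) * prod_mset a) = 0" for c
      using alg_indepD[OF assms(1) fin _ that] by blast
    show "prod_mset ` ?A \<subseteq> vs.span T" using assms(4) by blast
  qed (rule assms(3))
  then show ?thesis by (simp add: card_multisets_size_le(2)[OF assms(2)])
qed

lemma polys_spanning_set:
  assumes "finite U"
  shows "\<exists>T. finite T \<and> card T \<le> (card U + t) choose t \<and> polys U t = vs.span T"
proof -
  have *: "{prod_mset M |M. set_mset M \<subseteq> U \<and> size M \<le> t} =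
      prod_mset ` {M. set_mset M \<subseteq> U \<and> size M \<le> t}" by auto
  note fin = card_multisets_size_le(1)[OF assms, of t]
  show ?thesis unfolding polys_def *
    using finite_imageI[OF fin] card_image_le[OF fin, of prod_mset]
    unfolding card_multisets_size_le(2)[OF assms] by blast
qed

text \<open>The Hilbert function of \<open>U\<close> grows at least like that of an algebraically independent
  subset of its polynomials.\<close>

lemma alg_indep_card_le:
  assumes "finite U" "B \<subseteq> polys U d" "alg_indep B" "finite B"
  shows "card B \<le> card U"
proof (rule binomial_growth_exponent[where K = 1 and d = d])
  fix t
  obtain T where T: "finite T" "card T \<le> (card U + d * t) choose (d * t)" "polys U (d * t) = vs.span T"
    using polys_spanning_set[OF assms(1)] by blast
  have "(card B + t) choose t \<le> card T"
  proof (rule alg_indep_card_le_span[OF assms(3,4) T(1)])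
    fix M assume M: "set_mset M \<subseteq> B" "size M \<le> t"
    then have "prod_mset M \<in> polys U (d * size M)" using assms(2) by (intro polys_prod_mset_le) auto
    also have "\<dots> \<subseteq> polys U (d * t)" using M by (intro polys_mono) auto
    finally show "prod_mset M \<in> vs.span T" using T by simp
  qed
  then show "(card B + t) choose t \<le> 1 * ((card U + d * t) choose (d * t))" using T by simp
qed

text \<open>Every factor \<open>D\<close> pays for one multiplication by an element of
  \<open>Y\<close>: when an exponent would reach \<open>n\<close>, \<open>red\<close> replaces that
  power by smaller ones with coefficients of degree at most \<open>\<delta>\<close> in
  \<open>Z\<close>. The remainders \<open>V\<close> have exponents below \<open>n\<close> and do not
  depend on \<open>t\<close>, so all growth in \<open>t\<close> sits in \<open>Z\<close>.\<close>

lemma monomial_reduction: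
  assumes D: "D \<in> polys Z \<delta>" and n: "0 < n"
    and red: "\<And>y. y \<in> Y \<Longrightarrow> \<exists>c. (\<forall>l<n. c l \<in> polys Z \<delta>) \<and> D * y ^ n = (\<Sum>l<n. c l * y ^ l)"
    and M: "set_mset M \<subseteq> Y" "size M \<le> t"
  defines "V \<equiv> {prod_mset N |N. set_mset N \<subseteq> Y \<and> (\<forall>y. count N y < n)}"
  shows "D ^ t * prod_mset M \<in> vs.span {u * v |u v. u \<in> polys Z (\<delta> * t) \<and> v \<in> V}"
proof -
  define W where "W t = vs.span {u * v |u v. u \<in> polys Z (\<delta> * t) \<and> v \<in> V}" for t
  have W_mult: "e * w \<in> W (Suc t)"
    if w: "w \<in> W t" and e: "\<And>u v. u \<in> polys Z (\<delta> * t) \<Longrightarrow> v \<in> V \<Longrightarrow> e * (u * v) \<in> W (Suc t)" for e w t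
    using w unfolding W_def[of t]
  proof (induction rule: vs.span_induct_alt)
    case base
    then show ?case by (simp add: W_def vs.span_zero)
  next
    case (step c x y)
    have "e * x \<in> W (Suc t)" using e step by auto
    then have "\<epsilon> c * (e * x) + e * y \<in> W (Suc t)"
      using step unfolding W_def by (intro vs.span_add vs.span_scale)
    then show ?case by (simp add: algebra_simps)
  qed
  have W_base: "u * v \<in> W t" if "u \<in> polys Z (\<delta> * t)" "v \<in> V" for u v t
    unfolding W_def using that by (intro vs.span_base) auto
  have D_mult: "D * w \<in> W (Suc t)" if "w \<in> W t" for w t
  proof (rule W_mult[OF that])
    fix u v assume "u \<in> polys Z (\<delta> * t)" "v \<in> V"
    then have "(D * u) * v \<in> W (Suc t)" using polys_mult[OF D, of u "\<delta> * t"] by (intro W_base) auto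
    then show "D * (u * v) \<in> W (Suc t)" by (simp add: mult.assoc)
  qed
  have Dy_mult: "D * y * w \<in> W (Suc t)" if y: "y \<in> Y" and "w \<in> W t" for w y t
  proof (rule W_mult[OF that(2)])
    fix u v assume u: "u \<in> polys Z (\<delta> * t)" and "v \<in> V"
    then obtain N where N: "v = prod_mset N" "set_mset N \<subseteq> Y" "\<And>y. count N y < n" by (auto simp: V_def)
    show "D * y * (u * v) \<in> W (Suc t)"
    proof (cases "Suc (count N y) < n")
      case True
      have "(D * u) * (y * v) \<in> W (Suc t)"
      proof (rule W_base)
        show "y * v \<in> V" unfolding V_def using N True y
          by (intro CollectI exI[of _ "add_mset y N"]) auto
      qed (use polys_mult[OF D u] in simp)
      then show ?thesis by (simp add: algebra_simps)
    next
      case False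
      \<comment> \<open>The exponent of \<open>y\<close> is already the largest allowed one.
        Splitting off this full power lets the additional \<open>y\<close> complete
        \<open>y ^ n\<close>.\<close>
      then have cnt: "Suc (count N y) = n" using N(3)[of y] by simp
      define N' where "N' = filter_mset (\<lambda>z. z \<noteq> y) N"
      have "N = N' + replicate_mset (count N y) y"
        by (rule multiset_eqI) (simp add: N'_def)
      from arg_cong[OF this, of prod_mset] have v: "v = prod_mset N' * y ^ count N y"
        by (simp add: N(1))
      obtain c where c: "\<forall>l<n. c l \<in> polys Z \<delta>" "D * y ^ n = (\<Sum>l<n. c l * y ^ l)"
        using red[OF y] by blast
      have "D * y * (u * v) = u * prod_mset N' * (D * y ^ n)"
        unfolding v cnt[symmetric] by (simp add: ac_simps)
      also have "\<dots> = (\<Sum>l<n. (c l * u) * (prod_mset N' * y ^ l))"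
        unfolding c(2) sum_distrib_left by (simp add: ac_simps)
      also have "\<dots> \<in> W (Suc t)" unfolding W_def
      proof (rule vs.span_sum, fold W_def)
        fix l assume l: "l \<in> {..<n}"
        show "(c l * u) * (prod_mset N' * y ^ l) \<in> W (Suc t)"
        proof (rule W_base)
          show "c l * u \<in> polys Z (\<delta> * Suc t)" using polys_mult[of "c l" Z \<delta> u "\<delta> * t"] c u l by simp
          have "set_mset (N' + replicate_mset l y) \<subseteq> Y" using N y by (auto simp: N'_def)
          moreover have "count (N' + replicate_mset l y) z < n" for z using N l by (simp add: N'_def)
          ultimately show "prod_mset N' * y ^ l \<in> V" unfolding V_def
            by (intro CollectI exI[of _ "N' + replicate_mset l y"]) auto
        qed
      qed
      finally show ?thesis .
    qed
  qed
  have "D ^ t * prod_mset M \<in> W t" using M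
  proof (induction t arbitrary: M)
    case 0
    have "1 \<in> V" unfolding V_def using n by (intro CollectI exI[of _ "{#}"]) auto
    then show ?case using W_base[OF polys_1, of 1 0] 0 by simp
  next
    case (Suc t)
    show ?case
    proof (cases "M = {#}")
      case True
      then show ?thesis using D_mult[OF Suc.IH[of "{#}"]] by simp
    next
      case False
      then obtain y N where "M = add_mset y N" using multiset_cases by blast
      then show ?thesis using Dy_mult[OF _ Suc.IH[of N], of y] Suc.prems by (simp add: algebra_simps)
    qed
  qed
  then show ?thesis by (simp add: W_def)
qed

text \<open>Any nonzero coefficient suffices: the relation is cut off at the largest index with a
  nonzero coefficient.\<close>

lemma alg_depI:
  assumes "\<And>l. l \<le> n \<Longrightarrow> c l \<in> alg S" "(\<Sum>l\<le>n. c l * y ^ l) = 0" "k \<le> n" "c k \<noteq> 0"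
  shows "alg_dep S y"
proof -
  define m where "m = Max {l. l \<le> n \<and> c l \<noteq> 0}"
  have fin: "finite {l. l \<le> n \<and> c l \<noteq> 0}" by simp
  have "{l. l \<le> n \<and> c l \<noteq> 0} \<noteq> {}" using assms by blast
  from Max_in[OF fin this] have m: "m \<le> n" "c m \<noteq> 0" by (simp_all add: m_def)
  have "(\<Sum>l\<le>n. c l * y ^ l) = (\<Sum>l\<le>m. c l * y ^ l)"
    by (rule sum.mono_neutral_right) (use m Max_ge[OF fin] in \<open>fastforce simp: m_def\<close>)+
  then show ?thesis unfolding alg_dep_def using assms m by (intro exI[of _ m] exI[of _ c]) auto
qed

text \<open>A relation for \<open>z\<close> may be multiplied by \<open>E * z ^ k\<close>. Taking
  for \<open>E\<close> the leading coefficient and for \<open>k\<close> the degree of the other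
  relation makes both data agree.\<close>

lemma alg_dep_common_leading_coeff:
  assumes "finite Y" "\<And>y. y \<in> Y \<Longrightarrow> alg_dep S y"
  shows "\<exists>D n. D \<in> alg S \<and> D \<noteq> 0 \<and> 0 < n \<and>
    (\<forall>y\<in>Y. \<exists>c. (\<forall>l<n. c l \<in> alg S) \<and> D * y ^ n = (\<Sum>l<n. c l * y ^ l))"
  using assms
proof (induction Y rule: finite_induct)
  case empty
  then show ?case using alg_1[of S] by (intro exI[of _ 1]) auto
next
  case (insert y Y)
  have raise: "\<exists>c'. (\<forall>l<n + k. c' l \<in> alg S) \<and> (E * D) * z ^ (n + k) = (\<Sum>l<n + k. c' l * z ^ l)"
    if "\<forall>l<n. c l \<in> alg S" "D * z ^ n = (\<Sum>l<n. c l * z ^ l)" "E \<in> alg S" for n k c D E z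
  proof (intro exI conjI allI impI)
    let ?c = "\<lambda>l. if l < k then 0 else E * c (l - k)"
    show "?c l \<in> alg S" if "l < n + k" for l using that \<open>\<forall>l<n. c l \<in> alg S\<close> \<open>E \<in> alg S\<close>
      by (auto intro: alg_0 alg_mult)
    have "(\<Sum>l<n + k. ?c l * z ^ l) = (\<Sum>l\<in>{k..<n + k}. ?c l * z ^ l)"
      by (rule sum.mono_neutral_right) auto
    also have "\<dots> = (\<Sum>l<n. ?c (l + k) * z ^ (l + k))"
      by (rule sum.reindex_bij_witness[of _ "\<lambda>l. l + k" "\<lambda>l. l - k"]) auto
    also have "\<dots> = E * z ^ k * (\<Sum>l<n. c l * z ^ l)"
      by (simp add: sum_distrib_left power_add ac_simps)
    also have "\<dots> = (E * D) * z ^ (n + k)"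
      by (simp add: that(2)[symmetric] power_add ac_simps)
    finally show "(E * D) * z ^ (n + k) = (\<Sum>l<n + k. ?c l * z ^ l)" by simp
  qed
  obtain D n where D: "D \<in> alg S" "D \<noteq> 0" "0 < n"
    "\<forall>y\<in>Y. \<exists>c. (\<forall>l<n. c l \<in> alg S) \<and> D * y ^ n = (\<Sum>l<n. c l * y ^ l)"
    using insert by auto
  obtain k c where c: "\<forall>l\<le>k. c l \<in> alg S" "c k \<noteq> 0" "(\<Sum>l\<le>k. c l * y ^ l) = 0"
    using insert.prems[of y] unfolding alg_dep_def by auto
  have "(\<Sum>l<k. c l * y ^ l) + c k * y ^ k = 0"
    using c(3) sum.lessThan_Suc[of "\<lambda>l. c l * y ^ l" k] by (simp only: lessThan_Suc_atMost)
  then have "c k * y ^ k = - (\<Sum>l<k. c l * y ^ l)" by (metis add.commute eq_neg_iff_add_eq_0)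
  then have "c k * y ^ k = (\<Sum>l<k. (- c l) * y ^ l)" by (simp add: sum_negf)
  then have y: "\<exists>c'. (\<forall>l<k + n. c' l \<in> alg S) \<and> (D * c k) * y ^ (k + n) = (\<Sum>l<k + n. c' l * y ^ l)"
    by (intro raise[where c = "\<lambda>l. - c l"]) (use c D in \<open>auto intro: alg_uminus\<close>)
  have Y: "\<exists>c'. (\<forall>l<n + k. c' l \<in> alg S) \<and> (c k * D) * z ^ (n + k) = (\<Sum>l<n + k. c' l * z ^ l)"
    if z: "z \<in> Y" for z
  proof -
    obtain c' where "\<forall>l<n. c' l \<in> alg S" "D * z ^ n = (\<Sum>l<n. c' l * z ^ l)" using D(4) z by blast
    then show ?thesis by (rule raise) (use c in auto)
  qed
  show ?case
  proof (rule exI[of _ "D * c k"], rule exI[of _ "k + n"], intro conjI ballI)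
    show "D * c k \<in> alg S" "D * c k \<noteq> 0" "0 < k + n" using D c by (auto intro: alg_mult)
    show "\<exists>c'. (\<forall>l<k + n. c' l \<in> alg S) \<and> (D * c k) * z ^ (k + n) = (\<Sum>l<k + n. c' l * z ^ l)"
      if "z \<in> insert y Y" for z
      using that y Y[of z] by (auto simp: add.commute[of k n] mult.commute[of D])
  qed
qed

text \<open>Provides uniform input for \<open>monomial_reduction\<close>: finitely many coefficients
  involve finitely many generators and admit one degree bound.\<close>

lemma alg_dep_common_bound:
  assumes "finite Y" "\<And>y. y \<in> Y \<Longrightarrow> alg_dep S y"
  obtains Z D \<delta> n where "finite Z" "Z \<subseteq> S" "D \<noteq> 0" "0 < n" "D \<in> polys Z \<delta>"
    "\<And>y. y \<in> Y \<Longrightarrow> \<exists>c. (\<forall>l<n. c l \<in> polys Z \<delta>) \<and> D * y ^ n = (\<Sum>l<n. c l * y ^ l)"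
proof -
  obtain D n where D: "D \<in> alg S" "D \<noteq> 0" "0 < n"
    "\<forall>y\<in>Y. \<exists>c. (\<forall>l<n. c l \<in> alg S) \<and> D * y ^ n = (\<Sum>l<n. c l * y ^ l)"
    using alg_dep_common_leading_coeff[OF assms] by blast
  then obtain c where c: "\<And>y. y \<in> Y \<Longrightarrow> (\<forall>l<n. c y l \<in> alg S) \<and> D * y ^ n = (\<Sum>l<n. c y l * y ^ l)"
    by metis
  \<comment> \<open>\<open>None\<close> stands for the leading coefficient and
    \<open>Some (y, l)\<close> for the others, so that one finite family covers them all.\<close>
  define f where "f i = (case i of None \<Rightarrow> D | Some (y, l) \<Rightarrow> c y l)" for i
  have "\<exists>Z \<delta>. finite Z \<and> Z \<subseteq> S \<and> f ` insert None (Some ` (Y \<times> {..<n})) \<subseteq> polys Z \<delta>"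
    by (rule alg_imp_polys_finite) (use assms D c in \<open>auto simp: f_def\<close>)
  then obtain Z \<delta> where Z: "finite Z" "Z \<subseteq> S"
    "f ` insert None (Some ` (Y \<times> {..<n})) \<subseteq> polys Z \<delta>" by blast
  show thesis
  proof (rule that[OF Z(1,2) D(2,3)])
    show "D \<in> polys Z \<delta>" using Z(3) by (simp add: f_def)
    show "\<exists>c. (\<forall>l<n. c l \<in> polys Z \<delta>) \<and> D * y ^ n = (\<Sum>l<n. c l * y ^ l)" if y: "y \<in> Y" for y
    proof (intro exI conjI allI impI)
      show "c y l \<in> polys Z \<delta>" if "l < n" for l
        using subsetD[OF Z(3) imageI[of "Some (y, l)"]] y that by (auto simp: f_def)
    qed (use c[OF y] in auto)
  qed
qed

lemma finite_bounded_monomials: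
  fixes Y :: "'a set"
  assumes "finite Y"
  shows "finite {prod_mset N |N. set_mset N \<subseteq> Y \<and> (\<forall>y. count N y < n)}"
proof -
  have "size N \<le> card Y * n" if "set_mset N \<subseteq> Y" "\<forall>y. count N y < n" for N :: "'a multiset"
  proof -
    have "size N = (\<Sum>y\<in>set_mset N. count N y)" by (rule size_multiset_overloaded_eq)
    also have "\<dots> \<le> card (set_mset N) * n"
      using sum_bounded_above[of "set_mset N" "count N" n] that(2) by (simp add: less_imp_le)
    also have "\<dots> \<le> card Y * n" using card_mono[OF assms that(1)] by simp
    finally show ?thesis .
  qed
  then have "{N. set_mset N \<subseteq> Y \<and> (\<forall>y. count N y < n)} \<subseteq> {N. set_mset N \<subseteq> Y \<and> size N \<le> card Y * n}"
    by blast
  from finite_imageI[OF finite_subset[OF this card_multisets_size_le(1)[OF assms]], of prod_mset]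
  show ?thesis by (simp add: setcompr_eq_image)
qed

text \<open>Composes two reductions: \<open>w\<close> has coefficients in \<open>P\<close>, which
  \<open>E\<close> in turn reduces to coefficients in \<open>vs.span W\<close>; the sets of
  remainders \<open>V\<close> and \<open>V'\<close> multiply.\<close>

lemma span_triple_products:
  assumes "w \<in> vs.span {u * v |u v. u \<in> P \<and> v \<in> V}"
    and "\<And>u. u \<in> P \<Longrightarrow> E * u \<in> vs.span {u' * v' |u' v'. u' \<in> vs.span W \<and> v' \<in> V'}"
  shows "E * w \<in> vs.span {a * b * c |a b c. a \<in> W \<and> b \<in> V' \<and> c \<in> V}"
proof -
  let ?T = "vs.span {a * b * c |a b c. a \<in> W \<and> b \<in> V' \<and> c \<in> V}"
  have 1: "u' * (v' * v) \<in> ?T" if "u' \<in> vs.span W" "v' \<in> V'" "v \<in> V" for u' v' v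
    by (rule span_mult[OF that(1) vs.span_base[of "v' * v" "{v' * v}"]])
       (use that in \<open>auto intro!: vs.span_base simp: mult.assoc\<close>)
  have 2: "x * v \<in> ?T" if "x \<in> vs.span {u' * v' |u' v'. u' \<in> vs.span W \<and> v' \<in> V'}" "v \<in> V" for x v
    by (rule span_mult[OF that(1) vs.span_base[of v "{v}"]])
       (use 1 that(2) in \<open>auto simp: mult.assoc\<close>)
  show ?thesis using assms(1)
  proof (induction rule: vs.span_induct_alt)
    case (step c x y)
    then obtain u v where "x = u * v" "u \<in> P" "v \<in> V" by blast
    then have "E * x \<in> ?T" using 2[OF assms(2), of u v] by (simp add: mult.assoc)
    then have "\<epsilon> c * (E * x) + E * y \<in> ?T" using step by (intro vs.span_add vs.span_scale)
    then show ?case by (simp add: algebra_simps)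
  qed (simp add: vs.span_zero)
qed

text \<open>Up to fixed denominators, monomials of degree \<open>t\<close> in \<open>U\<close> are
  combinations of bounded monomials in \<open>U\<close> and \<open>Z\<close> with coefficients of
  degree \<open>\<eta> * \<delta> * t\<close> in \<open>B\<close>. The left count grows with
  exponent \<open>card U\<close>, the right one with exponent \<open>card B\<close>.\<close>

lemma alg_indep_card_le_trans:
  assumes "finite U" "alg_indep U" "\<And>x. x \<in> U \<Longrightarrow> alg_dep S x"
    and "finite B" "\<And>s. s \<in> S \<Longrightarrow> alg_dep B s"
  shows "card U \<le> card B"
proof -
  obtain Z D \<delta> n where Z: "finite Z" "Z \<subseteq> S" and D: "D \<noteq> 0" "0 < n" "D \<in> polys Z \<delta>"
    "\<And>y. y \<in> U \<Longrightarrow> \<exists>c. (\<forall>l<n. c l \<in> polys Z \<delta>) \<and> D * y ^ n = (\<Sum>l<n. c l * y ^ l)"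
    by (rule alg_dep_common_bound[OF assms(1,3)], assumption, rule that)
  have Z_dep: "alg_dep B z" if "z \<in> Z" for z using assms(5) Z(2) that by blast
  obtain Z' E \<eta> n' where Z': "finite Z'" "Z' \<subseteq> B" and E: "E \<noteq> 0" "0 < n'" "E \<in> polys Z' \<eta>"
    "\<And>y. y \<in> Z \<Longrightarrow> \<exists>c. (\<forall>l<n'. c l \<in> polys Z' \<eta>) \<and> E * y ^ n' = (\<Sum>l<n'. c l * y ^ l)"
    by (rule alg_dep_common_bound[OF Z(1) Z_dep], assumption, rule that)
  define V where "V = {prod_mset N |N. set_mset N \<subseteq> U \<and> (\<forall>y. count N y < n)}"
  define V' where "V' = {prod_mset N |N. set_mset N \<subseteq> Z \<and> (\<forall>y. count N y < n')}"
  have fin: "finite V" "finite V'" unfolding V_def V'_def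
    using finite_bounded_monomials assms(1) Z(1) by auto
  show ?thesis
  \<comment> \<open>Each reduction contributes its number of remainders to \<open>K\<close> and its
    degree bound to \<open>d\<close>.\<close>
  proof (rule binomial_growth_exponent[where K = "card V' * card V" and d = "\<eta> * \<delta>"])
    fix t
    obtain W where W: "finite W" "card W \<le> (card B + (\<eta> * \<delta>) * t) choose ((\<eta> * \<delta>) * t)"
      "polys B ((\<eta> * \<delta>) * t) = vs.span W"
      using polys_spanning_set[OF assms(4)] by blast
    let ?T = "{a * b * c |a b c. a \<in> W \<and> b \<in> V' \<and> c \<in> V}"
    have T: "?T = (\<lambda>(a, b, c). a * b * c) ` (W \<times> V' \<times> V)" by force
    have fin_T: "finite ?T" unfolding T using W fin by auto
    have card_T: "card ?T \<le> card W * (card V' * card V)"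
      unfolding T using card_image_le[of "W \<times> V' \<times> V"] W fin by (simp add: card_cartesian_product)
    have u: "E ^ (\<delta> * t) * u \<in> vs.span {u' * v' |u' v'. u' \<in> vs.span W \<and> v' \<in> V'}"
      if "u \<in> polys Z (\<delta> * t)" for u
      using that unfolding polys_def
    proof (induction rule: vs.span_induct_alt)
      case (step c x y)
      then obtain M where M: "x = prod_mset M" "set_mset M \<subseteq> Z" "size M \<le> \<delta> * t" by blast
      have "E ^ (\<delta> * t) * x \<in> vs.span {u * v |u v. u \<in> polys Z' (\<eta> * (\<delta> * t)) \<and> v \<in> V'}"
        unfolding V'_def M(1) by (rule monomial_reduction[OF E(3,2,4) M(2,3)])
      also have "\<dots> \<subseteq> vs.span {u' * v' |u' v'. u' \<in> vs.span W \<and> v' \<in> V'}"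
        using polys_mono[OF Z'(2) order.refl, of "\<eta> * (\<delta> * t)"] W(3)
        by (intro vs.span_mono) (auto simp: mult.assoc)
      finally have "\<epsilon> c * (E ^ (\<delta> * t) * x) + E ^ (\<delta> * t) * y
          \<in> vs.span {u' * v' |u' v'. u' \<in> vs.span W \<and> v' \<in> V'}"
        using step by (intro vs.span_add vs.span_scale)
      then show ?case by (simp add: algebra_simps)
    qed (simp add: vs.span_zero)
    let ?A = "{M. set_mset M \<subseteq> U \<and> size M \<le> t}"
    have "card ?A \<le> card ?T"
    proof (rule independent_family_card_le[where f = "\<lambda>M. E ^ (\<delta> * t) * (D ^ t * prod_mset M)"])
      show fin_A: "finite ?A" using card_multisets_size_le(1)[OF assms(1)] .
      fix c assume "(\<Sum>M\<in>?A. \<epsilon> (c M) * (E ^ (\<delta> * t) * (D ^ t * prod_mset M))) = 0"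
      then have "E ^ (\<delta> * t) * D ^ t * (\<Sum>M\<in>?A. \<epsilon> (c M) * prod_mset M) = 0"
        unfolding sum_distrib_left by (simp add: ac_simps)
      then have "(\<Sum>M\<in>?A. \<epsilon> (c M) * prod_mset M) = 0" using D(1) E(1) by simp
      from alg_indepD[OF assms(2) fin_A _ this] show "\<forall>M\<in>?A. c M = 0" by blast
    next
      show "(\<lambda>M. E ^ (\<delta> * t) * (D ^ t * prod_mset M)) ` ?A \<subseteq> vs.span ?T"
      proof clarify
        fix M assume M: "set_mset M \<subseteq> U" "size M \<le> t"
        show "E ^ (\<delta> * t) * (D ^ t * prod_mset M) \<in> vs.span ?T"
          by (rule span_triple_products[OF monomial_reduction[OF D(3,2,4) M, folded V_def] u])
      qed
    qed (rule fin_T)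
    also note card_T
    also have "card W * (card V' * card V) \<le>
        ((card B + (\<eta> * \<delta>) * t) choose ((\<eta> * \<delta>) * t)) * (card V' * card V)"
      using W(2) by simp
    finally show "(card U + t) choose t \<le> card V' * card V *
        ((card B + (\<eta> * \<delta>) * t) choose ((\<eta> * \<delta>) * t))"
      by (simp add: card_multisets_size_le(2)[OF assms(1)] mult.commute)
  qed
qed

lemma alg_indep_empty: "alg_indep {}"
  unfolding alg_indep_def
proof (intro allI impI ballI)
  fix A c M assume "finite A" "\<forall>M\<in>A. set_mset M \<subseteq> {}" "(\<Sum>M\<in>A. \<epsilon> (c M) * prod_mset M) = 0" "M \<in> A"
  then have "A = {{#}}" "M = {#}" by auto
  then show "c M = 0" using \<open>(\<Sum>M\<in>A. \<epsilon> (c M) * prod_mset M) = 0\<close> by (simp add: hom_eq_0_iff)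
qed

text \<open>Sort a relation between monomials in \<open>insert s B\<close> by the power of
  \<open>s\<close>. Among multisets with equal count of \<open>s\<close>, removing \<open>s\<close>
  is injective, so independence of \<open>B\<close> keeps the coefficient that contains a nonzero
  scalar from vanishing.\<close>

lemma alg_dep_if_insert_not_indep:
  assumes "alg_indep B" "\<not> alg_indep (insert s B)" "s \<notin> B"
  shows "alg_dep B s"
proof -
  obtain A c M0 where A: "finite A" "\<forall>M\<in>A. set_mset M \<subseteq> insert s B"
    and sum: "(\<Sum>M\<in>A. \<epsilon> (c M) * prod_mset M) = 0" and M0: "M0 \<in> A" "c M0 \<noteq> 0"
    using assms(2) unfolding alg_indep_def by blast
  define r where "r = filter_mset (\<lambda>z. z \<noteq> s)"
  define A' where "A' l = {M \<in> A. count M s = l}" for l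
  define C where "C l = (\<Sum>M\<in>A' l. \<epsilon> (c M) * prod_mset (r M))" for l
  define n where "n = Max ((\<lambda>M. count M s) ` A)"
  have split: "M = r M + replicate_mset (count M s) s" for M
    by (rule multiset_eqI) (simp add: r_def)
  have prod: "prod_mset M = prod_mset (r M) * s ^ count M s" for M
    using arg_cong[OF split, of prod_mset M] by simp
  have le_n: "count M s \<le> n" if "M \<in> A" for M unfolding n_def using A that by simp
  have r_sub: "set_mset (r M) \<subseteq> B" if "M \<in> A" for M using A that by (auto simp: r_def)
  have "(\<Sum>l\<le>n. C l * s ^ l) = (\<Sum>l\<le>n. \<Sum>M\<in>A' l. \<epsilon> (c M) * prod_mset M)"
    unfolding C_def sum_distrib_right
  proof (intro sum.cong refl)
    fix l M assume "M \<in> A' l"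
    then show "\<epsilon> (c M) * prod_mset (r M) * s ^ l = \<epsilon> (c M) * prod_mset M"
      unfolding prod[of M] by (simp add: A'_def)
  qed
  also have "\<dots> = (\<Sum>M\<in>A. \<epsilon> (c M) * prod_mset M)"
    unfolding A'_def by (rule sum.group) (use A le_n in auto)
  finally have sum_C: "(\<Sum>l\<le>n. C l * s ^ l) = 0" using sum by simp
  have "C (count M0 s) \<noteq> 0"
  proof
    assume "C (count M0 s) = 0"
    have inj: "inj_on r (A' (count M0 s))"
    proof (rule inj_onI)
      fix M N assume "M \<in> A' (count M0 s)" "N \<in> A' (count M0 s)" "r M = r N"
      then show "M = N" using split[of M] split[of N] by (simp add: A'_def)
    qed
    define c' where "c' = c \<circ> inv_into (A' (count M0 s)) r"
    have "(\<Sum>N\<in>r ` A' (count M0 s). \<epsilon> (c' N) * prod_mset N) = 0"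
      using \<open>C (count M0 s) = 0\<close> by (simp add: sum.reindex[OF inj] c'_def C_def inj)
    moreover have "finite (r ` A' (count M0 s))" using A by (auto simp: A'_def)
    moreover have "r M0 \<in> r ` A' (count M0 s)" using M0 by (auto simp: A'_def)
    moreover have "set_mset M \<subseteq> B" if "M \<in> r ` A' (count M0 s)" for M
      using that r_sub by (auto simp: A'_def)
    ultimately have "c' (r M0) = 0" using alg_indepD[OF assms(1)] by blast
    then show False using M0 inj by (simp add: c'_def A'_def)
  qed
  moreover have "C l \<in> alg B" for l
    unfolding C_def alg_def
    by (intro vs.span_sum vs.span_scale vs.span_base) (use r_sub in \<open>auto simp: A'_def\<close>)
  ultimately show ?thesis using alg_depI[of n C B s, OF _ sum_C le_n[OF M0(1)]] by blast
qed

text \<open>An independent subset of \<open>S\<close> of largest size exists because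
  \<open>alg_indep_card_le\<close> bounds the sizes by \<open>card U\<close>. By maximality all of
  \<open>S\<close> is algebraic over it, and \<open>alg_indep_card_le_trans\<close> gives the
  opposite inequality.\<close>

lemma exists_transcendence_basis:
  assumes "finite U" "alg_indep U" "S \<subseteq> polys U d" "\<And>x. x \<in> U \<Longrightarrow> alg_dep S x"
  shows "\<exists>B\<subseteq>S. finite B \<and> alg_indep B \<and> card B = card U"
proof -
  let ?P = "\<lambda>B. B \<subseteq> S \<and> finite B \<and> alg_indep B"
  have bound: "card B \<le> card U" if "?P B" for B
    using alg_indep_card_le[OF assms(1), of B d] assms(3) that by blast
  have "\<forall>B. ?P B \<longrightarrow> card B \<le> card U" by (intro allI impI, rule bound)
  with alg_indep_empty have "\<exists>B. ?P B \<and> (\<forall>B'. ?P B' \<longrightarrow> card B' \<le> card B)"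
    by (intro ex_has_greatest_nat[of ?P "{}" card "Suc (card U)"]) (simp_all add: less_Suc_eq_le)
  then obtain B where B: "?P B" and max: "\<And>B'. ?P B' \<Longrightarrow> card B' \<le> card B" by blast
  have "alg_dep B s" if "s \<in> S" for s
  proof (cases "s \<in> B")
    case True
    show ?thesis
      by (rule alg_depI[of 1 "\<lambda>l. if l = 0 then - s else 1" B s 1])
         (use True in \<open>auto intro: alg_base alg_uminus alg_1\<close>)
  next
    case False
    then have "\<not> alg_indep (insert s B)" using max[of "insert s B"] B that by auto
    then show ?thesis using alg_dep_if_insert_not_indep B False by blast
  qed
  then have "card U \<le> card B"
    using alg_indep_card_le_trans[OF assms(1,2,4)] B by blast
  then show ?thesis using B bound by (metis le_antisym)
qed

text \<open>A product of \<open>t\<close> elements of \<open>B\<close> has degree at most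
  \<open>d * t\<close> in \<open>U\<close>, which is where the factor \<open>d\<close> of the growth
  rate comes from.\<close>

theorem independent_over_alg_card_le:
  fixes y :: "'i \<Rightarrow> 'a"
  assumes "finite U" "alg_indep U" "S \<subseteq> polys U d" "\<And>x. x \<in> U \<Longrightarrow> alg_dep S x"
    and "finite I" "\<And>i. i \<in> I \<Longrightarrow> y i \<in> rat U"
    and indep: "\<And>a. (\<And>i. i \<in> I \<Longrightarrow> a i \<in> alg S) \<Longrightarrow> (\<Sum>i\<in>I. a i * y i) = 0 \<Longrightarrow> \<forall>i\<in>I. a i = 0"
  shows "card I \<le> d ^ card U"
proof -
  obtain B where B: "B \<subseteq> S" "finite B" "alg_indep B" "card B = card U"
    using exists_transcendence_basis[OF assms(1-4)] by blast
  obtain q where q: "q \<in> alg U" "q \<noteq> 0" "\<forall>i\<in>I. q * y i \<in> alg U"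
    using common_denominator[of I y U, OF assms(5,6)] by blast
  \<comment> \<open>\<open>q\<close> clears the denominators of the family and \<open>k\<close>
    bounds the degrees of the numerators; it is the additive constant that disappears in the
    limit.\<close>
  obtain k where k: "(\<lambda>i. q * y i) ` I \<subseteq> polys U k"
    using alg_finite_imp_polys[OF assms(1,5), of "\<lambda>i. q * y i"] q by auto
  show ?thesis
  proof (rule binomial_growth_leading_coeff)
    fix t
    let ?M = "{M. set_mset M \<subseteq> B \<and> size M \<le> t}"
    have fin_M: "finite ?M" using card_multisets_size_le(1)[OF B(2)] .
    obtain T where T: "finite T" "card T \<le> (card U + (d * t + k)) choose (d * t + k)"
      "polys U (d * t + k) = vs.span T"
      using polys_spanning_set[OF assms(1)] by blast
    have "card (I \<times> ?M) \<le> card T"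
    proof (rule independent_family_card_le[where f = "\<lambda>(i, M). prod_mset M * (q * y i)"])
      show "finite (I \<times> ?M)" using fin_M assms(5) by simp
      fix c assume "(\<Sum>a\<in>I \<times> ?M. \<epsilon> (c a) * (case a of (i, M) \<Rightarrow> prod_mset M * (q * y i))) = 0"
      also have "(\<Sum>a\<in>I \<times> ?M. \<epsilon> (c a) * (case a of (i, M) \<Rightarrow> prod_mset M * (q * y i))) =
          q * (\<Sum>i\<in>I. (\<Sum>M\<in>?M. \<epsilon> (c (i, M)) * prod_mset M) * y i)"
        unfolding sum_distrib_left sum_distrib_right sum.cartesian_product
        by (intro sum.cong) (auto simp: ac_simps)
      finally have sum_0: "(\<Sum>i\<in>I. (\<Sum>M\<in>?M. \<epsilon> (c (i, M)) * prod_mset M) * y i) = 0" using q by simp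
      have "(\<Sum>M\<in>?M. \<epsilon> (c (i, M)) * prod_mset M) \<in> alg S" for i
        unfolding alg_def by (intro vs.span_sum vs.span_scale vs.span_base) (use B(1) in auto)
      from indep[OF this sum_0] have "(\<Sum>M\<in>?M. \<epsilon> (c (i, M)) * prod_mset M) = 0" if "i \<in> I" for i
        using that by blast
      from alg_indepD[OF B(3) fin_M _ this] show "\<forall>a\<in>I \<times> ?M. c a = 0" by auto
    next
      show "(\<lambda>(i, M). prod_mset M * (q * y i)) ` (I \<times> ?M) \<subseteq> vs.span T"
      proof clarify
        fix i M assume i: "i \<in> I" and M: "set_mset M \<subseteq> B" "size M \<le> t"
        have "prod_mset M \<in> polys U (d * size M)"
          using M B assms(3) by (intro polys_prod_mset_le) auto
        moreover have "polys U (d * size M) \<subseteq> polys U (d * t)" using M by (intro polys_mono) auto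
        ultimately have "prod_mset M \<in> polys U (d * t)" by blast
        then show "prod_mset M * (q * y i) \<in> vs.span T"
          using polys_mult[of "prod_mset M" U "d * t" "q * y i" k] k i T(3) by blast
      qed
    qed (rule T(1))
    then show "card I * ((card U + t) choose t) \<le> (card U + (d * t + k)) choose (d * t + k)"
      using T(2) card_multisets_size_le(2)[OF B(2)] B(4) by (simp add: card_cartesian_product)
  qed
qed

lemma ring_hom_fixes_alg:
  assumes add: "\<And>x y. \<sigma> (x + y) = \<sigma> x + \<sigma> y" and mult: "\<And>x y. \<sigma> (x * y) = \<sigma> x * \<sigma> y"
    and const: "\<And>c. \<sigma> (\<epsilon> c) = \<epsilon> c" and S: "\<And>s. s \<in> S \<Longrightarrow> \<sigma> s = s"
    and x: "x \<in> alg S"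
  shows "\<sigma> x = x"
proof -
  have prod: "\<sigma> (prod_mset M) = prod_mset M" if "set_mset M \<subseteq> S" for M
    using that by (induction M) (use const[of 1] S in \<open>auto simp: mult hom_1\<close>)
  have "\<sigma> 0 = 0" using const[of 0] by (simp add: hom_0)
  with x[unfolded alg_def] show ?thesis
    by (induction rule: vs.span_induct_alt) (auto simp: add mult const prod)
qed

text \<open>The powers of an element \<open>h\<close> with \<open>card G\<close> distinct conjugates are independent over the fixed
  field, so an invariant \<open>u\<close> outside \<open>rat S\<close> would make \<open>h\<^sup>i\<close>, \<open>u h\<^sup>i\<close> independent over \<open>rat S\<close>.\<close>

theorem fixed_in_rat:
  fixes \<sigma> :: "'g \<Rightarrow> 'a \<Rightarrow> 'a"
  assumes "finite U" "alg_indep U" "S \<subseteq> polys U d" "\<And>x. x \<in> U \<Longrightarrow> alg_dep S x"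
    and "finite G"
    and add: "\<And>g x y. g \<in> G \<Longrightarrow> \<sigma> g (x + y) = \<sigma> g x + \<sigma> g y"
    and mult: "\<And>g x y. g \<in> G \<Longrightarrow> \<sigma> g (x * y) = \<sigma> g x * \<sigma> g y"
    and const: "\<And>g c. g \<in> G \<Longrightarrow> \<sigma> g (\<epsilon> c) = \<epsilon> c"
    and S: "\<And>g s. g \<in> G \<Longrightarrow> s \<in> S \<Longrightarrow> \<sigma> g s = s"
    and h: "h \<in> rat U" "inj_on (\<lambda>g. \<sigma> g h) G"
    and u: "u \<in> rat U" "\<And>g. g \<in> G \<Longrightarrow> \<sigma> g u = u"
    and less: "d ^ card U < 2 * card G"
  shows "u \<in> rat S"
proof (rule ccontr)
  assume contra: "u \<notin> rat S"
  \<comment> \<open>The Boolean selects the factor \<open>u\<close>, so the index set has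
    \<open>2 * card G\<close> elements.\<close>
  define y where "y = (\<lambda>(i, b). h ^ i * (if b then u else 1))"
  have "card ({..<card G} \<times> (UNIV :: bool set)) \<le> d ^ card U"
  proof (rule independent_over_alg_card_le[OF assms(1-4), where y = y])
    show "finite ({..<card G} \<times> (UNIV :: bool set))" by simp
    show "y i \<in> rat U" for i
      using h u by (auto simp: y_def split: prod.splits intro: rat_mult rat_power rat_1)
    fix a assume a: "\<And>i. i \<in> {..<card G} \<times> UNIV \<Longrightarrow> a i \<in> alg S"
      and "(\<Sum>i\<in>{..<card G} \<times> UNIV. a i * y i) = 0"
    define c where "c i = a (i, False) + a (i, True) * u" for i
    have "(\<Sum>i\<in>{..<card G} \<times> UNIV. a i * y i) = (\<Sum>i<card G. \<Sum>b\<in>UNIV. a (i, b) * y (i, b))"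
      by (simp add: sum.cartesian_product)
    also have "\<dots> = (\<Sum>i<card G. c i * h ^ i)"
      by (simp add: UNIV_bool y_def c_def algebra_simps)
    finally have sum_0: "(\<Sum>i<card G. c i * h ^ i) = 0"
      using \<open>(\<Sum>i\<in>{..<card G} \<times> UNIV. a i * y i) = 0\<close> by simp
    \<comment> \<open>Group elements fix the coefficients \<open>c i\<close>, so every conjugate of
      the root \<open>h\<close> is a root of \<open>p\<close>. These are \<open>card G\<close> roots
      in degree below \<open>card G\<close>.\<close>
    define p where "p = (\<Sum>i<card G. Polynomial.monom (c i) i)"
    have p_roots: "poly p (\<sigma> g h) = 0" if g: "g \<in> G" for g
    proof -
      have 0: "\<sigma> g 0 = 0" and 1: "\<sigma> g 1 = 1"
        using const[OF g, of 0] const[OF g, of 1] by (simp_all add: hom_0 hom_1)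
      have \<sigma>_sum: "\<sigma> g (sum f A) = (\<Sum>i\<in>A. \<sigma> g (f i))" for f and A :: "nat set"
        by (induction A rule: infinite_finite_induct) (auto simp: 0 add[OF g])
      have \<sigma>_power: "\<sigma> g (x ^ k) = \<sigma> g x ^ k" for x k
        by (induction k) (auto simp: 1 mult[OF g])
      have \<sigma>_c: "\<sigma> g (c i) = c i" if "i < card G" for i
      proof -
        have "\<sigma> g (a (i, b)) = a (i, b)" for b
          by (rule ring_hom_fixes_alg[OF add[OF g] mult[OF g] const[OF g] S[OF g] a]) (use that in auto)
        then show ?thesis by (simp add: c_def add[OF g] mult[OF g] u(2)[OF g])
      qed
      have "poly p (\<sigma> g h) = (\<Sum>i<card G. c i * \<sigma> g h ^ i)"
        by (simp add: p_def poly_sum poly_monom)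
      also have "\<dots> = \<sigma> g (\<Sum>i<card G. c i * h ^ i)"
        by (simp add: \<sigma>_sum mult[OF g] \<sigma>_power \<sigma>_c)
      finally show ?thesis using sum_0 0 by simp
    qed
    have "p = 0"
    proof (rule ccontr)
      assume "p \<noteq> 0"
      have "card G = card ((\<lambda>g. \<sigma> g h) ` G)" by (simp add: card_image[OF h(2)])
      also have "\<dots> \<le> card {x. poly p x = 0}"
        by (rule card_mono) (use p_roots poly_roots_finite[OF \<open>p \<noteq> 0\<close>] in auto)
      also have "\<dots> \<le> Polynomial.degree p" by (rule card_poly_roots_bound[OF \<open>p \<noteq> 0\<close>])
      finally have "card G \<le> Polynomial.degree p" .
      moreover have "Polynomial.coeff p i = 0" if "card G \<le> i" for i
        using that by (auto simp: p_def coeff_sum)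
      ultimately have "Polynomial.lead_coeff p = 0" by blast
      then show False using \<open>p \<noteq> 0\<close> by simp
    qed
    have c_0: "c i = 0" if "i < card G" for i
    proof -
      have "Polynomial.coeff p i = (\<Sum>j<card G. if j = i then c j else 0)"
        by (auto simp: p_def coeff_sum intro: sum.cong)
      then show ?thesis using \<open>p = 0\<close> that by simp
    qed
    have "a (i, b) = 0" if i: "i < card G" for i b
    proof -
      \<comment> \<open>Otherwise \<open>c i = 0\<close> would express \<open>u\<close> as a
        quotient of two elements of \<open>alg S\<close>.\<close>
      have T: "a (i, True) = 0"
      proof (rule ccontr)
        assume *: "a (i, True) \<noteq> 0"
        have "a (i, False) + a (i, True) * u = 0" using c_0[OF i] by (simp add: c_def)
        then have "a (i, True) * u = - a (i, False)" by (metis add.commute eq_neg_iff_add_eq_0)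
        with * have "u = (- a (i, False)) / a (i, True)" by (simp add: field_simps)
        moreover have "(- a (i, False)) / a (i, True) \<in> rat S"
          using a i by (intro ratI alg_uminus) auto
        ultimately show False using contra by simp
      qed
      then show ?thesis using c_0[OF i] by (cases b) (simp_all add: c_def)
    qed
    then show "\<forall>i\<in>{..<card G} \<times> UNIV. a i = 0" by auto
  qed
  then show False using less by (simp add: card_cartesian_product card_UNIV_bool)
qed

text \<open>For distinct \<open>g\<close>, \<open>g'\<close> the polynomial \<open>\<Sum>\<^sub>x (g x - g' x) T\<^bsup>f x\<^esup>\<close> has finitely many roots, so some
  invariant value of \<open>T\<close> makes \<open>\<Sum>\<^sub>x x T\<^bsup>f x\<^esup>\<close> separate the group elements.\<close>

lemma exists_separating_element:
  fixes \<sigma> :: "'g \<Rightarrow> 'a \<Rightarrow> 'a"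
  assumes "finite U" "finite G"
    and add: "\<And>g x y. g \<in> G \<Longrightarrow> \<sigma> g (x + y) = \<sigma> g x + \<sigma> g y"
    and mult: "\<And>g x y. g \<in> G \<Longrightarrow> \<sigma> g (x * y) = \<sigma> g x * \<sigma> g y"
    and const: "\<And>g c. g \<in> G \<Longrightarrow> \<sigma> g (\<epsilon> c) = \<epsilon> c"
    and T: "U \<noteq> {} \<Longrightarrow> infinite T" "T \<subseteq> rat U" "\<And>g t. g \<in> G \<Longrightarrow> t \<in> T \<Longrightarrow> \<sigma> g t = t"
    and sep: "\<And>g g'. g \<in> G \<Longrightarrow> g' \<in> G \<Longrightarrow> g \<noteq> g' \<Longrightarrow> \<exists>x\<in>U. \<sigma> g x \<noteq> \<sigma> g' x"
  shows "\<exists>h\<in>rat U. inj_on (\<lambda>g. \<sigma> g h) G"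
proof (cases "U = {}")
  case True
  \<comment> \<open>With nothing to separate by, \<open>sep\<close> leaves at most one element in
    \<open>G\<close>, so any \<open>h\<close> works.\<close>
  then have "inj_on (\<lambda>g. \<sigma> g 0) G" using sep by (intro inj_onI) blast
  then show ?thesis using rat_0 by blast
next
  case False
  \<comment> \<open>Distinct exponents keep the contributions of different \<open>x\<close> apart,
    so \<open>p g g'\<close> is nonzero as soon as one difference is.\<close>
  obtain f :: "'a \<Rightarrow> nat" where f: "inj_on f U"
    using finite_imp_inj_to_nat_seg[OF assms(1)] by blast
  define p where "p g g' = (\<Sum>x\<in>U. Polynomial.monom (\<sigma> g x - \<sigma> g' x) (f x))" for g g'
  have "p g g' \<noteq> 0" if "g \<in> G" "g' \<in> G" "g \<noteq> g'" for g g'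
  proof -
    obtain x where x: "x \<in> U" "\<sigma> g x \<noteq> \<sigma> g' x" using sep[OF \<open>g \<in> G\<close> \<open>g' \<in> G\<close> \<open>g \<noteq> g'\<close>] by blast
    have "Polynomial.coeff (p g g') (f x) = (\<Sum>z\<in>U. if z = x then \<sigma> g z - \<sigma> g' z else 0)"
      unfolding p_def coeff_sum using f x by (intro sum.cong) (auto simp: inj_on_def)
    then have "Polynomial.coeff (p g g') (f x) \<noteq> 0" using x assms(1) by simp
    then show ?thesis by auto
  qed
  then have fin: "finite (\<Union>(g, g')\<in>G \<times> G - Id. {t. poly (p g g') t = 0})" (is "finite ?R")
    using assms(2) by (auto intro: poly_roots_finite)
  have "\<not> T \<subseteq> ?R" using T(1)[OF False] finite_subset[OF _ fin] by blast
  then obtain t where t: "t \<in> T" "t \<notin> ?R" by blast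
  have t_root: "poly (p g g') t \<noteq> 0" if "g \<in> G" "g' \<in> G" "g \<noteq> g'" for g g'
    using t(2) that by auto
  define h where "h = (\<Sum>x\<in>U. x * t ^ f x)"
  have \<sigma>_h: "\<sigma> g h = (\<Sum>x\<in>U. \<sigma> g x * t ^ f x)" if g: "g \<in> G" for g
  proof -
    have 0: "\<sigma> g 0 = 0" and 1: "\<sigma> g 1 = 1"
      using const[OF g, of 0] const[OF g, of 1] by (simp_all add: hom_0 hom_1)
    have "\<sigma> g (sum f A) = (\<Sum>i\<in>A. \<sigma> g (f i))" for f and A :: "'a set"
      by (induction A rule: infinite_finite_induct) (auto simp: 0 add[OF g])
    moreover have "\<sigma> g (t ^ k) = t ^ k" for k
      by (induction k) (auto simp: 1 mult[OF g] T(3)[OF g t(1)])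
    ultimately show ?thesis by (simp add: h_def mult[OF g])
  qed
  have "inj_on (\<lambda>g. \<sigma> g h) G"
  proof (rule inj_onI, rule ccontr)
    fix g g' assume g: "g \<in> G" "g' \<in> G" "\<sigma> g h = \<sigma> g' h" "g \<noteq> g'"
    have "poly (p g g') t = \<sigma> g h - \<sigma> g' h"
      by (simp add: \<sigma>_h g(1,2) p_def poly_sum poly_monom algebra_simps sum_subtractf)
    then show False using t_root[OF g(1,2,4)] g(3) by simp
  qed
  moreover have "h \<in> rat U" unfolding h_def
    using T(2) t(1) by (intro rat_sum rat_mult rat_power) (auto intro: rat_base)
  ultimately show ?thesis by blast
qed

end

section \<open>Generated fields and algebraic elements in the associated ring structure\<close>

lemma ring_of_type_algebra_simps [simp]:
  "carrier ring_of_type_algebra = UNIV" "x \<otimes>\<^bsub>ring_of_type_algebra\<^esub> y = x * y"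
  "x \<oplus>\<^bsub>ring_of_type_algebra\<^esub> y = x + y" "\<one>\<^bsub>ring_of_type_algebra\<^esub> = 1" "\<zero>\<^bsub>ring_of_type_algebra\<^esub> = 0"
  by (simp_all add: ring_of_type_algebra_def)

lemma a_inv_ring_of_type_algebra [simp]: "\<ominus>\<^bsub>ring_of_type_algebra\<^esub> x = - (x :: 'a::field)"
proof -
  interpret R: field "ring_of_type_algebra :: 'a ring" by auto
  show ?thesis using R.minus_equality[of "- x" x] by simp
qed

lemma m_inv_ring_of_type_algebra: "x \<noteq> 0 \<Longrightarrow> inv\<^bsub>ring_of_type_algebra\<^esub> x = inverse (x :: 'a::field)"
proof -
  interpret R: field "ring_of_type_algebra :: 'a ring" by auto
  assume "x \<noteq> 0"
  then show ?thesis using R.inv_unique'[of x "inverse x"] by simp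
qed

lemma pow_ring_of_type_algebra [simp]: "x [^]\<^bsub>ring_of_type_algebra\<^esub> (n :: nat) = (x :: 'a::field) ^ n"
proof -
  interpret R: field "ring_of_type_algebra :: 'a ring" by auto
  show ?thesis by (induction n) (simp_all add: mult.commute)
qed

context field_embedding
begin

lemma subfield_rat: "subfield (rat S) (ring_of_type_algebra :: 'a ring)"
proof -
  interpret R: field "ring_of_type_algebra :: 'a ring" by auto
  show ?thesis
    by (rule R.subfieldI'[OF R.subringI])
       (auto simp: m_inv_ring_of_type_algebra rat_1 rat_uminus rat_mult rat_add rat_inverse)
qed

text \<open>\<open>rat\<close> always contains the constants while \<open>generate_field\<close>
  adjoins only \<open>S\<close>, hence the hypothesis on \<open>range \<epsilon>\<close>.\<close>

lemma generate_field_eq_rat: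
  assumes "range \<epsilon> \<subseteq> S"
  shows "generate_field ring_of_type_algebra S = rat S"
proof -
  interpret R: field "ring_of_type_algebra :: 'a ring" by auto
  let ?F = "generate_field (ring_of_type_algebra :: 'a ring) S"
  have F: "\<epsilon> c \<in> ?F" "0 \<in> ?F" "1 \<in> ?F" "x \<in> ?F \<Longrightarrow> y \<in> ?F \<Longrightarrow> x + y \<in> ?F"
    "x \<in> ?F \<Longrightarrow> y \<in> ?F \<Longrightarrow> x * y \<in> ?F" "x \<in> ?F \<Longrightarrow> x \<noteq> 0 \<Longrightarrow> inverse x \<in> ?F" for c x y
    using assms generate_field.incl[of "\<epsilon> c" S] generate_field.one[of "ring_of_type_algebra :: 'a ring" S]
      R.zero_in_generate[of S] generate_field.eng_add[of x "ring_of_type_algebra :: 'a ring" S y]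
      generate_field.eng_mult[of x "ring_of_type_algebra :: 'a ring" S y]
      generate_field.m_inv[of x "ring_of_type_algebra :: 'a ring" S]
    by (auto simp: m_inv_ring_of_type_algebra)
  have prod: "prod_mset M \<in> ?F" if "set_mset M \<subseteq> S" for M
    using that by (induction M) (auto intro: F generate_field.incl)
  have "x \<in> ?F" if "x \<in> alg S" for x
    using that unfolding alg_def
    by (induction rule: vs.span_induct_alt) (auto intro: F prod)
  then have "rat S \<subseteq> ?F" unfolding rat_def by (auto simp: divide_inverse intro!: F)
  moreover have "?F \<subseteq> rat S"
    by (rule R.generate_field_min_subfield1[OF _ subfield_rat]) (auto intro: rat_base)
  ultimately show ?thesis by blast
qed

text \<open>Coefficient lists start with the leading coefficient, which reverses the index.\<close>

lemma eval_ring_of_type_algebra: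
  fixes x :: 'a
  shows "ring.eval ring_of_type_algebra p x = (\<Sum>i<length p. p ! (length p - Suc i) * x ^ i)"
proof -
  interpret R: field "ring_of_type_algebra :: 'a ring" by auto
  show ?thesis
  proof (induction p)
    case (Cons a p)
    have "(\<Sum>i<length p. (a # p) ! (length p - i) * x ^ i) = (\<Sum>i<length p. p ! (length p - Suc i) * x ^ i)"
      by (intro sum.cong) (auto simp: nth_Cons' )
    then show ?case using Cons by (simp add: add.commute)
  qed simp
qed

text \<open>Polynomials over \<open>rat S\<close> become polynomials over \<open>alg S\<close> by
  clearing denominators; conversely \<open>alg S\<close> is contained in
  \<open>rat S\<close>.\<close>

lemma algebraic_iff_alg_dep:
  "(ring.algebraic ring_of_type_algebra over rat S) x \<longleftrightarrow> alg_dep S x"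
proof -
  interpret R: field "ring_of_type_algebra :: 'a ring" by auto
  note carrier = univ_poly_carrier[symmetric]
  show ?thesis
  proof
    assume "(R.algebraic over rat S) x"
    then obtain p where p: "p \<in> carrier (univ_poly ring_of_type_algebra (rat S))" "p \<noteq> []" "R.eval p x = 0"
      using R.algebraicE[of "rat S" x] subfieldE(1)[OF subfield_rat] by auto
    then have sub: "set p \<subseteq> rat S" "hd p \<noteq> 0"
      by (auto simp: carrier polynomial_def)
    define n where "n = length p - 1"
    have len: "length p = Suc n" using p(2) by (simp add: n_def)
    show "alg_dep S x"
    proof (rule alg_dep_rat[of n "\<lambda>i. p ! (n - i)"])
      show "p ! (n - l) \<in> rat S" if "l \<le> n" for l using sub len by (auto intro: subsetD)
      show "p ! (n - n) \<noteq> 0" using sub p(2) by (simp add: hd_conv_nth)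
      show "(\<Sum>l\<le>n. p ! (n - l) * x ^ l) = 0"
        using p(3) unfolding eval_ring_of_type_algebra len by (simp add: lessThan_Suc_atMost)
    qed
  next
    assume "alg_dep S x"
    then obtain n c where c: "\<forall>l\<le>n. c l \<in> alg S" "c n \<noteq> 0" "(\<Sum>l\<le>n. c l * x ^ l) = 0"
      unfolding alg_dep_def by blast
    define p where "p = map (\<lambda>i. c (n - i)) [0..<Suc n]"
    have len: "length p = Suc n" by (simp add: p_def)
    have nth_p: "p ! k = c (n - k)" if "k \<le> n" for k
      using that nth_upt[of 0 k "Suc n"] nth_map[of k "[0..<Suc n]" "\<lambda>i. c (n - i)"]
      by (simp add: p_def del: upt_Suc)
    have rat: "c (n - l) \<in> rat S" for l
      using c(1) by (intro subsetD[OF alg_subset_rat]) simp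
    show "(R.algebraic over rat S) x"
    proof (rule R.algebraicI)
      show "p \<noteq> []" using len by auto
      show "p \<in> carrier (univ_poly ring_of_type_algebra (rat S))"
        using c(2) rat by (auto simp: carrier polynomial_def p_def hd_map simp del: upt_Suc)
      show "R.eval p x = \<zero>\<^bsub>ring_of_type_algebra\<^esub>"
      proof -
        have "(\<Sum>i<Suc n. p ! (Suc n - Suc i) * x ^ i) = (\<Sum>i\<le>n. c i * x ^ i)"
          unfolding lessThan_Suc_atMost
          by (intro sum.cong) (simp_all add: nth_p)
        then show ?thesis unfolding eval_ring_of_type_algebra len using c(3) by simp
      qed
    qed
  qed
qed

end

section \<open>Rational functions in the coordinates\<close>

definition of_mpoly :: "('n::{finite,linorder}, 'k::field) mpoly \<Rightarrow> ('n, 'k) mpoly fract" where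
  "of_mpoly p = Fract p 1"

definition fconst :: "'k::field \<Rightarrow> ('n::{finite,linorder}, 'k) mpoly fract" where
  "fconst c = of_mpoly (mconst c)"

definition coord :: "'n::{finite,linorder} \<Rightarrow> ('n, 'k::field) mpoly fract" where
  "coord i = of_mpoly (mvar i)"

lemma mconst_0 [simp]: "mconst 0 = 0" and mconst_1 [simp]: "mconst 1 = 1"
  by (simp_all add: mconst_def)

lemma of_mpoly_add: "of_mpoly (p + q) = of_mpoly p + of_mpoly q"
  by (simp add: of_mpoly_def)

lemma of_mpoly_mult: "of_mpoly (p * q) = of_mpoly p * of_mpoly q"
  by (simp add: of_mpoly_def)

lemma of_mpoly_0 [simp]: "of_mpoly 0 = 0" and of_mpoly_1 [simp]: "of_mpoly 1 = 1"
  by (simp_all add: of_mpoly_def fract_collapse)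

lemma of_mpoly_eq_iff [simp]: "of_mpoly p = of_mpoly q \<longleftrightarrow> p = q"
  by (simp add: of_mpoly_def eq_fract)

lemma of_mpoly_eq_0_iff [simp]: "of_mpoly p = 0 \<longleftrightarrow> p = 0"
  using of_mpoly_eq_iff[of p 0] by simp

lemma of_mpoly_sum: "of_mpoly (\<Sum>i\<in>A. f i) = (\<Sum>i\<in>A. of_mpoly (f i))"
  by (induction A rule: infinite_finite_induct) (auto simp: of_mpoly_add)

lemma of_mpoly_prod: "of_mpoly (\<Prod>i\<in>A. f i) = (\<Prod>i\<in>A. of_mpoly (f i))"
  by (induction A rule: infinite_finite_induct) (auto simp: of_mpoly_mult)

lemma of_mpoly_power: "of_mpoly (p ^ n) = of_mpoly p ^ n"
  by (induction n) (auto simp: of_mpoly_mult)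

lemma Fract_eq_divide: "q \<noteq> 0 \<Longrightarrow> Fract p q = of_mpoly p / of_mpoly q"
  by (simp add: of_mpoly_def)

text \<open>The coefficient field remains a type variable, so \<open>polys\<close>,
  \<open>alg\<close>, \<open>rat\<close> and \<open>alg_dep\<close> serve the function fields over
  both \<open>k\<close> and \<open>K\<close>.\<close>

interpretation field_embedding "fconst :: 'k::field \<Rightarrow> ('n::{finite,linorder}, 'k) mpoly fract"
  by unfold_locales
    (simp_all add: fconst_def mconst_add mconst_mult of_mpoly_add of_mpoly_mult)

lemma single_one_eq_iff: "Poly_Mapping.single i (1::nat) = Poly_Mapping.single j 1 \<longleftrightarrow> i = j"
  by (metis lookup_single_eq lookup_single_not_eq one_neq_zero)

lemma inj_mvar: "inj (mvar :: 'n \<Rightarrow> ('n, 'k::field) mpoly)"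
proof (rule injI)
  fix i j :: 'n
  assume "(mvar i :: ('n, 'k) mpoly) = mvar j"
  then have "Poly_Mapping.keys (mvar i :: ('n, 'k) mpoly) = Poly_Mapping.keys (mvar j :: ('n, 'k) mpoly)"
    by simp
  then have "Poly_Mapping.single i (1::nat) = Poly_Mapping.single j 1" by (simp add: mvar_def)
  then show "i = j" by (simp only: single_one_eq_iff)
qed

lemma inj_coord: "inj (coord :: 'n::{finite,linorder} \<Rightarrow> ('n, 'k::field) mpoly fract)"
  using inj_mvar by (auto simp: inj_def coord_def)

definition exponent :: "('n::{finite,linorder}, 'k::field) mpoly fract multiset \<Rightarrow> 'n \<Rightarrow>\<^sub>0 nat" where
  "exponent M = (\<Sum>i\<in>UNIV. Poly_Mapping.single i (count M (coord i)))"

lemma lookup_exponent: "Poly_Mapping.lookup (exponent M) i = count M (coord i)"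
  by (simp add: exponent_def lookup_sum lookup_single when_def)

lemma prod_mset_coords:
  fixes M :: "('n::{finite,linorder}, 'k::field) mpoly fract multiset"
  assumes "set_mset M \<subseteq> range coord"
  shows "prod_mset M = of_mpoly (Poly_Mapping.single (exponent M) 1)"
  using assms
proof (induction M)
  case empty
  have "exponent ({#} :: ('n, 'k) mpoly fract multiset) = 0"
    by (rule poly_mapping_eqI) (simp add: lookup_exponent)
  then show ?case by simp
next
  case (add x M)
  then obtain i where i: "x = coord i" by auto
  have "exponent (add_mset x M) = Poly_Mapping.single i 1 + exponent M"
    by (rule poly_mapping_eqI)
       (auto simp: lookup_exponent lookup_add lookup_single i when_def injD[OF inj_coord])
  then have "Poly_Mapping.single (exponent (add_mset x M)) (1::'k) =
      mvar i * Poly_Mapping.single (exponent M) 1"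
    by (simp add: mvar_def mult_single)
  then show ?case using add by (simp add: of_mpoly_mult i coord_def)
qed

lemma exponent_inj:
  assumes "set_mset M \<subseteq> range coord" "set_mset N \<subseteq> range coord" "exponent M = exponent N"
  shows "M = N"
proof (rule multiset_eqI)
  fix x
  show "count M x = count N x"
  proof (cases "x \<in> range coord")
    case True
    then show ?thesis using assms(3) lookup_exponent by (metis rangeE)
  next
    case False
    then show ?thesis using assms(1,2) by (metis in_mono not_in_iff)
  qed
qed

text \<open>Multisets of coordinates correspond injectively to exponent vectors, so each scalar of a
  relation is a single coefficient of a polynomial.\<close>

lemma alg_indep_coords: "alg_indep (coord ` I :: ('n::{finite,linorder}, 'k::field) mpoly fract set)"
  unfolding alg_indep_def
proof (intro allI impI ballI)
  fix A :: "('n, 'k) mpoly fract multiset set" and c M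
  assume A: "finite A" "\<forall>M\<in>A. set_mset M \<subseteq> coord ` I"
    and sum: "(\<Sum>M\<in>A. fconst (c M) * prod_mset M) = 0" and M: "M \<in> A"
  have sub: "set_mset M \<subseteq> range coord" if "M \<in> A" for M using A(2) that by blast
  have "of_mpoly (\<Sum>M\<in>A. Poly_Mapping.single (exponent M) (c M)) = (\<Sum>M\<in>A. fconst (c M) * prod_mset M)"
    unfolding of_mpoly_sum
    by (intro sum.cong)
       (auto simp: prod_mset_coords[OF sub] fconst_def mconst_def mult_single simp flip: of_mpoly_mult)
  then have "(\<Sum>M\<in>A. Poly_Mapping.single (exponent M) (c M)) = 0" using sum by simp
  then have "Poly_Mapping.lookup (\<Sum>M\<in>A. Poly_Mapping.single (exponent M) (c M)) (exponent M) = 0"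
    by simp
  moreover have "Poly_Mapping.lookup (\<Sum>M\<in>A. Poly_Mapping.single (exponent M) (c M)) (exponent M) =
      (\<Sum>N\<in>A. if N = M then c N else 0)"
    unfolding lookup_sum lookup_single when_def
    by (intro sum.cong) (use exponent_inj[OF sub sub] M in auto)
  ultimately show "c M = 0" using A(1) M by simp
qed

lemma single_in_polys:
  assumes "Poly_Mapping.keys m \<subseteq> I" "(\<Sum>i\<in>UNIV. Poly_Mapping.lookup m i) \<le> d"
  shows "of_mpoly (Poly_Mapping.single m c) \<in>
    polys (coord ` I :: ('n::{finite,linorder}, 'k::field) mpoly fract set) d"
proof -
  define M where "M = (\<Sum>i\<in>UNIV. replicate_mset (Poly_Mapping.lookup m i) (coord i :: ('n, 'k) mpoly fract))"
  have cnt: "count M (coord i) = Poly_Mapping.lookup m i" for i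
    by (simp add: M_def count_sum inj_eq[OF inj_coord])
  have size: "size M = (\<Sum>i\<in>UNIV. Poly_Mapping.lookup m i)"
    unfolding M_def by (simp add: size_multiset_sum)
  have sub: "set_mset M \<subseteq> coord ` I"
  proof
    fix x assume "x \<in># M"
    then obtain i where "x = coord i" "Poly_Mapping.lookup m i \<noteq> 0"
      unfolding M_def by (auto simp: set_mset_sum split: if_splits)
    then have "i \<in> I" using assms(1) by (meson in_keys_iff subsetD)
    then show "x \<in> coord ` I" using \<open>x = coord i\<close> by blast
  qed
  have "exponent M = m" by (rule poly_mapping_eqI) (simp add: lookup_exponent cnt)
  then have "of_mpoly (Poly_Mapping.single m c) = fconst c * prod_mset M"
    using sub by (subst prod_mset_coords) (auto simp: fconst_def mconst_def mult_single simp flip: of_mpoly_mult)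
  moreover have "prod_mset M \<in> polys (coord ` I) d"
    using sub size assms(2) by (intro polys_prod_mset) auto
  ultimately show ?thesis using polys_mult[OF polys_const[of c _ 0]] by fastforce
qed

lemma of_mpoly_in_polys:
  assumes "deg_le f d"
  shows "of_mpoly f \<in> polys (range coord) d"
proof -
  have "of_mpoly f = (\<Sum>m\<in>Poly_Mapping.keys f. of_mpoly (Poly_Mapping.single m (Poly_Mapping.lookup f m)))"
    using mpoly_sum_single[of f] by (metis of_mpoly_sum)
  also have "\<dots> \<in> polys (range coord) d"
    by (intro polys_sum single_in_polys) (use assms in \<open>auto simp: deg_le_def\<close>)
  finally show ?thesis .
qed

lemma ex_deg_le: "\<exists>d. deg_le f d"
  unfolding deg_le_def using finite_nat_set_iff_bounded_le[of "(\<lambda>m. \<Sum>i\<in>UNIV. Poly_Mapping.lookup m i) ` Poly_Mapping.keys f"]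
  by auto

lemma deg_le_mono: "deg_le f d \<Longrightarrow> d \<le> d' \<Longrightarrow> deg_le f d'"
  unfolding deg_le_def by force

lemma of_mpoly_in_alg: "of_mpoly f \<in> alg (range coord)"
  using ex_deg_le[of f] of_mpoly_in_polys polys_subset_alg by blast

lemma rat_coords: "rat (range coord) = (UNIV :: ('n::{finite,linorder}, 'k::field) mpoly fract set)"
proof -
  have "x \<in> rat (range coord)" for x :: "('n, 'k) mpoly fract"
    by (cases x) (simp add: Fract_eq_divide ratI of_mpoly_in_alg)
  then show ?thesis by blast
qed

lemma mcompose_add: "mcompose A (f + g) = mcompose A f + mcompose A g"
  by (simp add: mcompose_def msubst_add)

lemma mcompose_mult: "mcompose A (f * g) = mcompose A f * mcompose A g"
  by (simp add: mcompose_def msubst_mult)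

lemma mcompose_mconst [simp]: "mcompose A (mconst c) = mconst c"
  by (simp add: mcompose_def)

lemma mcompose_0 [simp]: "mcompose A 0 = 0" and mcompose_1 [simp]: "mcompose A 1 = 1"
  by (simp_all add: mcompose_def)

lemma mcompose_uminus: "mcompose A (- f) = - mcompose A (f :: ('n::finite, 'k::comm_ring_1) mpoly)"
  using mcompose_add[of A f "- f"] by (simp add: eq_neg_iff_add_eq_0 add.commute)

lemma mcompose_sum: "mcompose A (\<Sum>i\<in>S. f i) = (\<Sum>i\<in>S. mcompose A (f i))"
  by (simp add: mcompose_def msubst_sum)

lemma mcompose_prod: "mcompose A (\<Prod>i\<in>S. f i) = (\<Prod>i\<in>S. mcompose A (f i))"
  by (simp add: mcompose_def msubst_prod)

lemma mcompose_mvar: "mcompose A (mvar i) = (\<Sum>j\<in>UNIV. mconst (A $ i $ j) * mvar j)"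
  by (simp add: mcompose_def)

lemma fcompose_of_mpoly: "invertible A \<Longrightarrow> fcompose A (of_mpoly f) = of_mpoly (mcompose A f)"
  by (simp add: of_mpoly_def fcompose_Fract)

lemma fcompose_add: "invertible A \<Longrightarrow> fcompose A (x + y) = fcompose A x + fcompose A y"
  by (cases x, cases y)
     (simp add: fcompose_Fract mcompose_eq_0_iff mcompose_add mcompose_mult)

lemma fcompose_mult: "invertible A \<Longrightarrow> fcompose A (x * y) = fcompose A x * fcompose A y"
  by (cases x, cases y) (simp add: fcompose_Fract mcompose_mult)

lemma fcompose_fconst: "invertible A \<Longrightarrow> fcompose A (fconst c) = fconst c"
  by (simp add: fconst_def fcompose_of_mpoly)

lemma map_poly_mult_hom:
  assumes "\<phi> 0 = 0" "\<And>a b. \<phi> (a + b) = \<phi> a + \<phi> b" "\<And>a b. \<phi> (a * b) = \<phi> a * \<phi> b"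
  shows "map_poly \<phi> (p * q) = map_poly \<phi> p * map_poly \<phi> (q :: 'a::comm_semiring_0 poly)"
proof (rule poly_eqI)
  fix n
  have "\<phi> (sum f A) = (\<Sum>i\<in>A. \<phi> (f i))" for f and A :: "nat set"
    by (induction A rule: infinite_finite_induct) (auto simp: assms)
  then show "Polynomial.coeff (map_poly \<phi> (p * q)) n = Polynomial.coeff (map_poly \<phi> p * map_poly \<phi> q) n"
    by (simp add: Polynomial.coeff_mult coeff_map_poly assms)
qed

text \<open>Reads matrix entries off the action on the coordinates; with faithfulness the
  coordinates then separate the group elements.\<close>

lemma coeff_mvar_sum:
  "Poly_Mapping.lookup (\<Sum>j\<in>UNIV. mconst (c j) * mvar j) (Poly_Mapping.single i 1) = c (i :: 'n::finite)"
proof -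
  have "Poly_Mapping.lookup (mconst (c j) * mvar j) (Poly_Mapping.single i 1) = (if j = i then c j else 0)" for j
    using single_one_eq_iff[of j i] by (simp add: mconst_def mvar_def mult_single lookup_single when_def)
  then show ?thesis by (simp add: lookup_sum)
qed

section \<open>Faithful representations\<close>

context field_embedding
begin

lemma rat_subset_subfield:
  assumes "subfield E (ring_of_type_algebra :: 'a ring)" "range \<epsilon> \<subseteq> E" "S \<subseteq> E"
  shows "rat S \<subseteq> E"
proof -
  interpret R: field "ring_of_type_algebra :: 'a ring" by auto
  have "rat S \<subseteq> rat (S \<union> range \<epsilon>)" by (rule rat_mono) auto
  also have "\<dots> = generate_field ring_of_type_algebra (S \<union> range \<epsilon>)"
    by (rule generate_field_eq_rat[symmetric]) auto
  also have "\<dots> \<subseteq> E" by (rule R.generate_field_min_subfield1) (use assms in auto)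
  finally show ?thesis .
qed

text \<open>Finitely many algebraic elements generate a finite extension, and here that extension is
  the whole field.\<close>

lemma finite_dimension_UNIV:
  assumes "finite U" "rat U = UNIV" "subfield E (ring_of_type_algebra :: 'a ring)" "range \<epsilon> \<subseteq> E"
    and "\<And>x. x \<in> U \<Longrightarrow> (ring.algebraic ring_of_type_algebra over E) x"
  shows "ring.finite_dimension ring_of_type_algebra E (UNIV :: 'a set)"
proof -
  interpret R: field "ring_of_type_algebra :: 'a ring" by auto
  obtain xs where xs: "set xs = U" using assms(1) finite_list by blast
  have sub: "set xs \<subseteq> carrier (ring_of_type_algebra :: 'a ring)" by simp
  have alg: "(R.algebraic over E) x" if "x \<in> set xs" for x using assms(5) xs that by blast
  have F: "subfield (R.finite_extension E xs) ring_of_type_algebra"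
    by (rule R.finite_extension_is_subfield[OF assms(3) sub alg])
  have "rat U \<subseteq> R.finite_extension E xs"
  proof (rule rat_subset_subfield[OF F])
    show "range \<epsilon> \<subseteq> R.finite_extension E xs"
      using assms(4) R.finite_extension_incl[of E xs] by (simp add: subset_trans)
    show "U \<subseteq> R.finite_extension E xs"
      using R.finite_extension_mem[OF subfieldE(1)[OF assms(3)] sub] xs by simp
  qed
  then have "R.finite_extension E xs = UNIV" using assms(2) by blast
  then show ?thesis using R.finite_extension_finite_dimension(1)[OF assms(3) sub alg] by simp
qed

end

lemma mvar_neq_0: "mvar i \<noteq> (0 :: ('n, 'k::field) mpoly)"
  unfolding mvar_def by (metis lookup_single_eq lookup_zero one_neq_zero)

locale finite_faithful_rep = group G for G :: "('g, 'b) monoid_scheme" (structure) +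
  fixes \<rho> :: "'g \<Rightarrow> ('k::field, 'n::{finite,linorder}) sqmat"
  assumes finite_G: "finite (carrier G)" and faithful: "faithful_rep G \<rho>"
begin

definition act :: "'g \<Rightarrow> ('n, 'k) mpoly \<Rightarrow> ('n, 'k) mpoly" where
  "act g = mcompose (\<rho> (inv g))"

definition fract_act :: "'g \<Rightarrow> ('n, 'k) mpoly fract \<Rightarrow> ('n, 'k) mpoly fract" where
  "fract_act g = fcompose (\<rho> (inv g))"

abbreviation invs :: "nat \<Rightarrow> ('n, 'k) mpoly fract set" where
  "invs d \<equiv> of_mpoly ` poly_invariants_le G \<rho> d"

lemma invertible_rho: "g \<in> carrier G \<Longrightarrow> invertible (\<rho> g)"
  using faithful by (auto simp: faithful_rep_def hom_def GL_monoid_def)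

lemma rho_mult: "g \<in> carrier G \<Longrightarrow> h \<in> carrier G \<Longrightarrow> \<rho> (g \<otimes> h) = \<rho> g ** \<rho> h"
  using faithful by (auto simp: faithful_rep_def hom_def GL_monoid_def)

lemma rho_inj: "g \<in> carrier G \<Longrightarrow> h \<in> carrier G \<Longrightarrow> \<rho> g = \<rho> h \<Longrightarrow> g = h"
  using faithful by (auto simp: faithful_rep_def inj_on_def)

lemma act_mult: "act g (p * q) = act g p * act g q" and act_add: "act g (p + q) = act g p + act g q"
  by (simp_all add: act_def mcompose_mult mcompose_add)

lemma act_0: "act g 0 = 0" and act_1: "act g 1 = 1"
  and act_uminus: "act g (- p) = - act g p"
  by (simp_all add: act_def mcompose_uminus)

lemma act_prod: "act g (\<Prod>i\<in>A. f i) = (\<Prod>i\<in>A. act g (f i))"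
  by (simp add: act_def mcompose_prod)

lemma act_act: "g \<in> carrier G \<Longrightarrow> h \<in> carrier G \<Longrightarrow> act g (act h f) = act (g \<otimes> h) f"
  by (simp add: act_def mcompose_mcompose rho_mult inv_mult_group)

lemma fract_act_hom:
  assumes "g \<in> carrier G"
  shows "fract_act g (x + y) = fract_act g x + fract_act g y" "fract_act g (x * y) = fract_act g x * fract_act g y"
    "fract_act g (fconst c) = fconst c" "fract_act g (of_mpoly f) = of_mpoly (act g f)"
  using assms invertible_rho[of "inv g"]
  by (simp_all add: fract_act_def act_def fcompose_add fcompose_mult fcompose_fconst fcompose_of_mpoly)

lemma fract_act_divide:
  assumes "g \<in> carrier G"
  shows "fract_act g (x / y) = fract_act g x / fract_act g y"
proof (cases "y = 0")
  case True
  have "fract_act g 0 = 0" using fract_act_hom(3)[OF assms, of 0] by (simp add: fconst_def)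
  then show ?thesis using True by simp
next
  case False
  have 1: "fract_act g 1 = 1" using fract_act_hom(3)[OF assms, of 1] by (simp add: fconst_def)
  have "fract_act g y * fract_act g (1 / y) = 1"
    using False 1 by (simp flip: fract_act_hom(2)[OF assms])
  moreover have "fract_act g (x / y) = fract_act g x * fract_act g (1 / y)"
    by (simp flip: fract_act_hom(2)[OF assms])
  ultimately show ?thesis by (metis divide_inverse inverse_unique)
qed

lemma bij_left_translation: "g \<in> carrier G \<Longrightarrow> bij_betw (\<lambda>h. g \<otimes> h) (carrier G) (carrier G)"
  by (rule bij_betw_byWitness[where f' = "\<lambda>h. inv g \<otimes> h"])
     (auto simp: inv_solve_left m_assoc[symmetric])

lemma norm_invariant:
  assumes "g \<in> carrier G"
  shows "act g (\<Prod>h\<in>carrier G. act h f) = (\<Prod>h\<in>carrier G. act h f)"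
proof -
  have "act g (\<Prod>h\<in>carrier G. act h f) = (\<Prod>h\<in>carrier G. act (g \<otimes> h) f)"
    unfolding act_prod using assms by (intro prod.cong refl) (rule act_act)
  also have "\<dots> = (\<Prod>h\<in>carrier G. act h f)"
    by (rule prod.reindex_bij_betw[OF bij_left_translation[OF assms]])
  finally show ?thesis .
qed

lemma act_eq_0_iff: "g \<in> carrier G \<Longrightarrow> act g f = 0 \<longleftrightarrow> f = 0"
  by (simp add: act_def mcompose_eq_0_iff invertible_rho)

lemma rho_one: "\<rho> \<one> = mat 1"
proof -
  have "\<rho> \<one> ** \<rho> \<one> = \<rho> \<one>" using rho_mult[of \<one> \<one>] by simp
  then show ?thesis using invertible_rho[of \<one>]
    by (metis invertible_def matrix_mul_assoc matrix_mul_rid one_closed)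
qed

lemma act_one: "act \<one> f = f"
  by (simp add: act_def rho_one mcompose_mat_1)

lemma invs_mono: "d \<le> d' \<Longrightarrow> invs d \<subseteq> invs d'"
  by (auto simp: poly_invariants_le_def intro: deg_le_mono)

lemma invs_polys: "invs d \<subseteq> polys (range coord) d"
  by (auto simp: poly_invariants_le_def intro: of_mpoly_in_polys)

lemma fconst_invs: "range fconst \<subseteq> invs d"
proof -
  have "deg_le (mconst c) d" for c :: 'k
    by (auto simp: deg_le_def mconst_def)
  then show ?thesis by (auto simp: fconst_def poly_invariants_le_def intro!: imageI)
qed

lemma inv_subfield_eq: "inv_subfield G \<rho> d = rat (invs d)"
  unfolding inv_subfield_def of_mpoly_def[symmetric] by (rule generate_field_eq_rat[OF fconst_invs])

lemma field_invariants_eq: "field_invariants G \<rho> = {x. \<forall>g\<in>carrier G. fract_act g x = x}"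
  by (simp add: field_invariants_def fract_act_def)

lemma fract_act_invs: "g \<in> carrier G \<Longrightarrow> s \<in> invs d \<Longrightarrow> fract_act g s = s"
  by (auto simp: fract_act_hom poly_invariants_le_def act_def)

lemma subfield_invariants: "subfield (field_invariants G \<rho>) ring_of_type_algebra"
proof -
  interpret R: field "ring_of_type_algebra :: ('n, 'k) mpoly fract ring" by auto
  have 1: "fract_act g 1 = 1" if "g \<in> carrier G" for g
    using fract_act_hom(3)[OF that, of 1] by (simp add: fconst_def)
  have m: "fract_act g (- x) = - fract_act g x" if "g \<in> carrier G" for g x
  proof -
    have "fract_act g (fconst (- 1) * x) = fconst (- 1) * fract_act g x"
      by (simp only: fract_act_hom[OF that])
    then show ?thesis by (simp add: hom_uminus hom_1)
  qed
  have i: "fract_act g (inverse x) = inverse (fract_act g x)" if "g \<in> carrier G" for g x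
    using fract_act_divide[OF that, of 1 x] by (simp add: 1[OF that] inverse_eq_divide)
  show ?thesis unfolding field_invariants_eq
    by (rule R.subfieldI'[OF R.subringI])
       (auto simp: m_inv_ring_of_type_algebra fract_act_hom 1 m i)
qed

lemma rat_invs_subset: "rat (invs d) \<subseteq> field_invariants G \<rho>"
proof (rule rat_subset_subfield[OF subfield_invariants])
  show "range fconst \<subseteq> field_invariants G \<rho>" by (auto simp: field_invariants_eq fract_act_hom)
  show "invs d \<subseteq> field_invariants G \<rho>"
    unfolding field_invariants_eq using fract_act_invs by blast
qed

text \<open>Each coordinate is a root of the product of all \<open>T - g x\<^sub>i\<close>, whose coefficients are invariant.\<close>

lemma coords_alg_dep: "\<exists>d. \<forall>x\<in>range coord. alg_dep (invs d) x"
proof -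
  have "\<exists>d. alg_dep (invs d) (coord i)" for i
  proof -
    define p where "p = (\<Prod>h\<in>carrier G. [:- act h (mvar i), 1:])"
    define n where "n = Polynomial.degree p"
    have inv_p: "map_poly (act g) p = p" if g: "g \<in> carrier G" for g
    proof -
      have "map_poly (act g) (\<Prod>h\<in>A. [:- act h (mvar i), 1:]) = (\<Prod>h\<in>A. [:- act (g \<otimes> h) (mvar i), 1:])"
        if "A \<subseteq> carrier G" for A
        using finite_subset[OF that finite_G] that
      proof (induction A rule: finite_induct)
        case empty
        then show ?case by (simp add: map_poly_1 act_1)
      next
        case (insert h A)
        have "map_poly (act g) [:- act h (mvar i), 1:] = [:- act (g \<otimes> h) (mvar i), 1:]"
          using insert.prems g by (simp add: map_poly_pCons act_0 act_1 act_uminus act_act)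
        then show ?case
          unfolding prod.insert[OF insert.hyps(1,2)] map_poly_mult_hom[of "act g", OF act_0 act_add act_mult]
          using insert.IH insert.prems by simp
      qed
      then have "map_poly (act g) p = (\<Prod>h\<in>carrier G. [:- act (g \<otimes> h) (mvar i), 1:])"
        by (simp add: p_def)
      also have "\<dots> = p" unfolding p_def
        by (rule prod.reindex_bij_betw[OF bij_left_translation[OF g]])
      finally show ?thesis .
    qed
    have "act g (Polynomial.coeff p l) = Polynomial.coeff p l" if "g \<in> carrier G" for g l
      using inv_p[OF that] by (metis act_0 coeff_map_poly)
    moreover obtain d where "\<forall>l\<le>n. deg_le (Polynomial.coeff p l) d"
    proof -
      have "\<forall>l. \<exists>d. deg_le (Polynomial.coeff p l) d" using ex_deg_le by blast
      then obtain d where d: "\<And>l. deg_le (Polynomial.coeff p l) (d l)" by metis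
      have "deg_le (Polynomial.coeff p l) (\<Sum>l\<le>n. d l)" if "l \<le> n" for l
        using d[of l] by (rule deg_le_mono) (use that in \<open>auto intro: member_le_sum\<close>)
      then show thesis using that by blast
    qed
    ultimately have coeffs: "of_mpoly (Polynomial.coeff p l) \<in> invs d" if "l \<le> n" for l
      using that by (auto simp: poly_invariants_le_def act_def)
    have "p \<noteq> 0" unfolding p_def using finite_G by simp
    have "poly p (mvar i) = 0"
      unfolding p_def poly_prod using finite_G one_closed act_one
      by (auto intro!: prod_zero bexI[of _ \<one>])
    then have sum_0: "(\<Sum>l\<le>n. of_mpoly (Polynomial.coeff p l) * coord i ^ l) = 0"
      by (simp add: poly_altdef n_def coord_def flip: of_mpoly_mult of_mpoly_power of_mpoly_sum)
    have "alg_dep (invs d) (coord i)"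
      by (rule alg_depI[OF _ sum_0 order.refl])
        (use coeffs \<open>p \<noteq> 0\<close> in \<open>auto simp: n_def intro: alg_base\<close>)
    then show ?thesis by blast
  qed
  then obtain d where d: "\<And>i. alg_dep (invs (d i)) (coord i)" by metis
  have "alg_dep (invs (\<Sum>i\<in>UNIV. d i)) (coord i)" for i
  proof -
    have "alg (invs (d i)) \<subseteq> alg (invs (\<Sum>i\<in>UNIV. d i))"
      by (intro alg_mono invs_mono member_le_sum) auto
    then show ?thesis using d[of i] unfolding alg_dep_def by blast
  qed
  then show ?thesis by blast
qed

text \<open>In the tower from \<open>k(S)\<close> through \<open>k(V)^G\<close> to
  \<open>k(V)\<close> the upper step is always finite, so finiteness of the lower step is a matter
  of the coordinates alone. This is the form in which \<open>gamma_field\<close> enters the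
  counting.\<close>

lemma finite_dimension_iff:
  "ring.finite_dimension ring_of_type_algebra (inv_subfield G \<rho> d) (field_invariants G \<rho>) \<longleftrightarrow>
    (\<forall>x\<in>range coord. alg_dep (invs d) x)"
proof -
  interpret R: field "ring_of_type_algebra :: ('n, 'k) mpoly fract ring" by auto
  note sub = subfield_rat[of "invs d"]
  have const_rat: "range fconst \<subseteq> rat (invs d)" by (auto intro: rat_const)
  have fin: "finite (range (coord :: 'n \<Rightarrow> ('n, 'k) mpoly fract))" by simp
  show ?thesis unfolding inv_subfield_eq
  proof
    assume fd: "R.finite_dimension (rat (invs d)) (field_invariants G \<rho>)"
    \<comment> \<open>The degree \<open>d'\<close> is unrelated to \<open>d\<close>: its invariants
      lie in \<open>k(V)^G\<close> anyway, which suffices for the upper step of the tower.\<close>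
    obtain d' where d': "\<forall>x\<in>range coord. alg_dep (invs d') x" using coords_alg_dep by blast
    have "R.finite_dimension (field_invariants G \<rho>) UNIV"
    proof (rule finite_dimension_UNIV[OF fin rat_coords subfield_invariants])
      show "range fconst \<subseteq> field_invariants G \<rho>" using const_rat rat_invs_subset by blast
      fix x :: "('n, 'k) mpoly fract"
      assume "x \<in> range coord"
      then have "(R.algebraic over rat (invs d')) x" using d' algebraic_iff_alg_dep by blast
      then show "(R.algebraic over field_invariants G \<rho>) x"
        using R.algebraic_mono[OF rat_invs_subset] by blast
    qed
    with fd have "R.finite_dimension (rat (invs d)) UNIV"
      unfolding R.finite_dimension_def using R.telescopic_base[OF sub subfield_invariants] by blast
    moreover have "subring UNIV (ring_of_type_algebra :: ('n, 'k) mpoly fract ring)"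
      using R.carrier_is_subring by simp
    ultimately have "(R.algebraic over rat (invs d)) x" for x
      using R.finite_dimension_imp_algebraic[OF sub] by blast
    then show "\<forall>x\<in>range coord. alg_dep (invs d) x" using algebraic_iff_alg_dep by blast
  next
    assume "\<forall>x\<in>range coord. alg_dep (invs d) x"
    then have "R.finite_dimension (rat (invs d)) UNIV"
      using finite_dimension_UNIV[OF fin rat_coords sub const_rat] algebraic_iff_alg_dep by blast
    moreover have "subalgebra (rat (invs d)) (field_invariants G \<rho>) ring_of_type_algebra"
    proof (intro subalgebra.intro subalgebra_axioms.intro)
      show "subgroup (field_invariants G \<rho>) (add_monoid ring_of_type_algebra)"
        by (rule subring.axioms(1)[OF subfieldE(1)[OF subfield_invariants]])
      show "c \<otimes>\<^bsub>ring_of_type_algebra\<^esub> x \<in> field_invariants G \<rho>"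
        if "c \<in> rat (invs d)" "x \<in> field_invariants G \<rho>" for c x
        using subringE(6)[OF subfieldE(1)[OF subfield_invariants], of c x] rat_invs_subset that by blast
    qed
    ultimately show "R.finite_dimension (rat (invs d)) (field_invariants G \<rho>)"
      using R.subalbegra_incl_imp_finite_dimension[OF sub] by blast
  qed
qed

text \<open>By \<open>coords_alg_dep\<close> some degree gives a finite extension, so the
  \<open>LEAST\<close> in \<open>gamma_field\<close> is attained.\<close>

lemma gamma_field_alg_dep: "x \<in> range coord \<Longrightarrow> alg_dep (invs (gamma_field G \<rho>)) x"
  unfolding gamma_field_def
  using LeastI_ex[of "\<lambda>d. ring.finite_dimension ring_of_type_algebra (inv_subfield G \<rho> d) (field_invariants G \<rho>)"]
    coords_alg_dep unfolding finite_dimension_iff by blast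

text \<open>A field has dimension one over itself, so a degree that generates the invariant field
  also qualifies for \<open>gamma_field\<close>. The hypothesis says that the degree
  \<open>gamma_field\<close> itself generates.\<close>

lemma beta_eq_gamma_if:
  assumes "field_invariants G \<rho> \<subseteq> rat (invs (gamma_field G \<rho>))"
  shows "beta_field G \<rho> = gamma_field G \<rho>"
proof (rule antisym)
  interpret R: field "ring_of_type_algebra :: ('n, 'k) mpoly fract ring" by auto
  have eq: "inv_subfield G \<rho> (gamma_field G \<rho>) = field_invariants G \<rho>"
    using assms rat_invs_subset unfolding inv_subfield_eq by blast
  then show "beta_field G \<rho> \<le> gamma_field G \<rho>" unfolding beta_field_def by (rule Least_le)
  have "inv_subfield G \<rho> (beta_field G \<rho>) = field_invariants G \<rho>"
    unfolding beta_field_def by (rule LeastI[of _ "gamma_field G \<rho>"]) (rule eq)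
  then have "R.finite_dimension (inv_subfield G \<rho> (beta_field G \<rho>)) (field_invariants G \<rho>)"
    using R.dimension_one[OF subfield_invariants] R.finite_dimensionI by metis
  then show "gamma_field G \<rho> \<le> beta_field G \<rho>" unfolding gamma_field_def by (rule Least_le)
qed

text \<open>Over a finite \<open>k\<close> the constants do not suffice; the powers of the norm of a
  coordinate are infinitely many invariants over any field.\<close>

lemma exists_infinite_invariants: "\<exists>T. infinite T \<and> (\<forall>g\<in>carrier G. \<forall>t\<in>T. fract_act g t = t)"
proof -
  define z where "z = (\<Prod>h\<in>carrier G. act h (mvar (undefined :: 'n)))"
  have "mvar (undefined :: 'n) \<noteq> (0 :: ('n, 'k) mpoly)" by (rule mvar_neq_0)
  then have z_nz: "z \<noteq> 0" using finite_G by (simp add: z_def act_eq_0_iff)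
  \<comment> \<open>The factor of the identity is a coordinate, so \<open>z\<close> vanishes at the
    origin and no positive power of it can be \<open>1\<close>.\<close>
  have z_at_0: "msubst (\<lambda>_. 0) z = (0 :: ('n, 'k) mpoly)"
  proof -
    have "msubst (\<lambda>_. 0) (act \<one> (mvar (undefined :: 'n))) = (0 :: ('n, 'k) mpoly)" by (simp add: act_one)
    then show ?thesis unfolding z_def msubst_prod using finite_G one_closed by (intro prod_zero) auto
  qed
  have "inj (\<lambda>k. of_mpoly z ^ k)"
  proof (rule linorder_injI)
    fix k l :: nat
    assume "k < l"
    show "of_mpoly z ^ k \<noteq> of_mpoly z ^ l"
    proof
      assume "of_mpoly z ^ k = of_mpoly z ^ l"
      then have "z ^ k = z ^ l" by (simp flip: of_mpoly_power)
      also have "\<dots> = z ^ k * z ^ (l - k)" using \<open>k < l\<close> by (simp flip: power_add)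
      finally have "z ^ (l - k) = 1" using z_nz by simp
      then have "msubst (\<lambda>_. 0) (z ^ (l - k)) = (1 :: ('n, 'k) mpoly)" by simp
      then show False using \<open>k < l\<close> by (simp add: msubst_power z_at_0 power_0_left split: if_splits)
    qed
  qed
  then have "infinite (range (\<lambda>k. of_mpoly z ^ k))" by (rule range_inj_infinite)
  moreover have "fract_act g (of_mpoly z ^ k) = of_mpoly z ^ k" if "g \<in> carrier G" for g k
  proof (induction k)
    case 0
    then show ?case using fract_act_hom(3)[OF that, of 1] by (simp add: fconst_def)
  next
    case (Suc k)
    then show ?case using norm_invariant[OF that] by (simp add: fract_act_hom[OF that] z_def)
  qed
  ultimately show ?thesis by blast
qed

theorem beta_eq_gamma:
  assumes "gamma_field G \<rho> ^ CARD('n) < 2 * card (carrier G)"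
  shows "beta_field G \<rho> = gamma_field G \<rho>"
proof (rule beta_eq_gamma_if, rule subsetI)
  fix u assume u: "u \<in> field_invariants G \<rho>"
  obtain T :: "('n, 'k) mpoly fract set" where
    T: "infinite T" "\<And>g t. g \<in> carrier G \<Longrightarrow> t \<in> T \<Longrightarrow> fract_act g t = t"
    using exists_infinite_invariants by blast
  have fin: "finite (range (coord :: 'n \<Rightarrow> ('n, 'k) mpoly fract))" by simp
  have sep: "\<exists>x\<in>range coord. fract_act g x \<noteq> fract_act g' x"
    if g: "g \<in> carrier G" "g' \<in> carrier G" and "g \<noteq> g'" for g g'
  proof (rule ccontr)
    assume *: "\<not> (\<exists>x\<in>range coord. fract_act g x \<noteq> fract_act g' x)"
    have "\<rho> (inv g) $ i $ j = \<rho> (inv g') $ i $ j" for i j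
    proof -
      have "act g (mvar i) = act g' (mvar i)"
        using * g by (auto simp: coord_def fract_act_hom)
      then have "Poly_Mapping.lookup (act g (mvar i)) (Poly_Mapping.single j 1) =
          Poly_Mapping.lookup (act g' (mvar i)) (Poly_Mapping.single j 1)" by simp
      then show ?thesis unfolding act_def mcompose_mvar coeff_mvar_sum .
    qed
    then have "\<rho> (inv g) = \<rho> (inv g')" by (simp add: vec_eq_iff)
    then have "inv g = inv g'" using rho_inj g by simp
    then show False using g \<open>g \<noteq> g'\<close> by (metis inv_inv)
  qed
  have "\<exists>h\<in>rat (range coord). inj_on (\<lambda>g. fract_act g h) (carrier G)"
  proof (rule exists_separating_element[where T = T, OF fin finite_G fract_act_hom(1,2,3)])
    show "T \<subseteq> rat (range coord)" by (simp add: rat_coords)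
  qed (use T sep in simp_all)
  then obtain h where h: "h \<in> rat (range coord)" "inj_on (\<lambda>g. fract_act g h) (carrier G)" by blast
  show "u \<in> rat (invs (gamma_field G \<rho>))"
  proof (rule fixed_in_rat[OF fin alg_indep_coords invs_polys gamma_field_alg_dep finite_G
        fract_act_hom(1,2,3) fract_act_invs h])
    show "u \<in> rat (range coord)" by (simp add: rat_coords)
    show "gamma_field G \<rho> ^ card (range (coord :: 'n \<Rightarrow> ('n, 'k) mpoly fract)) < 2 * card (carrier G)"
      using assms by (simp add: card_image[OF inj_coord])
  qed (use u in \<open>simp_all add: field_invariants_eq\<close>)
qed

end

section \<open>Simultaneous diagonalization\<close>

text \<open>This is \<open>p(A) v\<close> for the monic polynomial \<open>p\<close> with root list
  \<open>zs\<close>; see \<open>poly_op_linear_factors\<close>.\<close>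

definition root_product :: "('k::field, 'n::finite) sqmat \<Rightarrow> 'k list \<Rightarrow> ('k, 'n) vec \<Rightarrow> ('k, 'n) vec" where
  "root_product A zs v = foldr (\<lambda>z w. A *v w - z *s w) zs v"

lemma root_product_simps [simp]:
  "root_product A [] v = v"
  "root_product A (z # zs) v = A *v root_product A zs v - z *s root_product A zs v"
  by (simp_all add: root_product_def)

lemma matrix_vector_mult_scale: "A *v (c *s x) = c *s (A *v x)" for A :: "('k::field, 'n::finite) sqmat"
  by (simp add: vec_eq_iff matrix_vector_mult_def sum_distrib_left algebra_simps)

lemma root_product_diff: "root_product A zs (v - w) = root_product A zs v - root_product A zs w"
proof (induction zs)
  case (Cons z zs)
  show ?case
    unfolding root_product_simps Cons.IH matrix_vector_mult_diff_distrib vector_ssub_ldistrib by simp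
qed simp

lemma root_product_scale: "root_product A zs (c *s v) = c *s root_product A zs v"
  by (induction zs)
     (simp_all add: matrix_vector_mult_scale vector_ssub_ldistrib vector_smult_assoc mult.commute)

lemma root_product_eigenvector:
  assumes "A *v v = z *s v"
  shows "root_product A zs v = (\<Prod>y\<leftarrow>zs. z - y) *s v"
proof (induction zs)
  case (Cons y zs)
  show ?case
    unfolding root_product_simps Cons.IH matrix_vector_mult_scale assms
    by (simp add: vec_eq_iff algebra_simps)
qed simp

lemma root_product_mem:
  assumes "vec.subspace U" "\<And>w. w \<in> U \<Longrightarrow> A *v w \<in> U" "v \<in> U"
  shows "root_product A zs v \<in> U"
  by (induction zs) (auto intro!: assms vec.subspace_diff vec.subspace_scale)

text \<open>The vector \<open>\<Prod>\<^bsub>y \<in> zs\<^esub> (A - y) v\<close> is an eigenvector for \<open>z\<close>; subtracting a multiple of it from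
  \<open>v\<close> removes the root \<open>z\<close>.\<close>

lemma span_eigenvectors:
  assumes U: "vec.subspace U" "\<And>w. w \<in> U \<Longrightarrow> A *v w \<in> U"
    and "distinct zs" "root_product A zs v = 0" "v \<in> U"
  shows "v \<in> vec.span {w \<in> U. \<exists>z. A *v w = z *s w}"
  using assms(3-5)
proof (induction zs arbitrary: v)
  case Nil
  then show ?case by (simp add: vec.span_zero)
next
  case (Cons z zs)
  let ?E = "{w \<in> U. \<exists>z. A *v w = z *s w}"
  define u where "u = root_product A zs v"
  define c where "c = (\<Prod>y\<leftarrow>zs. z - y)"
  \<comment> \<open>The remaining product scales the eigenvector \<open>u\<close> by
    \<open>c\<close>, which is nonzero because \<open>z\<close> differs from the other
    roots.\<close>
  have c: "c \<noteq> 0" using Cons.prems(1) by (auto simp: c_def prod_list_zero_iff)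
  have u_eig: "A *v u = z *s u" using Cons.prems(2) by (simp add: u_def)
  have u_U: "u \<in> U" unfolding u_def by (rule root_product_mem[OF U Cons.prems(3)])
  have "root_product A zs (v - (1 / c) *s u) = u - (1 / c) *s (c *s u)"
    by (simp add: root_product_diff root_product_scale root_product_eigenvector[OF u_eig] c_def u_def[symmetric])
  also have "\<dots> = 0" using c by (simp add: vector_smult_assoc)
  finally have "v - (1 / c) *s u \<in> vec.span ?E"
    using Cons by (auto intro!: Cons.IH vec.subspace_diff[OF U(1)] vec.subspace_scale[OF U(1)] u_U)
  moreover have "(1 / c) *s u \<in> vec.span ?E"
    using u_U u_eig by (intro vec.span_scale vec.span_base) blast
  ultimately show ?case using vec.span_add by force
qed

text \<open>Induction on the operators: a joint eigenspace of the earlier ones is stable under a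
  commuting \<open>A g\<close>, so \<open>span_eigenvectors\<close> splits its vectors into
  eigenvectors of \<open>A g\<close> inside that space.\<close>

lemma span_simultaneous_eigenvectors:
  fixes A :: "'g \<Rightarrow> ('k::field, 'n::finite) sqmat"
  assumes "finite S" "\<And>g h. g \<in> S \<Longrightarrow> h \<in> S \<Longrightarrow> A g ** A h = A h ** A g"
    and "\<And>g. g \<in> S \<Longrightarrow> \<exists>zs. distinct zs \<and> (\<forall>v. root_product (A g) zs v = 0)"
  shows "vec.span {v. \<forall>g\<in>S. \<exists>z. A g *v v = z *s v} = UNIV"
  using assms
proof (induction S rule: finite_induct)
  case (insert g S)
  let ?E = "\<lambda>S. {v. \<forall>g\<in>S. \<exists>z. A g *v v = z *s v}"
  have "v \<in> vec.span (?E (insert g S))" if v: "v \<in> ?E S" for v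
  proof -
    obtain \<zeta> where \<zeta>: "\<And>h. h \<in> S \<Longrightarrow> A h *v v = \<zeta> h *s v" using v by (simp, metis)
    define U where "U = {w. \<forall>h\<in>S. A h *v w = \<zeta> h *s w}"
    have U: "vec.subspace U"
      by (rule vec.subspaceI)
         (auto simp: U_def matrix_vector_right_distrib matrix_vector_mult_scale vector_add_ldistrib
            vector_smult_assoc mult.commute)
    have stable: "A g *v w \<in> U" if "w \<in> U" for w
    proof -
      have "A h *v (A g *v w) = \<zeta> h *s (A g *v w)" if "h \<in> S" for h
      proof -
        have "A h *v (A g *v w) = A g *v (A h *v w)"
          using insert.prems(1)[of h g] that by (simp add: matrix_vector_mul_assoc)
        then show ?thesis using \<open>w \<in> U\<close> that by (simp add: U_def matrix_vector_mult_scale)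
      qed
      then show ?thesis by (simp add: U_def)
    qed
    obtain zs where "distinct zs" "\<forall>v. root_product (A g) zs v = 0" using insert.prems(2)[of g] by auto
    then have "v \<in> vec.span {w \<in> U. \<exists>z. A g *v w = z *s w}"
      using span_eigenvectors[OF U stable] \<zeta> by (auto simp: U_def)
    also have "\<dots> \<subseteq> vec.span (?E (insert g S))"
      by (rule vec.span_mono) (auto simp: U_def)
    finally show ?thesis .
  qed
  then have "vec.span (?E S) \<subseteq> vec.span (?E (insert g S))"
    by (intro vec.span_minimal) auto
  then show ?case using insert by auto
qed auto

text \<open>A basis chosen among the spanning joint eigenvectors supplies the columns of
  \<open>P\<close>.\<close>

theorem simultaneous_diagonalization:
  fixes A :: "'g \<Rightarrow> ('k::field, 'n::finite) sqmat"
  assumes "finite S" "\<And>g h. g \<in> S \<Longrightarrow> h \<in> S \<Longrightarrow> A g ** A h = A h ** A g"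
    and "\<And>g. g \<in> S \<Longrightarrow> \<exists>zs. distinct zs \<and> (\<forall>v. root_product (A g) zs v = 0)"
  shows "\<exists>(P :: ('k, 'n) sqmat) ev. invertible P \<and> (\<forall>g\<in>S. \<forall>j. A g *v column j P = ev g j *s column j P)"
proof -
  let ?E = "{v. \<forall>g\<in>S. \<exists>z. A g *v v = z *s v}"
  obtain B where B: "B \<subseteq> ?E" "vec.independent B" "?E \<subseteq> vec.span B"
    using vec.maximal_independent_subset[of ?E] by blast
  have span_B: "vec.span B = UNIV"
    using span_simultaneous_eigenvectors[OF assms] B(3) vec.span_minimal[of ?E "vec.span B"] by auto
  have "card B = CARD('n)"
    using vec.dim_eq_card[of B UNIV] span_B B(2) by (simp add: vec.dim_UNIV vec.dimension_def card_cart_basis)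
  moreover have "finite B" using B(2) by (rule vec.finiteI_independent)
  ultimately obtain b where b: "bij_betw b (UNIV :: 'n set) B"
    using finite_same_card_bij[of "UNIV :: 'n set" B] by auto
  define P where "P = (\<chi> i j. b j $ i)"
  have col: "column j P = b j" for j by (simp add: P_def column_def vec_eq_iff)
  have "columns P = B" using b by (auto simp: columns_def col bij_betw_def)
  then obtain Q where "P ** Q = mat 1" using matrix_right_invertible_span_columns[of P] span_B by auto
  then have "invertible P" by (auto simp: invertible_def matrix_left_right_inverse)
  have "\<exists>z. A g *v column j P = z *s column j P" if "g \<in> S" for g j
    using B(1) b that by (auto simp: col bij_betw_def)
  then have "\<exists>ev. \<forall>g\<in>S. \<forall>j. A g *v column j P = ev g j *s column j P" by metis
  then obtain ev where "\<forall>g\<in>S. \<forall>j. A g *v column j P = ev g j *s column j P" ..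
  with \<open>invertible P\<close> show ?thesis by (intro exI[of _ P] exI[of _ ev]) simp
qed

text \<open>Horner evaluation of \<open>p(A) v\<close>, used to turn an identity of polynomials into
  one of operators.\<close>

definition poly_op :: "('k::field, 'n::finite) sqmat \<Rightarrow> 'k poly \<Rightarrow> ('k, 'n) vec \<Rightarrow> ('k, 'n) vec" where
  "poly_op A p v = fold_coeffs (\<lambda>a w. a *s v + A *v w) p 0"

lemma poly_op_0 [simp]: "poly_op A 0 v = 0"
  by (simp add: poly_op_def)

lemma poly_op_pCons [simp]: "poly_op A (pCons a p) v = a *s v + A *v poly_op A p v"
  by (cases "p = 0 \<and> a = 0") (auto simp: poly_op_def fold_coeffs_pCons_not_0_0_eq fold_coeffs_pCons_coeff_not_0_eq)

lemma poly_op_add: "poly_op A (p + q) v = poly_op A p v + poly_op A q v"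
  by (induction p q rule: poly_induct2)
     (simp_all add: vector_sadd_rdistrib matrix_vector_right_distrib algebra_simps)

lemma poly_op_smult: "poly_op A (Polynomial.smult c p) v = c *s poly_op A p v"
  by (induction p) (simp_all add: vector_add_ldistrib vector_smult_assoc matrix_vector_mult_scale)

lemma poly_op_linear_factors: "poly_op A (\<Prod>z\<leftarrow>zs. [:- z, 1:]) v = root_product A zs v"
proof (induction zs)
  case Nil
  have "poly_op A [:1:] v = v" by (simp del: One_nat_def)
  then show ?case by (simp add: one_pCons)
next
  case (Cons z zs)
  let ?p = "\<Prod>z\<leftarrow>zs. [:- z, 1:]"
  have "[:- z, 1:] * ?p = Polynomial.smult (- z) ?p + pCons 0 ?p" by (simp add: mult_pCons_left)
  then have "poly_op A ([:- z, 1:] * ?p) v = (- z) *s poly_op A ?p v + A *v poly_op A ?p v"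
    by (simp only: poly_op_add poly_op_smult poly_op_pCons) simp
  then show ?case using Cons by (simp add: vec_eq_iff)
qed

lemma poly_op_monom: "poly_op A (Polynomial.monom 1 n) v = ((\<lambda>w. A *v w) ^^ n) v"
  by (induction n) (simp_all add: monom_0 monom_Suc)

lemma root_product_eq_0:
  fixes A :: "('k::field, 'n::finite) sqmat"
  assumes "Polynomial.monom 1 n - 1 = (\<Prod>z\<leftarrow>zs. [:- z, 1:])" "((\<lambda>w. A *v w) ^^ n) v = v"
  shows "root_product A zs v = 0"
proof -
  have "Polynomial.monom 1 n - 1 = Polynomial.monom 1 n + [:- 1 :: 'k:]"
    by (rule poly_eqI) (simp add: one_pCons coeff_pCons split: nat.splits)
  then have "poly_op A (Polynomial.monom 1 n - 1) v = ((\<lambda>w. A *v w) ^^ n) v + (- 1) *s v"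
    by (simp only: poly_op_add poly_op_monom) simp
  then show ?thesis using assms by (simp add: poly_op_linear_factors vec_eq_iff)
qed

text \<open>A repeated root is a root of the derivative \<open>n X ^ (n - 1)\<close>, hence
  \<open>0\<close>, and \<open>0\<close> is no root of \<open>X ^ n - 1\<close>.\<close>

lemma distinct_roots_of_unity:
  fixes zs :: "'k::field list"
  assumes "Polynomial.monom 1 n - 1 = (\<Prod>z\<leftarrow>zs. [:- z, 1:])" "of_nat n \<noteq> (0 :: 'k)"
  shows "distinct zs"
proof (rule ccontr)
  assume "\<not> distinct zs"
  then obtain as bs cs z where "zs = as @ [z] @ bs @ [z] @ cs" using not_distinct_decomp by blast
  define r where "r = (\<Prod>z\<leftarrow>as @ bs @ cs. [:- z, 1:])"
  have *: "Polynomial.monom 1 n - 1 = [:- z, 1:] * ([:- z, 1:] * r)"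
    unfolding assms(1) r_def \<open>zs = as @ [z] @ bs @ [z] @ cs\<close>
    by (simp add: ac_simps del: mult_pCons_left mult_pCons_right)
  have n: "n > 0" using assms(2) by (cases n) auto
  have "poly (Polynomial.monom 1 n - 1) z = 0" unfolding * by simp
  then have z: "z ^ n = 1" by (simp add: poly_monom)
  have "poly (pderiv (Polynomial.monom 1 n - 1)) z = 0" 
    unfolding * pderiv_mult by (simp add: pderiv_pCons del: mult_pCons_left mult_pCons_right)
  then have "of_nat n * z ^ (n - 1) = 0" by (simp add: pderiv_diff pderiv_monom poly_monom)
  then have "z = 0" using assms(2) by auto
  then show False using z n by (simp add: power_0_left)
qed

section \<open>Coefficientwise maps\<close>

abbreviation cmap :: "('a::zero \<Rightarrow> 'b::zero) \<Rightarrow> ('n, 'a) mpoly \<Rightarrow> ('n, 'b) mpoly" where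
  "cmap \<equiv> Poly_Mapping.map"

lemma lookup_cmap: "\<phi> 0 = 0 \<Longrightarrow> Poly_Mapping.lookup (cmap \<phi> f) m = \<phi> (Poly_Mapping.lookup f m)"
  by (simp add: Poly_Mapping.map.rep_eq when_def)

lemma mpoly_induct [case_names single add]:
  fixes f :: "('n, 'k::comm_semiring_1) mpoly"
  assumes "\<And>m c. P (Poly_Mapping.single m c)" "\<And>f g. P f \<Longrightarrow> P g \<Longrightarrow> P (f + g)"
  shows "P f"
proof -
  have "P (\<Sum>m\<in>A. Poly_Mapping.single m (Poly_Mapping.lookup f m))" if "finite A" for A
    using that by (induction A rule: finite_induct) (use assms assms(1)[of 0 0] in auto)
  then show ?thesis using mpoly_sum_single[of f] by (metis finite_keys)
qed

lemma cmap_0: "\<phi> 0 = 0 \<Longrightarrow> cmap \<phi> 0 = 0"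
  by (rule poly_mapping_eqI) (simp add: lookup_cmap)

lemma cmap_single: "\<phi> 0 = 0 \<Longrightarrow> cmap \<phi> (Poly_Mapping.single m c) = Poly_Mapping.single m (\<phi> c)"
  by (rule poly_mapping_eqI) (simp add: lookup_cmap lookup_single when_def)

lemma cmap_add:
  fixes \<phi> :: "'a::comm_semiring_1 \<Rightarrow> 'b::comm_semiring_1"
  assumes "\<phi> 0 = 0" "\<And>a b. \<phi> (a + b) = \<phi> a + \<phi> b"
  shows "cmap \<phi> (f + g) = cmap \<phi> f + cmap \<phi> g"
  by (rule poly_mapping_eqI) (simp add: lookup_cmap lookup_add assms)

section \<open>Degree bounds\<close>

lemma deg_le_add: "deg_le f d \<Longrightarrow> deg_le g d \<Longrightarrow> deg_le (f + g) d"
  unfolding deg_le_def using Poly_Mapping.keys_add[of f g] by blast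

lemma deg_le_0: "deg_le 0 d"
  by (simp add: deg_le_def)

lemma deg_le_sum: "(\<And>i. i \<in> A \<Longrightarrow> deg_le (f i) d) \<Longrightarrow> deg_le (\<Sum>i\<in>A. f i) d"
  by (induction A rule: infinite_finite_induct) (auto simp: deg_le_0 deg_le_add)

lemma deg_le_mult:
  assumes "deg_le f a" "deg_le g b"
  shows "deg_le (f * g) (a + b)"
  unfolding deg_le_def
proof
  fix m assume "m \<in> Poly_Mapping.keys (f * g)"
  then obtain k l where "m = k + l" "k \<in> Poly_Mapping.keys f" "l \<in> Poly_Mapping.keys g"
    using keys_mult[of f g] by blast
  then show "(\<Sum>i\<in>UNIV. Poly_Mapping.lookup m i) \<le> a + b"
    using assms by (auto simp: deg_le_def lookup_add sum.distrib intro!: add_mono)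
qed

lemma deg_le_single: "(\<Sum>i\<in>UNIV. Poly_Mapping.lookup m i) \<le> d \<Longrightarrow> deg_le (Poly_Mapping.single m c) d"
  by (simp add: deg_le_def)

lemma deg_le_mconst: "deg_le (mconst c) d"
  unfolding mconst_def by (rule deg_le_single) simp

lemma deg_le_1: "deg_le (1 :: ('n::finite, 'k::comm_semiring_1) mpoly) d"
  unfolding mconst_1[symmetric] by (rule deg_le_mconst)

lemma deg_le_power: "deg_le (f :: ('n::finite, 'k::comm_semiring_1) mpoly) d \<Longrightarrow> deg_le (f ^ k) (k * d)"
proof (induction k)
  case 0
  show ?case by (simp add: deg_le_1)
qed (simp add: deg_le_mult)

lemma deg_le_prod:
  fixes f :: "'i \<Rightarrow> ('n::finite, 'k::comm_semiring_1) mpoly"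
  assumes "finite A" "\<And>i. i \<in> A \<Longrightarrow> deg_le (f i) (d i)"
  shows "deg_le (\<Prod>i\<in>A. f i) (\<Sum>i\<in>A. d i)"
  using assms
proof (induction A rule: finite_induct)
  case empty
  show ?case by (simp add: deg_le_1)
qed (simp add: deg_le_mult)

lemma deg_le_mvar: "deg_le (mvar i) 1"
  unfolding mvar_def by (rule deg_le_single) (simp add: lookup_single when_def)

lemma deg_le_mcompose:
  assumes "deg_le f d"
  shows "deg_le (mcompose A f) d"
  unfolding mcompose_def msubst_def
proof (rule deg_le_sum)
  fix m assume m: "m \<in> Poly_Mapping.keys f"
  have base: "deg_le (\<Sum>j\<in>UNIV. mconst (A $ i $ j) * mvar j) 1" for i
    using deg_le_mult[OF deg_le_mconst[of _ 0] deg_le_mvar] by (intro deg_le_sum) simp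
  have "deg_le ((\<Sum>j\<in>UNIV. mconst (A $ i $ j) * mvar j) ^ Poly_Mapping.lookup m i)
      (Poly_Mapping.lookup m i)" for i
    using deg_le_power[OF base[of i], of "Poly_Mapping.lookup m i"] by simp
  then have "deg_le (\<Prod>i\<in>UNIV. (\<Sum>j\<in>UNIV. mconst (A $ i $ j) * mvar j) ^ Poly_Mapping.lookup m i)
      (\<Sum>i\<in>UNIV. Poly_Mapping.lookup m i)"
    by (intro deg_le_prod) auto
  then have "deg_le (mconst (Poly_Mapping.lookup f m) *
      (\<Prod>i\<in>UNIV. (\<Sum>j\<in>UNIV. mconst (A $ i $ j) * mvar j) ^ Poly_Mapping.lookup m i))
      (0 + (\<Sum>i\<in>UNIV. Poly_Mapping.lookup m i))"
    by (rule deg_le_mult[OF deg_le_mconst])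
  then show "deg_le (mconst (Poly_Mapping.lookup f m) *
      (\<Prod>i\<in>UNIV. (\<Sum>j\<in>UNIV. mconst (A $ i $ j) * mvar j) ^ Poly_Mapping.lookup m i)) d"
    by (rule deg_le_mono) (use assms m in \<open>auto simp: deg_le_def\<close>)
qed

lemma deg_le_cmap: "\<phi> 0 = 0 \<Longrightarrow> deg_le f d \<Longrightarrow> deg_le (cmap \<phi> f) d"
  by (auto simp: deg_le_def in_keys_iff lookup_cmap)

text \<open>A separate locale for the scalar extension \<open>e\<close>, which keeps its facts apart
  from those interpreted for \<open>fconst\<close>.\<close>

locale field_hom = field_embedding e for e :: "'k::field \<Rightarrow> 'K::field"
begin

lemmas e_simps = hom_0 hom_1 hom_add hom_mult

lemma cmap_e_add: "cmap e (f + g) = cmap e f + cmap e g"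
  by (rule cmap_add) (simp_all add: e_simps)

lemma cmap_e_sum: "cmap e (\<Sum>i\<in>A. f i) = (\<Sum>i\<in>A. cmap e (f i))"
  by (induction A rule: infinite_finite_induct) (simp_all add: cmap_e_add cmap_0 e_simps)

lemma cmap_e_mult: "cmap e (f * g) = cmap e f * cmap e g"
proof (induction f rule: mpoly_induct)
  case (single m c)
  show ?case
  proof (induction g rule: mpoly_induct)
    case (single l b)
    show ?case by (simp add: mult_single cmap_single e_simps)
  qed (simp add: cmap_e_add algebra_simps)
qed (simp add: cmap_e_add algebra_simps)

lemma cmap_e_mconst: "cmap e (mconst c) = mconst (e c)"
  by (simp add: mconst_def cmap_single e_simps)

lemma cmap_e_mvar: "cmap e (mvar i) = mvar i"
  by (simp add: mvar_def cmap_single e_simps)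

lemma cmap_e_1: "cmap e 1 = 1"
  using cmap_e_mconst[of 1] by (simp add: e_simps)

lemma cmap_e_power: "cmap e (f ^ n) = cmap e f ^ n"
  by (induction n) (simp_all add: cmap_e_1 cmap_e_mult)

lemma cmap_e_prod: "cmap e (\<Prod>i\<in>A. f i) = (\<Prod>i\<in>A. cmap e (f i))"
  by (induction A rule: infinite_finite_induct) (simp_all add: cmap_e_1 cmap_e_mult)

lemma cmap_e_eq_0_iff: "cmap e f = 0 \<longleftrightarrow> f = 0"
  by (auto simp: poly_mapping_eq_iff fun_eq_iff lookup_cmap e_simps hom_eq_0_iff)

lemma mcompose_single: "mcompose A (Poly_Mapping.single m c) =
    mconst c * (\<Prod>i\<in>UNIV. (\<Sum>j\<in>UNIV. mconst (A $ i $ j) * mvar j) ^ Poly_Mapping.lookup m i)"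
  by (simp add: mcompose_def msubst_single)

lemma cmap_e_mcompose: "cmap e (mcompose A f) = mcompose (map_matrix e A) (cmap e f)"
proof (induction f rule: mpoly_induct)
  case (single m c)
  show ?case
    by (simp add: mcompose_single cmap_single e_simps cmap_e_mult cmap_e_mconst cmap_e_prod
        cmap_e_power cmap_e_sum cmap_e_mvar map_matrix_def)
qed (simp add: cmap_e_add mcompose_add)

definition functional :: "('K \<Rightarrow> 'k) \<Rightarrow> bool" where
  "functional \<phi> \<longleftrightarrow> (\<forall>a b. \<phi> (a + b) = \<phi> a + \<phi> b) \<and> (\<forall>c w. \<phi> (e c * w) = c * \<phi> w)"

context
  fixes \<phi> assumes \<phi>: "functional \<phi>"
begin

lemma functional_0: "\<phi> 0 = 0"
proof -
  have "\<phi> (e 0 * 0) = 0 * \<phi> 0" using \<phi> unfolding functional_def by blast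
  then show ?thesis by simp
qed

lemma cmap_functional_add: "cmap \<phi> (f + g) = cmap \<phi> f + cmap \<phi> g"
  by (rule cmap_add) (use \<phi> functional_0 in \<open>auto simp: functional_def\<close>)

text \<open>Since \<open>\<phi>\<close> is only \<open>k\<close>-linear, \<open>cmap \<phi>\<close>
  is linear over \<open>k[V]\<close> but in general no ring homomorphism; one factor has to be
  defined over \<open>k\<close>.\<close>

lemma cmap_functional_mult: "cmap \<phi> (cmap e f * F) = f * cmap \<phi> F"
proof (induction f rule: mpoly_induct)
  case (single m c)
  show ?case
  proof (induction F rule: mpoly_induct)
    case (single l b)
    show ?case using \<phi> by (simp add: mult_single cmap_single e_simps functional_0 functional_def)
  qed (simp add: cmap_functional_add algebra_simps)
qed (simp add: cmap_functional_add cmap_e_add algebra_simps)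

lemma cmap_functional_mconst: "cmap \<phi> (mconst w * cmap e f) = mconst (\<phi> w) * f"
  using cmap_functional_mult[of f "mconst w"]
  by (simp add: mult.commute mconst_def cmap_single functional_0)

text \<open>The matrix has entries from \<open>k\<close>, so an invariant of \<open>G\<close> over
  \<open>K\<close> is sent to an invariant over \<open>k\<close>.\<close>

lemma cmap_functional_mcompose: "cmap \<phi> (mcompose (map_matrix e A) F) = mcompose A (cmap \<phi> F)"
proof (induction F rule: mpoly_induct)
  case (single m w)
  let ?H = "\<Prod>i\<in>UNIV. (\<Sum>j\<in>UNIV. mconst (A $ i $ j) * mvar j) ^ Poly_Mapping.lookup m i"
  have "mcompose (map_matrix e A) (Poly_Mapping.single m w) = mconst w * cmap e ?H"
    by (simp add: mcompose_single cmap_e_mult cmap_e_mconst cmap_e_prod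
        cmap_e_power cmap_e_sum cmap_e_mvar map_matrix_def)
  then show ?case by (simp only: cmap_functional_mconst) (simp add: mcompose_single cmap_single functional_0)
qed (simp add: cmap_functional_add mcompose_add)

end

definition basis :: "'K set" where
  "basis = vs.extend_basis {}"

lemma basis: "vs.independent basis" "vs.span basis = UNIV"
  unfolding basis_def
  using vs.independent_extend_basis[OF vs.independent_empty] vs.span_extend_basis[OF vs.independent_empty]
  by simp_all

abbreviation coordinate :: "'K \<Rightarrow> 'K \<Rightarrow> 'k" where
  "coordinate b w \<equiv> vs.representation basis w b"

lemma functional_coordinate: "functional (coordinate b)"
  unfolding functional_def using basis by (simp add: vs.representation_add vs.representation_scale)

lemma coordinate_expansion: "(\<Sum>b | coordinate b w \<noteq> 0. e (coordinate b w) * b) = w"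
  using vs.sum_nonzero_representation_eq[OF basis(1), of w] basis(2) by simp

lemma finite_coordinates: "finite {b. coordinate b w \<noteq> 0}"
  by (rule vs.finite_representation)

lemma exists_functional: "w \<noteq> 0 \<Longrightarrow> \<exists>\<phi>. functional \<phi> \<and> \<phi> w \<noteq> 0"
  using coordinate_expansion[of w] functional_coordinate by (metis (mono_tags, lifting) empty_Collect_eq sum.empty)

text \<open>The finitely many coefficients of \<open>F\<close> have finitely many nonzero
  coordinates altogether, so a finite part of the possibly infinite basis suffices.\<close>

lemma cmap_expansion: "\<exists>B. finite B \<and> F = (\<Sum>b\<in>B. mconst b * cmap e (cmap (coordinate b) F))"
proof -
  define B where "B = (\<Union>m\<in>Poly_Mapping.keys F. {b. coordinate b (Poly_Mapping.lookup F m) \<noteq> 0})"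
  have fin: "finite B" unfolding B_def by (intro finite_UN_I finite_keys finite_coordinates)
  have lookup_mconst: "Poly_Mapping.lookup (mconst b * H) m = Poly_Mapping.lookup H m * b" for b :: 'K and H m
  proof (induction H rule: mpoly_induct)
    case (single l c)
    show ?case by (simp add: mconst_def mult_single lookup_single when_def mult.commute)
  qed (simp add: lookup_add algebra_simps)
  have "Poly_Mapping.lookup F m = Poly_Mapping.lookup (\<Sum>b\<in>B. mconst b * cmap e (cmap (coordinate b) F)) m" for m
  proof -
    let ?w = "Poly_Mapping.lookup F m"
    have "?w = (\<Sum>b | coordinate b ?w \<noteq> 0. e (coordinate b ?w) * b)" by (simp add: coordinate_expansion)
    also have "\<dots> = (\<Sum>b\<in>B. e (coordinate b ?w) * b)"
    proof (rule sum.mono_neutral_left[OF fin])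
      show "{b. coordinate b ?w \<noteq> 0} \<subseteq> B"
      proof
        fix b assume b: "b \<in> {b. coordinate b ?w \<noteq> 0}"
        then have "?w \<noteq> 0" using functional_0[OF functional_coordinate] by auto
        then show "b \<in> B" using b by (auto simp: B_def in_keys_iff)
      qed
    qed (simp add: e_simps)
    finally show ?thesis
      by (simp add: lookup_sum lookup_mconst lookup_cmap e_simps functional_0[OF functional_coordinate])
  qed
  then show ?thesis using fin by (intro exI[of _ B]) (auto intro: poly_mapping_eqI)
qed

end

section \<open>Diagonalization over an extension field\<close>

context field_embedding
begin

lemma hom_sum: "\<epsilon> (\<Sum>i\<in>A. f i) = (\<Sum>i\<in>A. \<epsilon> (f i))"
  by (induction A rule: infinite_finite_induct) (simp_all add: hom_0 hom_add)

lemma alg_induct [consumes 1, case_names const gen add mult]: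
  assumes "x \<in> alg S" "\<And>c. Q (\<epsilon> c)" "\<And>s. s \<in> S \<Longrightarrow> Q s"
    "\<And>x y. Q x \<Longrightarrow> Q y \<Longrightarrow> Q (x + y)" "\<And>x y. Q x \<Longrightarrow> Q y \<Longrightarrow> Q (x * y)"
  shows "Q x"
proof -
  have prod: "Q (prod_mset M)" if "set_mset M \<subseteq> S" for M
    using that by (induction M) (use assms(2)[of 1] assms(3,5) in \<open>auto simp: hom_1\<close>)
  show ?thesis using assms(1) unfolding alg_def
  proof (induction rule: vs.span_induct_alt)
    case base
    then show ?case using assms(2)[of 0] by (simp add: hom_0)
  next
    case (step c x y)
    then show ?case using prod assms(2,4,5) by blast
  qed
qed

end

lemma mconst_power: "mconst (c ^ n) = mconst c ^ n"
  by (induction n) (simp_all add: mconst_mult)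

lemma mconst_prod: "mconst (\<Prod>i\<in>A. f i) = (\<Prod>i\<in>A. mconst (f i))"
  by (induction A rule: infinite_finite_induct) (simp_all add: mconst_mult)

lemma single_eq_prod_mvar:
  "Poly_Mapping.single m (c::'k::comm_semiring_1) = mconst c * (\<Prod>i\<in>UNIV. mvar (i::'n::finite) ^ Poly_Mapping.lookup m i)"
  using msubst_mvar_id[of "Poly_Mapping.single m c"] by (simp add: msubst_single)

definition diag :: "('n::finite \<Rightarrow> 'k) \<Rightarrow> ('k::zero, 'n) sqmat" where
  "diag v = (\<chi> i j. if i = j then v i else 0)"

lemma mcompose_diag_single:
  "mcompose (diag v) (Poly_Mapping.single m c) =
    Poly_Mapping.single m (c * (\<Prod>i\<in>UNIV. v i ^ Poly_Mapping.lookup m i) :: 'k::comm_semiring_1)"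
proof -
  have "(\<Sum>j\<in>UNIV. mconst (diag v $ i $ j) * mvar j) = mconst (v i) * mvar i" for i
  proof -
    have "(\<Sum>j\<in>UNIV. mconst (diag v $ i $ j) * mvar j) = (\<Sum>j\<in>UNIV. if j = i then mconst (v j) * mvar j else 0)"
      by (intro sum.cong) (auto simp: diag_def)
    then show ?thesis by simp
  qed
  then show ?thesis
    by (simp add: mcompose_def msubst_single single_eq_prod_mvar[of m "c * _"] power_mult_distrib
        prod.distrib mconst_mult mconst_prod mconst_power mult.assoc)
qed

text \<open>Each monomial is only scaled, which is why an invariant of a diagonal action consists of
  invariant monomials.\<close>

lemma lookup_mcompose_diag:
  "Poly_Mapping.lookup (mcompose (diag v) f) m =
    Poly_Mapping.lookup f m * (\<Prod>i\<in>UNIV. v i ^ Poly_Mapping.lookup m i :: 'k::comm_semiring_1)"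
  by (induction f rule: mpoly_induct)
     (simp_all add: mcompose_diag_single mcompose_add lookup_add algebra_simps lookup_single when_def)

lemma invertible_diag:
  assumes "\<And>i. v i \<noteq> (0 :: 'k::field)"
  shows "invertible (diag v)"
proof -
  have "diag v ** diag w = mat 1" if "\<And>i. v i * w i = 1" for v w :: "'n::finite \<Rightarrow> 'k"
    using that by (auto simp: diag_def matrix_matrix_mult_def mat_def vec_eq_iff if_distrib[of "\<lambda>x. x * _"] cong: if_cong)
  from this[of v "\<lambda>i. inverse (v i)"] this[of "\<lambda>i. inverse (v i)" v] show ?thesis
    using assms by (auto simp: invertible_def intro!: exI[of _ "diag (\<lambda>i. inverse (v i))"])
qed

definition fmonom :: "('n::{finite,linorder} \<Rightarrow>\<^sub>0 nat) \<Rightarrow> ('n, 'k::field) mpoly fract" where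
  "fmonom m = of_mpoly (Poly_Mapping.single m 1)"

lemma fmonom_add: "fmonom (a + b) = fmonom a * fmonom b"
  by (simp add: fmonom_def mult_single flip: of_mpoly_mult)

lemma fmonom_0: "fmonom 0 = 1"
  by (simp add: fmonom_def)

lemma fmonom_nonzero: "fmonom m \<noteq> (0 :: ('n::{finite,linorder}, 'k::field) mpoly fract)"
  unfolding fmonom_def of_mpoly_eq_0_iff by (metis lookup_single_eq lookup_zero one_neq_zero)

lemma fmonom_single: "fmonom (Poly_Mapping.single i n) = coord i ^ n"
  by (simp add: fmonom_def coord_def mvar_power flip: of_mpoly_power)

lemma fmonom_eq_prod: "fmonom m = (\<Prod>i\<in>UNIV. coord i ^ Poly_Mapping.lookup m i)"
  by (simp add: fmonom_def single_eq_prod_mvar[of m 1] of_mpoly_prod of_mpoly_power coord_def)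

lemma of_mpoly_eq_sum_fmonom:
  "of_mpoly F = (\<Sum>m\<in>Poly_Mapping.keys F. fconst (Poly_Mapping.lookup F m) * fmonom m)"
proof -
  have "of_mpoly F = of_mpoly (\<Sum>m\<in>Poly_Mapping.keys F. Poly_Mapping.single m (Poly_Mapping.lookup F m))"
    using mpoly_sum_single[of F] by simp
  then show ?thesis
    by (simp add: of_mpoly_sum fconst_def mconst_def fmonom_def mult_single flip: of_mpoly_mult)
qed

lemma (in field_hom) map_matrix_mult: "map_matrix e (A ** B) = map_matrix e A ** map_matrix e B"
  by (simp add: vec_eq_iff map_matrix_def matrix_matrix_mult_def e_simps hom_sum)

lemma (in field_hom) map_matrix_one: "map_matrix e (mat 1) = mat 1"
  by (simp add: vec_eq_iff map_matrix_def mat_def e_simps)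

lemma (in field_hom) map_matrix_inj: "map_matrix e A = map_matrix e B \<Longrightarrow> A = B"
proof -
  assume *: "map_matrix e A = map_matrix e B"
  have "A $ i $ j = B $ i $ j" for i j
  proof -
    have "e (A $ i $ j) = e (B $ i $ j)" using * by (simp add: vec_eq_iff map_matrix_def)
    then have "e (A $ i $ j - B $ i $ j) = 0"
      using hom_add[of "A $ i $ j - B $ i $ j" "B $ i $ j"] by simp
    then show ?thesis by (simp add: hom_eq_0_iff)
  qed
  then show ?thesis by (simp add: vec_eq_iff)
qed

locale diagonalized_rep = finite_faithful_rep G \<rho> + E: field_hom e
  for G :: "('g, 'b) monoid_scheme" (structure)
    and \<rho> :: "'g \<Rightarrow> ('k::field, 'n::{finite,linorder}) sqmat" and e :: "'k \<Rightarrow> 'K::field" +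
  fixes P :: "('K, 'n) sqmat" and ev :: "'g \<Rightarrow> 'n \<Rightarrow> 'K"
  assumes inv_P: "invertible P"
    and ev: "g \<in> carrier G \<Longrightarrow> map_matrix e (\<rho> g) *v column j P = ev g j *s column j P"
begin

definition Q :: "('K, 'n) sqmat" where
  "Q = (SOME Q. P ** Q = mat 1 \<and> Q ** P = mat 1)"

lemma P_Q: "P ** Q = mat 1" and Q_P: "Q ** P = mat 1"
  using someI_ex[OF inv_P[unfolded invertible_def]] by (auto simp: Q_def)

lemma column_nonzero: "column j P \<noteq> 0"
proof
  assume *: "column j P = 0"
  have "P $ i $ j = 0" for i
    using arg_cong[OF *, of "\<lambda>v. v $ i"] by (simp add: column_def)
  then have "(Q ** P) $ j $ j = 0" by (simp add: matrix_matrix_mult_def)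
  then show False by (simp add: Q_P mat_def)
qed

lemma ev_mult: "g \<in> carrier G \<Longrightarrow> h \<in> carrier G \<Longrightarrow> ev (g \<otimes> h) j = ev g j * ev h j"
proof -
  assume g: "g \<in> carrier G" "h \<in> carrier G"
  have "ev (g \<otimes> h) j *s column j P = map_matrix e (\<rho> g) *v (map_matrix e (\<rho> h) *v column j P)"
    using ev[of "g \<otimes> h" j] g by (simp add: rho_mult E.map_matrix_mult matrix_vector_mul_assoc)
  also have "\<dots> = (ev g j * ev h j) *s column j P"
    using g by (simp add: ev matrix_vector_mult_scale vector_smult_assoc mult.commute)
  finally show ?thesis using column_nonzero by simp
qed

lemma ev_one: "ev \<one> j = 1"
proof -
  have "ev \<one> j *s column j P = 1 *s column j P"
    using ev[of \<one> j] by (simp add: rho_one E.map_matrix_one)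
  then show ?thesis using column_nonzero[of j] unfolding vector_mul_rcancel by simp
qed

lemma ev_nonzero: "g \<in> carrier G \<Longrightarrow> ev g j \<noteq> 0"
  using ev_mult[of g "inv g" j] ev_one[of j] by auto

lemma ev_power_order: "g \<in> carrier G \<Longrightarrow> ev g j ^ order G = 1"
proof -
  assume g: "g \<in> carrier G"
  have "ev (g [^] n) j = ev g j ^ n" for n :: nat
    by (induction n) (simp_all add: ev_one ev_mult g mult.commute)
  then show ?thesis using pow_order_eq_1[OF g] ev_one by metis
qed

definition dg :: "'g \<Rightarrow> ('n, 'K) mpoly \<Rightarrow> ('n, 'K) mpoly" where
  "dg g = mcompose (diag (ev (inv g)))"

definition fdg :: "'g \<Rightarrow> ('n, 'K) mpoly fract \<Rightarrow> ('n, 'K) mpoly fract" where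
  "fdg g = fcompose (diag (ev (inv g)))"

text \<open>Extension of scalars, followed by the passage to coordinates in which \<open>G\<close> is diagonal.\<close>

definition iota :: "('n, 'k) mpoly \<Rightarrow> ('n, 'K) mpoly" where
  "iota f = mcompose P (cmap e f)"

lemma fdg_hom:
  assumes "g \<in> carrier G"
  shows "fdg g (x + y) = fdg g x + fdg g y" "fdg g (x * y) = fdg g x * fdg g y"
    "fdg g (fconst c) = fconst c" "fdg g (of_mpoly f) = of_mpoly (dg g f)"
  using assms invertible_diag[of "ev (inv g)"] ev_nonzero[of "inv g"]
  by (simp_all add: fdg_def dg_def fcompose_add fcompose_mult fcompose_fconst fcompose_of_mpoly)

lemma conjugate_rho: "g \<in> carrier G \<Longrightarrow> map_matrix e (\<rho> g) ** P = P ** diag (ev g)"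
proof -
  assume g: "g \<in> carrier G"
  have "(map_matrix e (\<rho> g) ** P) $ i $ j = (P ** diag (ev g)) $ i $ j" for i j
  proof -
    have "(map_matrix e (\<rho> g) ** P) $ i $ j = (map_matrix e (\<rho> g) *v column j P) $ i"
      by (simp add: matrix_matrix_mult_def matrix_vector_mult_def column_def)
    also have "\<dots> = P $ i $ j * ev g j" unfolding ev[OF g] by (simp add: column_def mult.commute)
    also have "\<dots> = (\<Sum>k\<in>UNIV. if k = j then P $ i $ k * ev g k else 0)" by simp
    also have "\<dots> = (P ** diag (ev g)) $ i $ j"
    proof -
      have "(\<Sum>k\<in>UNIV. if k = j then P $ i $ k * ev g k else 0) = (\<Sum>k\<in>UNIV. P $ i $ k * diag (ev g) $ k $ j)"
        by (rule sum.cong) (simp_all add: diag_def)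
      then show ?thesis by (simp add: matrix_matrix_mult_def)
    qed
    finally show ?thesis .
  qed
  then show ?thesis by (simp add: vec_eq_iff)
qed

lemma iota_act: "g \<in> carrier G \<Longrightarrow> iota (act g f) = dg g (iota f)"
  by (simp add: iota_def act_def dg_def E.cmap_e_mcompose mcompose_mcompose conjugate_rho)

lemma iota_add: "iota (f + g) = iota f + iota g" and iota_mult: "iota (f * g) = iota f * iota g"
  by (simp_all add: iota_def E.cmap_e_add E.cmap_e_mult mcompose_add mcompose_mult)

lemma iota_mconst: "iota (mconst c) = mconst (e c)"
  by (simp add: iota_def E.cmap_e_mconst)

lemma iota_eq_0_iff: "iota f = 0 \<longleftrightarrow> f = 0"
  by (simp add: iota_def mcompose_eq_0_iff[OF inv_P] E.cmap_e_eq_0_iff)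

lemma iota_0: "iota 0 = 0"
  by (simp add: iota_eq_0_iff)

lemma iota_power: "iota (f ^ n) = iota f ^ n"
  using iota_mconst[of 1] by (induction n) (simp_all add: iota_mult E.e_simps)

lemma iota_sum: "iota (\<Sum>i\<in>A. f i) = (\<Sum>i\<in>A. iota (f i))"
  by (induction A rule: infinite_finite_induct) (simp_all add: iota_0 iota_add)

lemma mcompose_Q_iota: "mcompose Q (iota f) = cmap e f"
  by (simp add: iota_def mcompose_mcompose P_Q mcompose_mat_1)

section \<open>Invariant monomials of the diagonal action, and descent to the base field\<close>

definition weight :: "'g \<Rightarrow> ('n \<Rightarrow>\<^sub>0 nat) \<Rightarrow> 'K" where
  "weight g m = (\<Prod>i\<in>UNIV. ev g i ^ Poly_Mapping.lookup m i)"

text \<open>Exponent vectors of invariant monomials. The action involves inverses, but quantifying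
  over the whole group gives the same condition, see \<open>weight_inv\<close>.\<close>

definition lam :: "nat \<Rightarrow> ('n \<Rightarrow>\<^sub>0 nat) set" where
  "lam d = {m. (\<Sum>i\<in>UNIV. Poly_Mapping.lookup m i) \<le> d \<and> (\<forall>g\<in>carrier G. weight g m = 1)}"

abbreviation minvs :: "nat \<Rightarrow> ('n, 'K) mpoly fract set" where
  "minvs d \<equiv> fmonom ` lam d"

lemma weight_inv: "(\<forall>g\<in>carrier G. weight (inv g) m = 1) \<longleftrightarrow> (\<forall>g\<in>carrier G. weight g m = 1)"
  by (metis inv_closed inv_inv)

lemma keys_weight:
  assumes "\<And>g. g \<in> carrier G \<Longrightarrow> dg g F = F" "m \<in> Poly_Mapping.keys F"
  shows "\<forall>g\<in>carrier G. weight g m = 1"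
proof -
  have "weight (inv g) m = 1" if "g \<in> carrier G" for g
  proof -
    have "Poly_Mapping.lookup F m * weight (inv g) m = Poly_Mapping.lookup F m"
      using lookup_mcompose_diag[of "ev (inv g)" F m] assms(1)[OF that] by (simp add: dg_def weight_def)
    then show ?thesis using assms(2) by (simp add: in_keys_iff)
  qed
  then show ?thesis using weight_inv by blast
qed

lemma dg_single: "(\<forall>g\<in>carrier G. weight g m = 1) \<Longrightarrow> g \<in> carrier G \<Longrightarrow>
    dg g (Poly_Mapping.single m c) = Poly_Mapping.single m c"
  using weight_inv[of m] by (simp add: dg_def mcompose_diag_single weight_def)

lemma iota_invs:
  assumes "f \<in> poly_invariants_le G \<rho> d"
  shows "of_mpoly (iota f) \<in> alg (minvs d)"
proof -
  have f: "deg_le f d" "\<And>g. g \<in> carrier G \<Longrightarrow> act g f = f"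
    using assms by (auto simp: poly_invariants_le_def act_def)
  have "dg g (iota f) = iota f" if "g \<in> carrier G" for g
    using iota_act[OF that, of f] f(2)[OF that] by simp
  from keys_weight[OF this] have "\<forall>g\<in>carrier G. weight g m = 1" if "m \<in> Poly_Mapping.keys (iota f)" for m
    using that by blast
  moreover have "deg_le (iota f) d"
    unfolding iota_def using f(1) by (intro deg_le_mcompose deg_le_cmap) (auto simp: E.e_simps)
  ultimately have "Poly_Mapping.keys (iota f) \<subseteq> lam d" by (auto simp: lam_def deg_le_def)
  then show ?thesis unfolding of_mpoly_eq_sum_fmonom
    by (intro alg_sum alg_mult alg_const alg_base) auto
qed

lemma iota_alg:
  assumes "w \<in> alg (invs d)"
  shows "\<exists>f. w = of_mpoly f \<and> of_mpoly (iota f) \<in> alg (minvs d)"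
  using assms
proof (induction rule: alg_induct)
  case (const c)
  have "of_mpoly (iota (mconst c)) \<in> alg (minvs d)"
    using alg_const[of "e c" "minvs d"] by (simp add: iota_mconst fconst_def)
  then show ?case using fconst_def[of c] by blast
next
  case (gen s)
  then show ?case using iota_invs by blast
next
  case (add x y)
  then show ?case by (metis alg_add iota_add of_mpoly_add)
next
  case (mult x y)
  then show ?case by (metis alg_mult iota_mult of_mpoly_mult)
qed

text \<open>The \<open>K\<close>-span of the algebra generated by the invariants defined over \<open>k\<close>.\<close>

inductive_set descent :: "nat \<Rightarrow> ('n, 'K) mpoly set" for d where
  zero: "0 \<in> descent d"
| step: "of_mpoly f \<in> alg (invs d) \<Longrightarrow> F \<in> descent d \<Longrightarrow> mconst b * cmap e f + F \<in> descent d"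

lemma descent_term: "of_mpoly f \<in> alg (invs d) \<Longrightarrow> mconst b * cmap e f \<in> descent d"
  using descent.step[OF _ descent.zero] by simp

lemma descent_add: "F \<in> descent d \<Longrightarrow> H \<in> descent d \<Longrightarrow> F + H \<in> descent d"
  by (induction F rule: descent.induct) (auto simp: add.assoc intro: descent.step)

lemma descent_sum: "(\<And>i. i \<in> A \<Longrightarrow> f i \<in> descent d) \<Longrightarrow> (\<Sum>i\<in>A. f i) \<in> descent d"
  by (induction A rule: infinite_finite_induct) (auto intro: descent.zero descent_add)

lemma descent_mult_term:
  assumes "of_mpoly f \<in> alg (invs d)" "F \<in> descent d"
  shows "mconst b * cmap e f * F \<in> descent d"
  using assms(2)
proof (induction rule: descent.induct)
  case zero
  then show ?case by (simp add: descent.zero)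
next
  case (step f' F b')
  have "mconst (b * b') * cmap e (f * f') + mconst b * cmap e f * F \<in> descent d"
    using step assms(1) by (intro descent.step) (auto simp: of_mpoly_mult alg_mult)
  then show ?case by (simp add: mconst_mult E.cmap_e_mult algebra_simps)
qed

lemma descent_mult: "F \<in> descent d \<Longrightarrow> H \<in> descent d \<Longrightarrow> F * H \<in> descent d"
  by (induction F rule: descent.induct)
     (auto simp: distrib_right intro: descent.zero descent_add descent_mult_term)

lemma descent_functional:
  assumes "E.functional \<phi>" "F \<in> descent d"
  shows "of_mpoly (cmap \<phi> F) \<in> alg (invs d)"
  using assms(2)
proof (induction rule: descent.induct)
  case zero
  then show ?case by (simp add: cmap_0 E.functional_0[OF assms(1)] alg_0)
next
  case (step f F b)
  have "of_mpoly (mconst (\<phi> b) * f) \<in> alg (invs d)"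
    using alg_mult[OF alg_const[of "\<phi> b"] step(1)] by (simp add: of_mpoly_mult fconst_def)
  then show ?case using step
    by (simp add: E.cmap_functional_add[OF assms(1)] E.cmap_functional_mconst[OF assms(1)] of_mpoly_add alg_add)
qed

text \<open>In the original coordinates the monomial is invariant under matrices with entries from
  \<open>k\<close>, so its coordinates with respect to a \<open>k\<close>-basis of \<open>K\<close>
  are invariants over \<open>k\<close> of no larger degree.\<close>

lemma lam_descent:
  assumes "m \<in> lam d"
  shows "mcompose Q (Poly_Mapping.single m 1) \<in> descent d"
proof -
  define F where "F = mcompose Q (Poly_Mapping.single m 1)"
  have P_F: "mcompose P F = Poly_Mapping.single m 1"
    by (simp add: F_def mcompose_mcompose Q_P mcompose_mat_1)
  have deg: "deg_le F d" unfolding F_def using assms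
    by (intro deg_le_mcompose deg_le_single) (simp add: lam_def)
  have F_inv: "mcompose (map_matrix e (\<rho> (inv g))) F = F" if g: "g \<in> carrier G" for g
  proof -
    have "mcompose P (mcompose (map_matrix e (\<rho> (inv g))) F) = dg g (mcompose P F)"
      using g by (simp add: mcompose_mcompose conjugate_rho dg_def)
    also have "\<dots> = mcompose P F" unfolding P_F using assms g by (intro dg_single) (auto simp: lam_def)
    finally have "mcompose Q (mcompose P (mcompose (map_matrix e (\<rho> (inv g))) F)) = mcompose Q (mcompose P F)"
      by simp
    then show ?thesis by (simp add: mcompose_mcompose[of Q P] P_Q mcompose_mat_1)
  qed
  have coeff: "cmap (E.coordinate b) F \<in> poly_invariants_le G \<rho> d" for b
  proof -
    have "deg_le (cmap (E.coordinate b) F) d"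
      by (rule deg_le_cmap[OF _ deg]) (rule E.functional_0[OF E.functional_coordinate])
    moreover have "mcompose (\<rho> (inv g)) (cmap (E.coordinate b) F) = cmap (E.coordinate b) F"
      if g: "g \<in> carrier G" for g
      using E.cmap_functional_mcompose[OF E.functional_coordinate, of b "\<rho> (inv g)" F] F_inv[OF g] by simp
    ultimately show ?thesis by (simp add: poly_invariants_le_def)
  qed
  obtain B where "F = (\<Sum>b\<in>B. mconst b * cmap e (cmap (E.coordinate b) F))"
    using E.cmap_expansion by blast
  also have "\<dots> \<in> descent d"
    by (intro descent_sum descent_term alg_base imageI coeff)
  finally show ?thesis by (simp add: F_def)
qed

lemma alg_minvs_descent:
  assumes "w \<in> alg (minvs d)"
  shows "\<exists>F. w = of_mpoly F \<and> mcompose Q F \<in> descent d"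
  using assms
proof (induction rule: alg_induct)
  case (const c)
  have "of_mpoly 1 \<in> alg (invs d)" using alg_1 by simp
  from descent_term[OF this, of c] have "mcompose Q (mconst c) \<in> descent d" by (simp add: E.cmap_e_1)
  then show ?case by (auto simp: fconst_def)
next
  case (gen s)
  then show ?case using lam_descent by (auto simp: fmonom_def)
next
  case (add x y)
  then show ?case by (metis descent_add mcompose_add of_mpoly_add)
next
  case (mult x y)
  then show ?case by (metis descent_mult mcompose_mult of_mpoly_mult)
qed

text \<open>The injective map \<open>iota\<close> transports the relations of the old coordinates.
  The new coordinates are linear combinations of the images \<open>y i\<close>, and algebraic
  elements form a field.\<close>

lemma coord_alg_dep:
  assumes "\<forall>x\<in>range coord. alg_dep (invs d) x"
  shows "alg_dep (minvs d) (coord j)"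
proof -
  interpret R: field "ring_of_type_algebra :: ('n, 'K) mpoly fract ring" by auto
  define y where "y i = of_mpoly (iota (mvar i))" for i
  have dep: "alg_dep (minvs d) (y i)" for i
  proof -
    have "alg_dep (invs d) (coord i)" using assms by blast
    then obtain n c where c: "\<forall>l\<le>n. c l \<in> alg (invs d)" "c n \<noteq> 0" "(\<Sum>l\<le>n. c l * coord i ^ l) = 0"
      unfolding alg_dep_def by blast
    then have "\<forall>l. \<exists>f. l \<le> n \<longrightarrow> c l = of_mpoly f \<and> of_mpoly (iota f) \<in> alg (minvs d)"
      using iota_alg by blast
    then obtain f where f: "\<And>l. l \<le> n \<Longrightarrow> c l = of_mpoly (f l) \<and> of_mpoly (iota (f l)) \<in> alg (minvs d)"
      by metis
    have "of_mpoly (\<Sum>l\<le>n. f l * mvar i ^ l) = (\<Sum>l\<le>n. c l * coord i ^ l)"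
      unfolding of_mpoly_sum using f by (intro sum.cong) (auto simp: of_mpoly_mult of_mpoly_power coord_def)
    then have "(\<Sum>l\<le>n. f l * mvar i ^ l) = 0" using c(3) by simp
    from arg_cong[OF this, of "\<lambda>f. of_mpoly (iota f)"]
    have sum_0: "(\<Sum>l\<le>n. of_mpoly (iota (f l)) * y i ^ l) = 0"
      by (simp add: iota_sum iota_mult iota_power of_mpoly_sum of_mpoly_mult of_mpoly_power y_def iota_0)
    have "f n \<noteq> 0" using f[of n] c(2) by auto
    then show ?thesis
      by (intro alg_depI[OF _ sum_0 order.refl]) (use f in \<open>auto simp: iota_eq_0_iff\<close>)
  qed
  have "mvar j = mcompose P (mcompose Q (mvar j :: ('n, 'K) mpoly))"
    by (simp add: mcompose_mcompose Q_P mcompose_mat_1)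
  also have "\<dots> = (\<Sum>i\<in>UNIV. mconst (Q $ j $ i) * iota (mvar i))"
    by (simp add: mcompose_mvar[of Q] mcompose_sum mcompose_mult iota_def E.cmap_e_mvar)
  finally have "coord j = (\<Sum>i\<in>UNIV. fconst (Q $ j $ i) * y i)"
    by (simp add: coord_def y_def fconst_def of_mpoly_sum flip: of_mpoly_mult)
  then have "coord j \<in> alg (range y)"
    by (simp only:) (intro alg_sum alg_mult alg_const alg_base, blast)
  then have "coord j \<in> rat (range y)" using alg_subset_rat by blast
  also have "\<dots> \<subseteq> {x \<in> carrier ring_of_type_algebra. (R.algebraic over rat (minvs d)) x}"
  proof (rule rat_subset_subfield[OF R.subfield_of_algebraics[OF subfield_rat]])
    show "range y \<subseteq> {x \<in> carrier ring_of_type_algebra. (R.algebraic over rat (minvs d)) x}"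
      using dep algebraic_iff_alg_dep by auto
    show "range fconst \<subseteq> {x \<in> carrier ring_of_type_algebra. (R.algebraic over rat (minvs d)) x}"
      using R.algebraic_self[OF subfieldE(1)[OF subfield_rat]] rat_const by auto
  qed
  finally show ?thesis using algebraic_iff_alg_dep by blast
qed

text \<open>The set on the right is the additive monoid generated by \<open>lam d\<close>; algebraic
  relations thereby become relations between exponent vectors.\<close>

lemma alg_minvs_keys:
  assumes "w \<in> alg (minvs d)"
  shows "\<exists>F. w = of_mpoly F \<and> Poly_Mapping.keys F \<subseteq> {\<Sum>\<^sub># N |N. set_mset N \<subseteq> lam d}"
  using assms
proof (induction rule: alg_induct)
  case (const c)
  have "\<exists>N. 0 = \<Sum>\<^sub># N \<and> set_mset N \<subseteq> lam d" by (rule exI[of _ "{#}"]) simp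
  then show ?case by (intro exI[of _ "mconst c"]) (auto simp: fconst_def mconst_def)
next
  case (gen s)
  then obtain m where "s = fmonom m" "m \<in> lam d" by blast
  then show ?case
    by (intro exI[of _ "Poly_Mapping.single m 1"]) (auto simp: fmonom_def intro!: exI[of _ "{#m#}"])
next
  case (add x y)
  then obtain F H where "x = of_mpoly F" "y = of_mpoly H"
    "Poly_Mapping.keys F \<subseteq> {\<Sum>\<^sub># N |N. set_mset N \<subseteq> lam d}"
    "Poly_Mapping.keys H \<subseteq> {\<Sum>\<^sub># N |N. set_mset N \<subseteq> lam d}" by blast
  then show ?case using Poly_Mapping.keys_add[of F H]
    by (intro exI[of _ "F + H"]) (auto simp: of_mpoly_add)
next
  case (mult x y)
  then obtain F H where *: "x = of_mpoly F" "y = of_mpoly H"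
    "Poly_Mapping.keys F \<subseteq> {\<Sum>\<^sub># N |N. set_mset N \<subseteq> lam d}"
    "Poly_Mapping.keys H \<subseteq> {\<Sum>\<^sub># N |N. set_mset N \<subseteq> lam d}" by blast
  have "Poly_Mapping.keys (F * H) \<subseteq> {\<Sum>\<^sub># N |N. set_mset N \<subseteq> lam d}"
  proof
    fix m assume "m \<in> Poly_Mapping.keys (F * H)"
    then obtain a b where "m = a + b" "a \<in> Poly_Mapping.keys F" "b \<in> Poly_Mapping.keys H"
      using keys_mult[of F H] by blast
    then obtain M N where "m = \<Sum>\<^sub># M + \<Sum>\<^sub># N" "set_mset M \<subseteq> lam d" "set_mset N \<subseteq> lam d"
      using * by blast
    then show "m \<in> {\<Sum>\<^sub># N |N. set_mset N \<subseteq> lam d}"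
      by (intro CollectI exI[of _ "M + N"]) simp
  qed
  then show ?case using * by (intro exI[of _ "F * H"]) (simp add: of_mpoly_mult)
qed

text \<open>In an algebraic relation for a coordinate over the monomial algebra, a nonzero leading monomial
  must cancel against a monomial of another term.\<close>

lemma power_relation:
  assumes "alg_dep (minvs d) (coord j)"
  shows "\<exists>n M N. 0 < n \<and> set_mset M \<subseteq> lam d \<and> set_mset N \<subseteq> lam d \<and>
    \<Sum>\<^sub># M = Poly_Mapping.single j n + \<Sum>\<^sub># N"
proof -
  obtain n c where c: "\<forall>l\<le>n. c l \<in> alg (minvs d)" "c n \<noteq> 0" "(\<Sum>l\<le>n. c l * coord j ^ l) = 0"
    using assms unfolding alg_dep_def by blast
  then have "\<forall>l. \<exists>F. l \<le> n \<longrightarrow> c l = of_mpoly F \<and> Poly_Mapping.keys F \<subseteq> {\<Sum>\<^sub># N |N. set_mset N \<subseteq> lam d}"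
    using alg_minvs_keys by blast
  from choice[OF this] obtain F where "\<forall>l. l \<le> n \<longrightarrow> c l = of_mpoly (F l) \<and>
    Poly_Mapping.keys (F l) \<subseteq> {\<Sum>\<^sub># N |N. set_mset N \<subseteq> lam d}" ..
  then have F: "\<And>l. l \<le> n \<Longrightarrow> c l = of_mpoly (F l)"
    "\<And>l. l \<le> n \<Longrightarrow> Poly_Mapping.keys (F l) \<subseteq> {\<Sum>\<^sub># N |N. set_mset N \<subseteq> lam d}" by simp_all
  have "of_mpoly (\<Sum>l\<le>n. F l * mvar j ^ l) = (\<Sum>l\<le>n. c l * coord j ^ l)"
    unfolding of_mpoly_sum using F by (intro sum.cong) (auto simp: of_mpoly_mult of_mpoly_power coord_def)
  then have sum_0: "(\<Sum>l\<le>n. F l * mvar j ^ l) = 0" using c(3) by simp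
  have "F n \<noteq> 0" using F(1)[of n] c(2) by auto
  then obtain m where m: "m \<in> Poly_Mapping.keys (F n)" by (metis all_not_in_conv keys_eq_empty)
  have shift: "Poly_Mapping.lookup (H * Poly_Mapping.single s 1) (k + s) = Poly_Mapping.lookup H k"
    for H :: "('n, 'K) mpoly" and s k
  proof (induction H rule: mpoly_induct)
    case (single l b)
    then show ?case by (simp add: mult_single lookup_single when_def)
  qed (simp add: lookup_add distrib_right)
  \<comment> \<open>Multiplication by a power of one variable only shifts exponents, so
    \<open>?k\<close> occurs in the top term; the sum being zero, it also occurs in a term with
    \<open>l < n\<close>.\<close>
  let ?k = "m + Poly_Mapping.single j n"
  have "Poly_Mapping.lookup (F n * mvar j ^ n) ?k \<noteq> 0"
    unfolding mvar_power shift using m by (simp add: in_keys_iff)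
  moreover have "(\<Sum>l\<le>n. Poly_Mapping.lookup (F l * mvar j ^ l) ?k) = 0"
    using sum_0 by (simp flip: lookup_sum)
  then have "Poly_Mapping.lookup (F n * mvar j ^ n) ?k + (\<Sum>l<n. Poly_Mapping.lookup (F l * mvar j ^ l) ?k) = 0"
    by (simp add: lessThan_Suc_atMost[symmetric] add.commute)
  ultimately have "(\<Sum>l<n. Poly_Mapping.lookup (F l * mvar j ^ l) ?k) \<noteq> 0" by auto
  then obtain l where l: "l < n" "Poly_Mapping.lookup (F l * mvar j ^ l) ?k \<noteq> 0"
    by (metis (no_types, lifting) lessThan_iff sum.neutral)
  then have "?k \<in> Poly_Mapping.keys (F l * Poly_Mapping.single (Poly_Mapping.single j l) 1)"
    by (simp add: in_keys_iff mvar_power)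
  then obtain m' where m': "m' \<in> Poly_Mapping.keys (F l)" "?k = m' + Poly_Mapping.single j l"
    using keys_mult[of "F l" "Poly_Mapping.single (Poly_Mapping.single j l) 1"] by (auto split: if_splits)
  have "Poly_Mapping.single j n = Poly_Mapping.single j (n - l) + Poly_Mapping.single j l"
    using l(1) by (simp flip: single_add)
  then have "m' + Poly_Mapping.single j l = (Poly_Mapping.single j (n - l) + m) + Poly_Mapping.single j l"
    using m'(2) by (simp add: ac_simps)
  then have eq: "m' = Poly_Mapping.single j (n - l) + m" by simp
  obtain M where "m' = \<Sum>\<^sub># M" "set_mset M \<subseteq> lam d" using F(2)[of l] l(1) m'(1) by auto
  moreover obtain N where "m = \<Sum>\<^sub># N" "set_mset N \<subseteq> lam d" using F(2)[of n] m by auto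
  ultimately show ?thesis using eq l(1) by (intro exI[of _ "n - l"] exI[of _ M] exI[of _ N]) simp
qed

end

lemma lookup_sum_mset: "Poly_Mapping.lookup (\<Sum>\<^sub># M) i = (\<Sum>a\<in>#M. Poly_Mapping.lookup a i)"
  by (induction M) (simp_all add: lookup_add)

lemma sum_lookup_single: "(\<Sum>i\<in>UNIV. Poly_Mapping.lookup (Poly_Mapping.single (k :: 'n::finite) n) i) = (n :: nat)"
  by (simp add: lookup_single when_def)

lemma mcompose_diag_mvar: "mcompose (diag v) (mvar i) = mconst (v i) * mvar i"
proof -
  have "mcompose (diag v) (mvar i) = (\<Sum>j\<in>UNIV. if j = i then mconst (v j) * mvar j else 0)"
    unfolding mcompose_mvar by (intro sum.cong) (auto simp: diag_def)
  then show ?thesis by simp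
qed

section \<open>One variable for each nontrivial character\<close>

context diagonalized_rep
begin

definition triv :: "'n \<Rightarrow> bool" where
  "triv j \<longleftrightarrow> (\<forall>g\<in>carrier G. ev g j = 1)"

text \<open>The choice depends only on the character of \<open>j\<close>, so coordinates with equal
  characters receive the same representative.\<close>

definition rep :: "'n \<Rightarrow> 'n" where
  "rep j = (SOME k. \<forall>g\<in>carrier G. ev g k = ev g j)"

definition reps :: "'n set" where
  "reps = rep ` {j. \<not> triv j}"

text \<open>On monomials this substitutes \<open>1\<close> for the coordinates with trivial
  character and the representative for every other one.\<close>

definition reduce :: "('n \<Rightarrow>\<^sub>0 nat) \<Rightarrow> ('n \<Rightarrow>\<^sub>0 nat)" where
  "reduce m = (\<Sum>j | \<not> triv j. Poly_Mapping.single (rep j) (Poly_Mapping.lookup m j))"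

abbreviation minvs_reps :: "nat \<Rightarrow> ('n, 'K) mpoly fract set" where
  "minvs_reps d \<equiv> fmonom ` {m \<in> lam d. Poly_Mapping.keys m \<subseteq> reps}"

lemma ev_rep: "g \<in> carrier G \<Longrightarrow> ev g (rep j) = ev g j"
  using someI[of "\<lambda>k. \<forall>g\<in>carrier G. ev g k = ev g j" j] by (simp add: rep_def)

lemma rep_eqI: "(\<And>g. g \<in> carrier G \<Longrightarrow> ev g j = ev g k) \<Longrightarrow> rep j = rep k"
  by (simp add: rep_def)

lemma reps_D: "i \<in> reps \<Longrightarrow> rep i = i \<and> \<not> triv i"
  using rep_eqI[OF ev_rep] by (auto simp: reps_def triv_def ev_rep)

lemma reduce_add: "reduce (a + b) = reduce a + reduce b"
  by (simp add: reduce_def lookup_add single_add sum.distrib)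

lemma reduce_sum_mset: "reduce (\<Sum>\<^sub># N) = \<Sum>\<^sub># (image_mset reduce N)"
  by (induction N) (simp_all add: reduce_add, simp add: reduce_def)

lemma reduce_single:
  assumes "i \<in> reps"
  shows "reduce (Poly_Mapping.single i n) = Poly_Mapping.single i n"
proof -
  have "reduce (Poly_Mapping.single i n) =
      (\<Sum>j | \<not> triv j. if j = i then Poly_Mapping.single (rep j) n else 0)"
    unfolding reduce_def by (intro sum.cong) (auto simp: lookup_single when_def)
  then show ?thesis using reps_D[OF assms] by simp
qed

lemma keys_reduce: "Poly_Mapping.keys (reduce m) \<subseteq> reps"
proof
  fix i assume "i \<in> Poly_Mapping.keys (reduce m)"
  then have "(\<Sum>j | \<not> triv j. Poly_Mapping.lookup (Poly_Mapping.single (rep j) (Poly_Mapping.lookup m j)) i) \<noteq> 0"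
    by (simp add: in_keys_iff reduce_def lookup_sum)
  then obtain j where "j \<in> {j. \<not> triv j}" "Poly_Mapping.lookup (Poly_Mapping.single (rep j) (Poly_Mapping.lookup m j)) i \<noteq> 0"
    by (rule sum.not_neutral_contains_not_neutral)
  then show "i \<in> reps" by (auto simp: reps_def lookup_single when_def split: if_splits)
qed

lemma weight_add: "weight g (a + b) = weight g a * weight g b"
  by (simp add: weight_def lookup_add power_add prod.distrib)

lemma weight_single: "weight g (Poly_Mapping.single i n) = ev g i ^ n"
proof -
  have "weight g (Poly_Mapping.single i n) = (\<Prod>j\<in>UNIV. if j = i then ev g j ^ n else 1)"
    unfolding weight_def by (intro prod.cong) (auto simp: lookup_single when_def)
  then show ?thesis by simp
qed

lemma weight_sum: "finite A \<Longrightarrow> weight g (\<Sum>i\<in>A. f i) = (\<Prod>i\<in>A. weight g (f i))"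
  by (induction A rule: finite_induct) (simp_all add: weight_add, simp add: weight_def)

lemma weight_reduce: "g \<in> carrier G \<Longrightarrow> weight g (reduce m) = weight g m"
proof -
  assume g: "g \<in> carrier G"
  have "weight g (reduce m) = (\<Prod>j | \<not> triv j. ev g j ^ Poly_Mapping.lookup m j)"
    by (simp add: reduce_def weight_sum weight_single ev_rep[OF g])
  also have "\<dots> = weight g m" unfolding weight_def
    by (rule prod.mono_neutral_left) (auto simp: triv_def g)
  finally show ?thesis .
qed

lemma degree_reduce:
  "(\<Sum>i\<in>UNIV. Poly_Mapping.lookup (reduce m) i) \<le> (\<Sum>i\<in>UNIV. Poly_Mapping.lookup m i)"
proof -
  have "(\<Sum>i\<in>UNIV. Poly_Mapping.lookup (reduce m) i) = (\<Sum>j | \<not> triv j. Poly_Mapping.lookup m j)"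
    unfolding reduce_def lookup_sum by (subst sum.swap) (simp only: sum_lookup_single)
  also have "\<dots> \<le> (\<Sum>i\<in>UNIV. Poly_Mapping.lookup m i)" by (rule sum_mono2) auto
  finally show ?thesis .
qed

lemma reduce_lam: "m \<in> lam d \<Longrightarrow> reduce m \<in> lam d"
  using degree_reduce[of m] by (auto simp: lam_def weight_reduce)

text \<open>\<open>reduce\<close> is additive and leaves the powers of a representative alone, so it
  turns \<open>power_relation\<close> into a two-term relation for \<open>coord i\<close> over the
  reduced monomials.\<close>

lemma coord_reps_alg_dep:
  assumes "i \<in> reps" "alg_dep (minvs d) (coord i)"
  shows "alg_dep (minvs_reps d) (coord i)"
proof -
  obtain n M N where n: "0 < n" and M: "set_mset M \<subseteq> lam d" and N: "set_mset N \<subseteq> lam d"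
    and eq: "\<Sum>\<^sub># M = Poly_Mapping.single i n + \<Sum>\<^sub># N"
    using power_relation[OF assms(2)] by blast
  define r :: "_ \<Rightarrow> ('n, 'K) mpoly fract" where "r L = fmonom (\<Sum>\<^sub># (image_mset reduce L))" for L
  have r: "r L \<in> alg (minvs_reps d)" if "set_mset L \<subseteq> lam d" for L
    using that
  proof (induction L)
    case empty
    then show ?case by (simp add: r_def fmonom_0 alg_1)
  next
    case (add a L)
    then have "fmonom (reduce a) \<in> alg (minvs_reps d)"
      using reduce_lam keys_reduce by (intro alg_base) auto
    then show ?case using add by (simp add: r_def fmonom_add alg_mult)
  qed
  have rel: "r M = coord i ^ n * r N"
    using arg_cong[OF eq, of reduce]
    by (simp add: r_def reduce_add reduce_sum_mset reduce_single[OF assms(1)] fmonom_add fmonom_single)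
  define c where "c l = (if l = n then r N else if l = 0 then - r M else 0)" for l
  have "(\<Sum>l\<le>n. c l * coord i ^ l) = (\<Sum>l\<in>{0, n}. c l * coord i ^ l)"
    by (rule sum.mono_neutral_right) (auto simp: c_def)
  also have "\<dots> = 0" using n by (simp add: c_def rel mult.commute)
  finally show ?thesis
    by (intro alg_depI[of n c _ _ n])
       (use r[OF M] r[OF N] in \<open>auto simp: c_def alg_uminus alg_0 r_def fmonom_nonzero\<close>)
qed

lemma fdg_coord: "g \<in> carrier G \<Longrightarrow> fdg g (coord i) = fconst (ev (inv g) i) * coord i"
  by (simp add: coord_def fdg_hom dg_def mcompose_diag_mvar of_mpoly_mult fconst_def)

lemma fdg_fmonom:
  assumes "\<forall>g\<in>carrier G. weight g m = 1" "g \<in> carrier G"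
  shows "fdg g (fmonom m) = fmonom m"
  using dg_single[OF assms] by (simp add: fmonom_def fdg_hom[OF assms(2)])

lemma fmonom_in_rat_reps: "Poly_Mapping.keys m \<subseteq> reps \<Longrightarrow> fmonom m \<in> rat (coord ` reps)"
  unfolding fmonom_def
  using single_in_polys[OF _ order.refl, of m reps 1] polys_subset_alg alg_subset_rat by blast

text \<open>Trivial coordinates have eigenvalue \<open>1\<close> and all others share the eigenvalue
  of their representative, so the representatives determine the whole diagonal matrix and, by
  faithfulness, the group element.\<close>

lemma reps_separate:
  assumes g: "g \<in> carrier G" "g' \<in> carrier G" and "g \<noteq> g'"
  shows "\<exists>x\<in>coord ` reps. fdg g x \<noteq> (fdg g' x :: ('n, 'K) mpoly fract)"
proof (rule ccontr)
  assume *: "\<not> ?thesis"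
  have "ev (inv g) j = ev (inv g') j" for j
  proof (cases "triv j")
    case True
    then show ?thesis using g by (simp add: triv_def)
  next
    case False
    then have "fdg g (coord (rep j)) = fdg g' (coord (rep j))" using * by (auto simp: reps_def)
    moreover have "mvar (rep j) \<noteq> (0 :: ('n, 'K) mpoly)" by (rule mvar_neq_0)
    then have "coord (rep j) \<noteq> (0 :: ('n, 'K) mpoly fract)" by (simp add: coord_def)
    ultimately have "fconst (ev (inv g) (rep j)) = (fconst (ev (inv g') (rep j)) :: ('n, 'K) mpoly fract)"
      using g by (simp add: fdg_coord)
    then have "mconst (ev (inv g) (rep j)) = (mconst (ev (inv g') (rep j)) :: ('n, 'K) mpoly)"
      by (simp add: fconst_def)
    from arg_cong[OF this, of "\<lambda>p. Poly_Mapping.lookup p 0"]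
    show ?thesis using g by (simp add: mconst_def ev_rep)
  qed
  then have "ev (inv g) = ev (inv g')" by (rule ext)
  then have "map_matrix e (\<rho> (inv g)) ** P = map_matrix e (\<rho> (inv g')) ** P"
    using g by (simp add: conjugate_rho)
  then have "(map_matrix e (\<rho> (inv g)) ** P) ** Q = (map_matrix e (\<rho> (inv g')) ** P) ** Q" by simp
  then have "map_matrix e (\<rho> (inv g)) = map_matrix e (\<rho> (inv g'))"
    by (simp add: P_Q flip: matrix_mul_assoc)
  then have "inv g = inv g'" using E.map_matrix_inj rho_inj g by (meson inv_closed)
  then show False using g \<open>g \<noteq> g'\<close> by (metis inv_inv)
qed

text \<open>The \<open>order G\<close>-th power of every eigenvalue is \<open>1\<close>, so the
  powers of one representative with exponents divisible by \<open>order G\<close> are invariant. If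
  there is no representative, the empty set does.\<close>

lemma fixed_powers:
  "\<exists>T. (coord ` reps \<noteq> ({} :: ('n, 'K) mpoly fract set) \<longrightarrow> infinite T) \<and> T \<subseteq> rat (coord ` reps) \<and>
    (\<forall>g\<in>carrier G. \<forall>t\<in>T. fdg g t = (t :: ('n, 'K) mpoly fract))"
proof (cases "reps = {}")
  case True
  then show ?thesis by (intro exI[of _ "{}"]) simp
next
  case False
  then obtain i where i: "i \<in> reps" by blast
  define t where "t k = (fmonom (Poly_Mapping.single i (order G * k)) :: ('n, 'K) mpoly fract)" for k
  have "order G > 0" using finite_G one_closed by (auto simp: order_def card_gt_0_iff)
  then have "inj t"
    by (intro injI) (auto simp: t_def fmonom_def dest!: arg_cong[of _ _ Poly_Mapping.keys]
        arg_cong[of "Poly_Mapping.single i _" _ "\<lambda>m. Poly_Mapping.lookup m i"] split: if_splits)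
  then have "infinite (range t)" by (rule range_inj_infinite)
  moreover have "t k \<in> rat (coord ` reps)" for k
    unfolding t_def using i by (intro fmonom_in_rat_reps) auto
  moreover have "fdg g (t k) = t k" if "g \<in> carrier G" for g k
    unfolding t_def using that
    by (intro fdg_fmonom) (auto simp: weight_single power_mult ev_power_order)
  ultimately show ?thesis by (intro exI[of _ "range t"]) auto
qed

text \<open>\<open>fixed_in_rat\<close> is applied inside the field generated by the
  representatives, whose transcendence degree is \<open>card reps\<close>; this is how the exponent
  \<open>N\<close> is improved.\<close>

lemma reduced_monomial_in_rat:
  assumes dep: "\<And>j. alg_dep (minvs d) (coord j)" and less: "d ^ card reps < 2 * card (carrier G)"
    and m: "\<forall>g\<in>carrier G. weight g m = 1"
  shows "fmonom (reduce m) \<in> rat (minvs_reps d)"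
proof -
  let ?U = "coord ` reps :: ('n, 'K) mpoly fract set"
  have fin: "finite ?U" by simp
  obtain T where T: "?U \<noteq> {} \<Longrightarrow> infinite T" "T \<subseteq> rat ?U" "\<And>g t. g \<in> carrier G \<Longrightarrow> t \<in> T \<Longrightarrow> fdg g t = t"
    using fixed_powers by blast
  have "\<exists>h\<in>rat ?U. inj_on (\<lambda>g. fdg g h) (carrier G)"
    by (rule exists_separating_element[where T = T, OF fin finite_G fdg_hom(1,2,3) T reps_separate])
  then obtain h where h: "h \<in> rat ?U" "inj_on (\<lambda>g. fdg g h) (carrier G)" by blast
  have sub: "minvs_reps d \<subseteq> polys ?U d"
    by (auto simp: fmonom_def lam_def intro!: single_in_polys)
  have dep_reps: "alg_dep (minvs_reps d) x" if "x \<in> ?U" for x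
    using that coord_reps_alg_dep dep by blast
  have fixed: "fdg g s = s" if "g \<in> carrier G" "s \<in> minvs_reps d" for g s
    using that by (auto simp: lam_def intro: fdg_fmonom)
  show ?thesis
  proof (rule fixed_in_rat[OF fin alg_indep_coords sub dep_reps finite_G fdg_hom(1,2,3) fixed h])
    show "fmonom (reduce m) \<in> rat ?U" by (rule fmonom_in_rat_reps[OF keys_reduce])
    show "fdg g (fmonom (reduce m)) = fmonom (reduce m)" if "g \<in> carrier G" for g
      using m that by (intro fdg_fmonom) (simp_all add: weight_reduce)
    show "d ^ card ?U < 2 * card (carrier G)"
      using less by (simp add: card_image[OF inj_on_subset[OF inj_coord]])
  qed
qed

text \<open>In \<open>power_relation\<close> the exponent of \<open>j\<close> on the right is
  positive, so some summand on the left involves \<open>j\<close>.\<close>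

lemma exists_lam:
  assumes "alg_dep (minvs d) (coord j)"
  shows "\<exists>r. Poly_Mapping.single j 1 + r \<in> lam d"
proof -
  obtain n M N where *: "0 < n" "set_mset M \<subseteq> lam d" "\<Sum>\<^sub># M = Poly_Mapping.single j n + \<Sum>\<^sub># N"
    using power_relation[OF assms] by blast
  from arg_cong[OF *(3), of "\<lambda>m. Poly_Mapping.lookup m j"]
  have "(\<Sum>a\<in>#M. Poly_Mapping.lookup a j) \<noteq> 0" using *(1) by (simp add: lookup_sum_mset lookup_add)
  then obtain a where a: "a \<in># M" "Poly_Mapping.lookup a j \<noteq> 0" by auto
  have "a = Poly_Mapping.single j 1 + (a - Poly_Mapping.single j 1)"
  proof (rule poly_mapping_eqI)
    fix k
    show "Poly_Mapping.lookup a k = Poly_Mapping.lookup (Poly_Mapping.single j 1 + (a - Poly_Mapping.single j 1)) k"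
      using a(2) by (cases "k = j") (auto simp: lookup_add lookup_minus lookup_single when_def)
  qed
  then show ?thesis using a(1) *(2) by (metis subsetD)
qed

text \<open>Exchanging one \<open>j\<close> for \<open>k\<close> in an invariant monomial that
  contains \<open>j\<close> changes neither weight nor degree; the quotient of the two monomials is
  the ratio.\<close>

lemma coord_ratio_in_rat:
  assumes "alg_dep (minvs d) (coord j)" "\<And>g. g \<in> carrier G \<Longrightarrow> ev g k = ev g j"
  shows "coord k / coord j \<in> rat (minvs d)"
proof -
  obtain r where r: "Poly_Mapping.single j 1 + r \<in> lam d" using exists_lam[OF assms(1)] by blast
  then have "Poly_Mapping.single k 1 + r \<in> lam d"
    using assms(2) by (auto simp: lam_def weight_add weight_single lookup_add sum.distrib sum_lookup_single
        simp del: One_nat_def)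
  then have "fmonom (Poly_Mapping.single k 1 + r) / fmonom (Poly_Mapping.single j 1 + r) \<in> rat (minvs d)"
    using r by (intro rat_divide rat_base) auto
  then show ?thesis by (simp add: fmonom_add fmonom_single fmonom_nonzero del: One_nat_def)
qed

text \<open>The coordinate is itself invariant, and a monomial of \<open>lam d\<close> that contains
  it shows that its degree is at most \<open>d\<close>.\<close>

lemma trivial_coord_in_rat:
  assumes "alg_dep (minvs d) (coord j)" "triv j"
  shows "coord j \<in> rat (minvs d)"
proof -
  obtain r where r: "Poly_Mapping.single j 1 + r \<in> lam d" using exists_lam[OF assms(1)] by blast
  then have "Poly_Mapping.single j 1 \<in> lam d"
    using assms(2) by (auto simp: lam_def weight_single triv_def lookup_add sum.distrib sum_lookup_single
        simp del: One_nat_def)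
  then have "fmonom (Poly_Mapping.single j 1) \<in> rat (minvs d)" by (intro rat_base) auto
  then show ?thesis by (simp add: fmonom_single del: One_nat_def)
qed

text \<open>The monomial is the product of its trivial coordinates, its reduction, and powers of the
  ratios of coordinates to their representatives.\<close>

lemma invariant_monomial_in_rat:
  assumes dep: "\<And>j. alg_dep (minvs d) (coord j)" and less: "d ^ card reps < 2 * card (carrier G)"
    and m: "\<forall>g\<in>carrier G. weight g m = 1"
  shows "fmonom m \<in> rat (minvs d)"
proof -
  let ?e = "Poly_Mapping.lookup m"
  have coord_nz: "coord j \<noteq> (0 :: ('n, 'K) mpoly fract)" for j
    using mvar_neq_0 by (simp add: coord_def)
  have fmonom_reduce: "fmonom (reduce m) = (\<Prod>j | \<not> triv j. coord (rep j) ^ ?e j :: ('n, 'K) mpoly fract)"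
  proof -
    have "fmonom (\<Sum>j\<in>A. f j) = (\<Prod>j\<in>A. fmonom (f j) :: ('n, 'K) mpoly fract)" if "finite A" for A :: "'n set" and f :: "'n \<Rightarrow> 'n \<Rightarrow>\<^sub>0 nat"
      using that by (induction A rule: finite_induct) (simp_all add: fmonom_0 fmonom_add)
    then show ?thesis by (simp add: reduce_def fmonom_single)
  qed
  have "fmonom m = (\<Prod>j | triv j. coord j ^ ?e j) * (\<Prod>j | \<not> triv j. coord j ^ ?e j :: ('n, 'K) mpoly fract)"
    unfolding fmonom_eq_prod by (subst prod.union_disjoint[symmetric]) (auto intro: prod.cong)
  also have "(\<Prod>j | \<not> triv j. coord j ^ ?e j :: ('n, 'K) mpoly fract) =
      fmonom (reduce m) * (\<Prod>j | \<not> triv j. (coord j / coord (rep j)) ^ ?e j)"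
    unfolding fmonom_reduce prod.distrib[symmetric]
    by (intro prod.cong) (simp_all add: coord_nz flip: power_mult_distrib)
  finally have eq: "(fmonom m :: ('n, 'K) mpoly fract) = (\<Prod>j | triv j. coord j ^ ?e j) *
      (fmonom (reduce m) * (\<Prod>j | \<not> triv j. (coord j / coord (rep j)) ^ ?e j))" .
  have "fmonom (reduce m) \<in> rat (minvs d)"
    using reduced_monomial_in_rat[OF dep less m] rat_mono[of "minvs_reps d" "minvs d"] by blast
  then show ?thesis unfolding eq
    by (intro rat_mult rat_prod rat_power)
       (auto intro: trivial_coord_in_rat dep coord_ratio_in_rat simp: ev_rep)
qed

lemma invariant_in_rat:
  assumes dep: "\<And>j. alg_dep (minvs d) (coord j)" and less: "d ^ card reps < 2 * card (carrier G)"
    and "\<And>g. g \<in> carrier G \<Longrightarrow> dg g F = F"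
  shows "of_mpoly F \<in> rat (minvs d)"
  unfolding of_mpoly_eq_sum_fmonom
  using keys_weight[OF assms(3)]
  by (intro rat_sum rat_mult rat_const invariant_monomial_in_rat[OF dep less]) blast+

text \<open>An invariant over \<open>k\<close> that is a quotient of invariants over \<open>K\<close> of degree at most \<open>d\<close> is also
  one over \<open>k\<close>: apply a \<open>k\<close>-linear functional \<open>K \<rightarrow> k\<close> to the coefficients of \<open>p b = q a\<close>.\<close>

lemma field_invariants_subset_rat:
  assumes dep: "\<And>j. alg_dep (minvs d) (coord j)" and less: "d ^ card reps < 2 * card (carrier G)"
  shows "field_invariants G \<rho> \<subseteq> rat (invs d)"
proof
  fix u assume u: "u \<in> field_invariants G \<rho>"
  obtain p0 q0 where u_eq: "u = Fract p0 q0" "q0 \<noteq> 0" by (cases u)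
  \<comment> \<open>Expanding the fraction by the conjugates of \<open>q0\<close> turns the
    denominator into a norm; then the numerator is invariant too.\<close>
  define q where "q = (\<Prod>h\<in>carrier G. act h q0)"
  define p where "p = p0 * (\<Prod>h\<in>carrier G - {\<one>}. act h q0)"
  have q_inv: "act g q = q" if "g \<in> carrier G" for g unfolding q_def by (rule norm_invariant[OF that])
  have q_nz: "q \<noteq> 0" unfolding q_def using finite_G u_eq(2) by (simp add: act_eq_0_iff)
  have "q = q0 * (\<Prod>h\<in>carrier G - {\<one>}. act h q0)"
    unfolding q_def using prod.remove[OF finite_G one_closed, of "\<lambda>h. act h q0"] by (simp add: act_one)
  then have "of_mpoly p0 * of_mpoly q = of_mpoly q0 * (of_mpoly p :: ('n, 'k) mpoly fract)"
    unfolding p_def of_mpoly_mult[symmetric] by (simp add: ac_simps)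
  then have u_pq: "u = of_mpoly p / of_mpoly q"
    using u_eq q_nz by (simp add: Fract_eq_divide frac_eq_eq mult.commute)
  have p_inv: "act g p = p" if g: "g \<in> carrier G" for g
  proof -
    have "of_mpoly p = u * of_mpoly q" using u_pq q_nz by simp
    then have "fract_act g (of_mpoly p) = of_mpoly p"
      using u g by (simp add: fract_act_hom[OF g] q_inv[OF g] field_invariants_eq)
    then show ?thesis by (simp add: fract_act_hom[OF g])
  qed
  have "of_mpoly (iota p) \<in> rat (minvs d)" "of_mpoly (iota q) \<in> rat (minvs d)"
    by (rule invariant_in_rat[OF dep less]; metis iota_act p_inv q_inv)+
  then have "of_mpoly (iota p) / of_mpoly (iota q) \<in> rat (minvs d)" by (rule rat_divide)
  then obtain a b where ab: "a \<in> alg (minvs d)" "b \<in> alg (minvs d)" "b \<noteq> 0"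
    "of_mpoly (iota p) / of_mpoly (iota q) = a / b"
    unfolding rat_def by blast
  obtain F where F: "a = of_mpoly F" "mcompose Q F \<in> descent d" using alg_minvs_descent[OF ab(1)] by blast
  obtain H where H: "b = of_mpoly H" "mcompose Q H \<in> descent d" using alg_minvs_descent[OF ab(2)] by blast
  have "of_mpoly (iota p) * of_mpoly H = of_mpoly F * of_mpoly (iota q)"
    using ab(3,4) q_nz F(1) H(1) by (simp add: frac_eq_eq iota_eq_0_iff)
  then have "iota p * H = F * iota q" by (simp flip: of_mpoly_mult)
  from arg_cong[OF this, of "mcompose Q"]
  have pq: "cmap e p * mcompose Q H = cmap e q * mcompose Q F"
    by (simp add: mcompose_mult mcompose_Q_iota mult.commute)
  have "invertible Q" using P_Q Q_P by (auto simp: invertible_def)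
  then have "mcompose Q H \<noteq> 0" using ab(3) H(1) by (simp add: mcompose_eq_0_iff)
  \<comment> \<open>The functional must not annihilate the denominator, so it is chosen nonzero on
    one of its coefficients.\<close>
  then obtain m where "Poly_Mapping.lookup (mcompose Q H) m \<noteq> 0"
    by (metis lookup_zero poly_mapping_eqI)
  then obtain \<phi> where \<phi>: "E.functional \<phi>" "\<phi> (Poly_Mapping.lookup (mcompose Q H) m) \<noteq> 0"
    using E.exists_functional by blast
  define B where "B = cmap \<phi> (mcompose Q H)"
  define A where "A = cmap \<phi> (mcompose Q F)"
  have "Poly_Mapping.lookup B m \<noteq> 0" using \<phi> by (simp add: B_def lookup_cmap E.functional_0)
  then have B_nz: "B \<noteq> 0" by auto
  have "p * B = q * A"
    using arg_cong[OF pq, of "cmap \<phi>"] by (simp add: E.cmap_functional_mult[OF \<phi>(1)] A_def B_def)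
  then have "of_mpoly p * of_mpoly B = of_mpoly A * (of_mpoly q :: ('n, 'k) mpoly fract)"
    by (simp add: mult.commute flip: of_mpoly_mult)
  then have "u = of_mpoly A / of_mpoly B" using u_pq q_nz B_nz by (simp add: frac_eq_eq)
  moreover have "of_mpoly A \<in> alg (invs d)" "of_mpoly B \<in> alg (invs d)"
    unfolding A_def B_def using descent_functional[OF \<phi>(1)] F(2) H(2) by auto
  ultimately show "u \<in> rat (invs d)" by (simp add: ratI)
qed

theorem beta_eq_gamma_reps:
  assumes "gamma_field G \<rho> ^ card reps < 2 * card (carrier G)"
  shows "beta_field G \<rho> = gamma_field G \<rho>"
proof (rule beta_eq_gamma_if, rule field_invariants_subset_rat[OF _ assms])
  show "alg_dep (minvs (gamma_field G \<rho>)) (coord j)" for j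
    by (rule coord_alg_dep) (use gamma_field_alg_dep in blast)
qed

text \<open>Representatives have pairwise distinct nontrivial characters, and the columns of
  \<open>P\<close> are eigenvectors in which these occur.\<close>

lemma card_reps_le:
  assumes "finite (nontrivial_characters G \<rho> e)"
  shows "card reps \<le> card (nontrivial_characters G \<rho> e)"
proof (rule card_inj_on_le[where f = "\<lambda>i. restrict (\<lambda>g. ev g i) (carrier G)", OF _ _ assms])
  show "inj_on (\<lambda>i. restrict (\<lambda>g. ev g i) (carrier G)) reps"
  proof (rule inj_onI)
    fix i j assume "i \<in> reps" "j \<in> reps"
      and eq: "restrict (\<lambda>g. ev g i) (carrier G) = restrict (\<lambda>g. ev g j) (carrier G)"
    have "ev g i = ev g j" if "g \<in> carrier G" for g using fun_cong[OF eq, of g] that by simp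
    then have "rep i = rep j" by (rule rep_eqI)
    then show "i = j" using reps_D \<open>i \<in> reps\<close> \<open>j \<in> reps\<close> by metis
  qed
  show "(\<lambda>i. restrict (\<lambda>g. ev g i) (carrier G)) ` reps \<subseteq> nontrivial_characters G \<rho> e"
  proof (rule image_subsetI)
    fix i assume "i \<in> reps"
    then obtain g where "g \<in> carrier G" "ev g i \<noteq> 1" using reps_D by (auto simp: triv_def)
    moreover have "restrict (\<lambda>g. ev g i) (carrier G) \<in> hom G (mult_of ring_of_type_algebra)"
      by (auto simp: hom_def ev_mult ev_nonzero)
    moreover have "\<exists>v. v \<noteq> 0 \<and> (\<forall>g\<in>carrier G. map_matrix e (\<rho> g) *v v = ev g i *s v)"
      using column_nonzero ev by blast
    ultimately show "restrict (\<lambda>g. ev g i) (carrier G) \<in> nontrivial_characters G \<rho> e"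
      by (auto simp: nontrivial_characters_def)
  qed
qed

end

section \<open>The root bounds and the existence of a diagonalization\<close>

lemma of_nat_root_bound:
  assumes "real d < root m (2 * real n)" "0 < m"
  shows "d ^ m < 2 * n"
proof -
  have "real d ^ m < root m (2 * real n) ^ m" using assms by (intro power_strict_mono) auto
  also have "\<dots> = 2 * real n" using assms(2) by (intro real_root_pow_pos2) auto
  finally show ?thesis by (metis of_nat_less_iff of_nat_mult of_nat_numeral of_nat_power)
qed

text \<open>Every group element is annihilated by \<open>X ^ order G - 1\<close>, which splits over
  \<open>K\<close>; its roots are distinct because \<open>order G\<close> is nonzero in
  \<open>k\<close>, hence in \<open>K\<close>. Commutativity of \<open>G\<close> allows a common
  eigenbasis.\<close>

lemma (in finite_faithful_rep) exists_diagonalization: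
  fixes e :: "'k \<Rightarrow> 'K::field"
  assumes "comm_group G" "\<not> CHAR('k) dvd order G" "field_hom e" "has_roots_of_unity TYPE('K) (order G)"
  shows "\<exists>P ev. diagonalized_rep G \<rho> e P ev"
proof -
  interpret E: field_hom e by fact
  let ?A = "\<lambda>g. map_matrix e (\<rho> g)"
  obtain zs :: "'K list" where zs: "Polynomial.monom 1 (order G) - 1 = (\<Prod>z\<leftarrow>zs. [:- z, 1:])"
    using assms(4) by (auto simp: has_roots_of_unity_def)
  have "of_nat (order G) \<noteq> (0 :: 'k)" using assms(2) by (simp add: of_nat_eq_0_iff_char_dvd)
  moreover have "e (of_nat n) = of_nat n" for n by (induction n) (simp_all add: E.e_simps)
  ultimately have "of_nat (order G) \<noteq> (0 :: 'K)" by (metis E.hom_eq_0_iff)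
  then have "distinct zs" by (rule distinct_roots_of_unity[OF zs])
  have power: "((\<lambda>w. ?A g *v w) ^^ n) v = ?A (g [^] n) *v v" if g: "g \<in> carrier G" for g and n :: nat and v
  proof (induction n arbitrary: v)
    case 0
    then show ?case by (simp add: rho_one E.map_matrix_one)
  next
    case (Suc n)
    have "((\<lambda>w. ?A g *v w) ^^ Suc n) v = ?A (g [^] n) *v (?A g *v v)"
      using Suc by (simp only: funpow_Suc_right o_apply)
    then show ?case using g by (simp add: rho_mult E.map_matrix_mult matrix_vector_mul_assoc)
  qed
  have "root_product (?A g) zs v = 0" if "g \<in> carrier G" for g v
    by (rule root_product_eq_0[OF zs])
       (simp add: power[OF that] pow_order_eq_1[OF that] rho_one E.map_matrix_one)
  moreover have "?A g ** ?A h = ?A h ** ?A g" if "g \<in> carrier G" "h \<in> carrier G" for g h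
    using comm_groupE(4)[OF assms(1), of g h] that by (metis E.map_matrix_mult rho_mult)
  ultimately obtain P :: "('K, 'n) sqmat" and ev where
    "invertible P" "\<forall>g\<in>carrier G. \<forall>j. ?A g *v column j P = ev g j *s column j P"
    using simultaneous_diagonalization[OF finite_G, of ?A] \<open>distinct zs\<close> by blast
  then have "diagonalized_rep G \<rho> e P ev"
    by unfold_locales auto
  then show ?thesis by blast
qed

theorem proposition3p8:
  fixes G :: "('g, 'b) monoid_scheme"
    and \<rho> :: "'g \<Rightarrow> ('k::field, 'n::{finite,linorder}) sqmat"
    and e :: "'k \<Rightarrow> 'K::field"
  assumes "group G" and "finite (carrier G)" and "faithful_rep G \<rho>"
  shows "(real (gamma_field G \<rho>) < root CARD('n) (2 * real (order G))
            \<longrightarrow> beta_field G \<rho> = gamma_field G \<rho>) \<and>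
         (comm_group G \<and> \<not> CHAR('k) dvd order G \<and>
          e \<in> ring_hom ring_of_type_algebra ring_of_type_algebra \<and>
          has_roots_of_unity TYPE('K) (order G) \<and>
          card (nontrivial_characters G \<rho> e) \<ge> 1 \<and>
          real (gamma_field G \<rho>) <
            root (card (nontrivial_characters G \<rho> e)) (2 * real (order G))
            \<longrightarrow> beta_field G \<rho> = gamma_field G \<rho>)"
proof (intro conjI impI)
  interpret finite_faithful_rep G \<rho>
    using assms by (simp add: finite_faithful_rep_def finite_faithful_rep_axioms_def)
  show "beta_field G \<rho> = gamma_field G \<rho>" if "real (gamma_field G \<rho>) < root CARD('n) (2 * real (order G))"
    using of_nat_root_bound[OF that] by (intro beta_eq_gamma) (simp add: order_def)
  assume *: "comm_group G \<and> \<not> CHAR('k) dvd order G \<and>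
          e \<in> ring_hom ring_of_type_algebra ring_of_type_algebra \<and>
          has_roots_of_unity TYPE('K) (order G) \<and>
          card (nontrivial_characters G \<rho> e) \<ge> 1 \<and>
          real (gamma_field G \<rho>) <
            root (card (nontrivial_characters G \<rho> e)) (2 * real (order G))"
  let ?m = "card (nontrivial_characters G \<rho> e)" and ?d = "gamma_field G \<rho>"
  have "field_hom e"
    using * by unfold_locales (auto simp: ring_hom_def)
  then obtain P ev where "diagonalized_rep G \<rho> e P ev" using exists_diagonalization * by blast
  then interpret D: diagonalized_rep G \<rho> e P ev .
  \<comment> \<open>An infinite set would have \<open>card\<close> equal to \<open>0\<close>,
    against the assumed bound.\<close>
  have "finite (nontrivial_characters G \<rho> e)" using * by (intro card_ge_0_finite) auto
  then have le: "card D.reps \<le> ?m" by (rule D.card_reps_le)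
  have less: "?d ^ ?m < 2 * card (carrier G)"
    using of_nat_root_bound[of ?d ?m "order G"] * by (simp add: order_def)
  \<comment> \<open>Passing to a smaller exponent is monotone only for a positive base. For
    \<open>?d = 0\<close> the power is at most \<open>0 ^ 0 = 1\<close>, which is still below
    \<open>2 * card (carrier G)\<close>.\<close>
  have "?d ^ card D.reps < 2 * card (carrier G)"
  proof (cases "?d = 0")
    case True
    have "card (carrier G) > 0" using assms(2) one_closed by (auto simp: card_gt_0_iff)
    then show ?thesis using True by (simp add: power_0_left)
  next
    case False
    then have "?d ^ card D.reps \<le> ?d ^ ?m" using le by (intro power_increasing) auto
    then show ?thesis using less by linarith
  qed
  then show "beta_field G \<rho> = gamma_field G \<rho>" by (rule D.beta_eq_gamma_reps)
qed

end
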